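(* There exist positive integers $p,m_1,\ldots,m_p$, a tropical variety $\Gamma\subset\mathbb R^{m_1}\times\cdots\times\mathbb R^{m_p}$ that is projection-pure and facet-selectable but not translation-admissible, and a sequence $\underline\Lambda=\Lambda_1,\ldots,\Lambda_p$ of positive tropical divisors $\Lambda_i\subset\mathbb R^{m_i}$, such that the tropical volume polynomial $\mathrm{tvol}_{\Gamma,\underline\Lambda}(t_1,\ldots,t_p)$ is not Lorentzian.
   Context: Notation. $\mathbb N=\{0,1,2,\ldots\}$, $[p]=\{1,\ldots,p\}$, $N=\mathbb Z^{m_1+\cdots+m_p}$, $N_{\mathbb R}=N\otimes\mathbb R=\mathbb R^{m_1}\times\cdots\times\mathbb R^{m_p}$. For $I\subseteq[p]$, $\Pi_I:N_{\mathbb R}\to\prod_{i\in I}\mathbb R^{m_i}$ is the natural projection (to a point if $I=\varnothing$), and $\Pi_i=\Pi_{\{i\}}$. $|\mathbf n|=\sum_in_i$, $|\mathbf n|_I=\sum_{i\in I}n_i$. Tropical varieties. A tropical variety of dimension $d$ in $N_{\mathbb R}$ is a finite rational polyhedral complex $\Gamma$, pure of dimension $d$ (in particular nonempty), with positive integer weights $\omega_\Gamma$ on its facets ($d$-dimensional cells), balanced: for every $(d-1)$-dimensional cell $\tau$, $\sum_{\sigma\supset\tau}\omega_\Gamma(\sigma)\mathbf v_{\sigma/\tau}=0$ in $N_{\mathbb R}/(N_\tau)_{\mathbb R}$, the sum being over facets $\sigma\supset\tau$, where $N_\tau$ and $(N_\tau)_{\mathbb R}$ are the lattice and linear space parallel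 to $\tau$ and $\mathbf v_{\sigma/\tau}$ is the primitive integer generator of $\sigma$ modulo $\tau$. Its support is the union of its cells; one works up to refinement. A tropical divisor has codimension $1$; a tropical curve has dimension $1$. The stable intersection $\Gamma\cap_{\mathrm{st}}\Gamma'$ is the limit as $\varepsilon\to0^+$ of $\Gamma\cap(\Gamma'+\varepsilon\mathbf v)$ for generic $\mathbf v$ (a transverse intersection), with weight $\omega_\Gamma(\sigma)\omega_{\Gamma'}(\sigma')[N:N_\sigma+N_{\sigma'}]$ on the facet $\sigma\cap(\sigma'+\varepsilon\mathbf v)$ (weights of facets with the same limit are added). The degree of a $0$-dimensional tropical variety is the sum of its weights ($0$ if empty). A tropical divisor $\Lambda_i\subset\mathbb R^{m_i}$ is positive if $\deg(\Lambda_i\cap_{\mathrm{st}}C)>0$ for every tropical curve $C\subset\mathbb R^{m_i}$. For $|\mathbf n|=d=\dim\Gamma$, $\deg^{\mathbf n}_{\underline\Lambda}(\Gamma)=\deg(\Gamma\cap_{\mathrm{st}}(\Pi_1^{-1}(\Lambda_1))^{n_1}\cap_{\mathrm{st}}\cdots\cap_{\mathrm{st}}(\Pi_p^{-1}(\Lambda_p))^{n_p})$, powers being stable self-intersections. The tropical volume polynomial is $\mathrm{tvol}_{\Gamma,\underline\Lambda}(t_1,\ldots,t_p)=\sum_{|\mathbf n|=d}\frac{d!}{n_1!\cdots n_p!}\deg^{\mathbf n}_{\underline\Lambda}(\Gamma)\,t_1^{n_1}\cdots t_p^{n_p}$. $\Gamma$ is projection-pure if for every $I\subseteq[p]$ the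 set $\Pi_I(\Gamma)$ (image of the support) is the support of a tropical variety. $\Gamma$ is facet-selectable if for every $\mathbf n\in\mathbb N^p$ with $|\mathbf n|=d$, the inequalities $|\mathbf n|_I\le\dim(\Pi_I(\Gamma))$ for all $I\subseteq[p]$ imply that there is a facet $\sigma$ of $\Gamma$ with $|\mathbf n|_I\le\dim(\Pi_I(\sigma))$ for all $I\subseteq[p]$. $\Gamma$ is translation-admissible if for every rational linear subspace $V\subseteq N_{\mathbb R}$ the Minkowski sum $\Gamma+V$ is the support of a tropical variety (equivalently, is pure-dimensional). Lorentzian. A homogeneous polynomial $h\in\mathbb R[t_1,\ldots,t_p]$ of degree $d$ is Lorentzian if its coefficients are nonnegative, its support is M-convex (equivalently, the set of lattice points of the base polytope of a polymatroid, i.e. of $\{\mathbf v\in\mathbb R^p_{\ge0}\mid\sum_{i\in I}v_i\le r(I)\ \forall I,\ \sum_iv_i=r([p])\}$ for a normalized monotone submodular $r:2^{[p]}\to\mathbb N$), and for all $1\le i_1\le\cdots\le i_{d-2}\le p$ the quadratic form $\partial_{t_{i_1}}\cdots\partial_{t_{i_{d-2}}}h$ has at most one positive eigenvalue. *)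

theory Defs
  imports
    "HOL-Analysis.Analysis"
    "HOL-Analysis.Finite_Function_Topology"
    "Jordan_Normal_Form.Char_Poly"
begin

section \<open>Vectors, lattices, polyhedra\<close>

text \<open>
  Dimensions are quantified inside the statement, so real vectors are finitely supported functions
  and the space with coordinate set \<open>J\<close> is the subspace \<open>euclid J\<close>. All the library notions for real
  normed vector spaces (span, dim, convexity, faces, limits) are available for this type.
\<close>

type_synonym 'k rvec = "'k \<Rightarrow>\<^sub>0 real"

definition euclid :: "'k set \<Rightarrow> 'k rvec set" where
  "euclid J = {x. Poly_Mapping.keys x \<subseteq> J}"

definition int_lattice :: "'k set \<Rightarrow> 'k rvec set" where
  "int_lattice J = {x \<in> euclid J. \<forall>k. Poly_Mapping.lookup x k \<in> \<int>}"

definition pairing :: "'k set \<Rightarrow> 'k rvec \<Rightarrow> 'k rvec \<Rightarrow> real" where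
  "pairing J a x = (\<Sum>k\<in>J. Poly_Mapping.lookup a k * Poly_Mapping.lookup x k)"

text \<open>Rational slopes, arbitrary real constant terms.\<close>

definition rational_polyhedron :: "'k set \<Rightarrow> 'k rvec set \<Rightarrow> bool" where
  "rational_polyhedron J P \<longleftrightarrow>
     (\<exists>F :: ('k rvec \<times> real) set. finite F \<and> fst ` F \<subseteq> int_lattice J \<and>
        P = {x \<in> euclid J. \<forall>(a, b)\<in>F. pairing J a x \<le> b})"

definition lin_space :: "'k rvec set \<Rightarrow> 'k rvec set" where
  "lin_space \<sigma> = span {x - y |x y. x \<in> \<sigma> \<and> y \<in> \<sigma>}"

definition cell_dim :: "'k rvec set \<Rightarrow> nat" where
  "cell_dim \<sigma> = dim (lin_space \<sigma>)"

definition cell_lattice :: "'k set \<Rightarrow> 'k rvec set \<Rightarrow> 'k rvec set" where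
  "cell_lattice J \<sigma> = int_lattice J \<inter> lin_space \<sigma>"

definition sum_set :: "'k rvec set \<Rightarrow> 'k rvec set \<Rightarrow> 'k rvec set" where
  "sum_set A B = {a + b |a b. a \<in> A \<and> b \<in> B}"

definition subgroup_index :: "'k rvec set \<Rightarrow> 'k rvec set \<Rightarrow> nat" where
  "subgroup_index L M = card (L // {(x, y). x \<in> L \<and> y \<in> L \<and> x - y \<in> M})"

section \<open>Tropical varieties\<close>

text \<open>Only the values of \<open>weight\<close> on facets are meaningful.\<close>

record 'k tropical =
  cells :: "'k rvec set set"
  weight :: "'k rvec set \<Rightarrow> nat"

definition tdim :: "'k tropical \<Rightarrow> nat" where
  "tdim \<Gamma> = Max (cell_dim ` cells \<Gamma>)"

definition facets :: "'k tropical \<Rightarrow> 'k rvec set set" where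
  "facets \<Gamma> = {\<sigma> \<in> cells \<Gamma>. cell_dim \<sigma> = tdim \<Gamma>}"

definition support :: "'k tropical \<Rightarrow> 'k rvec set" where
  "support \<Gamma> = \<Union> (cells \<Gamma>)"

text \<open>Cells are nonempty; the empty set counts as a face of every cell.\<close>

definition polyhedral_complex :: "'k set \<Rightarrow> 'k rvec set set \<Rightarrow> bool" where
  "polyhedral_complex J K \<longleftrightarrow>
     finite K \<and>
     (\<forall>\<sigma>\<in>K. \<sigma> \<noteq> {} \<and> rational_polyhedron J \<sigma>) \<and>
     (\<forall>\<sigma>\<in>K. \<forall>\<rho>. \<rho> face_of \<sigma> \<and> \<rho> \<noteq> {} \<longrightarrow> \<rho> \<in> K) \<and>
     (\<forall>\<sigma>\<in>K. \<forall>\<sigma>'\<in>K. (\<sigma> \<inter> \<sigma>') face_of \<sigma> \<and> (\<sigma> \<inter> \<sigma>') face_of \<sigma>')"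

text \<open>
  For a face \<open>\<tau>\<close> of codimension one of \<open>\<sigma>\<close>: \<open>u\<close> generates the lattice of \<open>\<sigma>\<close> modulo that of \<open>\<tau>\<close>
  (so it is unique up to sign modulo the latter) and points from \<open>\<tau>\<close> into \<open>\<sigma>\<close>.
\<close>

definition primitive_generator ::
    "'k set \<Rightarrow> 'k rvec set \<Rightarrow> 'k rvec set \<Rightarrow> 'k rvec \<Rightarrow> bool" where
  "primitive_generator J \<tau> \<sigma> u \<longleftrightarrow>
     u \<in> cell_lattice J \<sigma> \<and>
     cell_lattice J \<sigma> = {w + of_int k *\<^sub>R u |w k. w \<in> cell_lattice J \<tau>} \<and>
     (\<exists>x\<in>\<tau>. \<exists>t>0. x + t *\<^sub>R u \<in> \<sigma>)"

definition balanced :: "'k set \<Rightarrow> 'k tropical \<Rightarrow> bool" where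
  "balanced J \<Gamma> \<longleftrightarrow>
     (\<forall>\<tau>\<in>cells \<Gamma>. cell_dim \<tau> + 1 = tdim \<Gamma> \<longrightarrow>
        (\<exists>v. (\<forall>\<sigma>\<in>facets \<Gamma>. \<tau> \<subseteq> \<sigma> \<longrightarrow> primitive_generator J \<tau> \<sigma> (v \<sigma>)) \<and>
             (\<Sum>\<sigma> | \<sigma> \<in> facets \<Gamma> \<and> \<tau> \<subseteq> \<sigma>. of_nat (weight \<Gamma> \<sigma>) *\<^sub>R v \<sigma>) \<in> lin_space \<tau>))"

definition tropical_variety :: "'k set \<Rightarrow> 'k tropical \<Rightarrow> bool" where
  "tropical_variety J \<Gamma> \<longleftrightarrow>
     polyhedral_complex J (cells \<Gamma>) \<and>
     cells \<Gamma> \<noteq> {} \<and>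
     (\<forall>\<sigma>\<in>cells \<Gamma>. \<exists>\<rho>\<in>facets \<Gamma>. \<sigma> \<subseteq> \<rho>) \<and>
     (\<forall>\<sigma>\<in>facets \<Gamma>. 0 < weight \<Gamma> \<sigma>) \<and>
     balanced J \<Gamma>"

definition tropical_curve :: "'k set \<Rightarrow> 'k tropical \<Rightarrow> bool" where
  "tropical_curve J C \<longleftrightarrow> tropical_variety J C \<and> tdim C = 1"

definition tropical_divisor :: "'k set \<Rightarrow> 'k tropical \<Rightarrow> bool" where
  "tropical_divisor J D \<longleftrightarrow> tropical_variety J D \<and> tdim D + 1 = card J"

section \<open>Stable intersection\<close>

definition generic :: "'k set \<Rightarrow> 'k tropical \<Rightarrow> 'k tropical \<Rightarrow> 'k rvec \<Rightarrow> bool" where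
  "generic J \<Gamma> \<Gamma>' v \<longleftrightarrow>
     v \<in> euclid J \<and>
     (\<forall>\<^sub>F \<epsilon> in at_right (0::real). \<forall>\<sigma>\<in>cells \<Gamma>. \<forall>\<sigma>'\<in>cells \<Gamma>'.
        \<sigma> \<inter> (+) (\<epsilon> *\<^sub>R v) ` \<sigma>' \<noteq> {} \<longrightarrow> sum_set (lin_space \<sigma>) (lin_space \<sigma>') = euclid J)"

text \<open>
  The set limit of \<open>\<sigma> \<inter> (\<sigma>' + \<epsilon>v)\<close> for \<open>\<epsilon> \<rightarrow> 0+\<close>. The set of \<open>\<epsilon> > 0\<close> for which the intersection of two
  polyhedra is nonempty is an interval, so the intersection is either nonempty for all small \<open>\<epsilon>\<close> or
  empty for all small \<open>\<epsilon>\<close>; in the latter case the limit is empty.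
\<close>

definition limit_cell :: "'k rvec \<Rightarrow> 'k rvec set \<Rightarrow> 'k rvec set \<Rightarrow> 'k rvec set" where
  "limit_cell v \<sigma> \<sigma>' =
     {x. \<exists>y :: real \<Rightarrow> 'k rvec.
           (\<forall>\<^sub>F \<epsilon> in at_right 0. y \<epsilon> \<in> \<sigma> \<inter> (+) (\<epsilon> *\<^sub>R v) ` \<sigma>') \<and> (y \<longlongrightarrow> x) (at_right 0)}"

text \<open>
  The facets are the limits of the transverse intersections of facets. Limits of smaller dimension
  (a bounded intersection may collapse) are not facets of the limit complex.
\<close>

definition displaced_facets ::
    "'k set \<Rightarrow> 'k rvec \<Rightarrow> 'k tropical \<Rightarrow> 'k tropical \<Rightarrow> 'k rvec set set" where
  "displaced_facets J v \<Gamma> \<Gamma>' =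
     {\<tau>. \<tau> \<noteq> {} \<and> (\<exists>\<sigma>\<in>facets \<Gamma>. \<exists>\<sigma>'\<in>facets \<Gamma>'.
            \<tau> = limit_cell v \<sigma> \<sigma>' \<and> cell_dim \<tau> + card J = cell_dim \<sigma> + cell_dim \<sigma>')}"

definition displaced_intersection ::
    "'k set \<Rightarrow> 'k rvec \<Rightarrow> 'k tropical \<Rightarrow> 'k tropical \<Rightarrow> 'k tropical" where
  "displaced_intersection J v \<Gamma> \<Gamma>' =
     \<lparr>cells = {\<rho>. \<rho> \<noteq> {} \<and> (\<exists>\<tau>\<in>displaced_facets J v \<Gamma> \<Gamma>'. \<rho> face_of \<tau>)},
      weight = (\<lambda>\<tau>. \<Sum>(\<sigma>, \<sigma>') | \<sigma> \<in> facets \<Gamma> \<and> \<sigma>' \<in> facets \<Gamma>' \<and> limit_cell v \<sigma> \<sigma>' = \<tau>.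
         weight \<Gamma> \<sigma> * weight \<Gamma>' \<sigma>' *
         subgroup_index (int_lattice J) (sum_set (cell_lattice J \<sigma>) (cell_lattice J \<sigma>')))\<rparr>"

text \<open>
  For balanced complexes all generic displacements give the same result; an arbitrary one is chosen.
  The result may be the empty complex.
\<close>

definition stable_intersection ::
    "'k set \<Rightarrow> 'k tropical \<Rightarrow> 'k tropical \<Rightarrow> 'k tropical" where
  "stable_intersection J \<Gamma> \<Gamma>' = displaced_intersection J (SOME v. generic J \<Gamma> \<Gamma>' v) \<Gamma> \<Gamma>'"

definition whole_space :: "'k set \<Rightarrow> 'k tropical" where
  "whole_space J = \<lparr>cells = {euclid J}, weight = (\<lambda>_. 1)\<rparr>"

primrec stable_power :: "'k set \<Rightarrow> 'k tropical \<Rightarrow> nat \<Rightarrow> 'k tropical" where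
  "stable_power J \<Gamma> 0 = whole_space J"
| "stable_power J \<Gamma> (Suc n) = stable_intersection J (stable_power J \<Gamma> n) \<Gamma>"

definition tropical_degree :: "'k tropical \<Rightarrow> nat" where
  "tropical_degree \<Gamma> = (\<Sum>\<sigma>\<in>facets \<Gamma>. weight \<Gamma> \<sigma>)"

definition positive_divisor :: "'k set \<Rightarrow> 'k tropical \<Rightarrow> bool" where
  "positive_divisor J D \<longleftrightarrow>
     tropical_divisor J D \<and>
     (\<forall>C. tropical_curve J C \<longrightarrow> 0 < tropical_degree (stable_intersection J D C))"

section \<open>The multigraded setting\<close>

text \<open>
  The coordinate \<open>(i, j)\<close> is the \<open>j\<close>-th one of the \<open>i\<close>-th factor, so that the product of the factors
  with index in \<open>I\<close> is \<open>euclid (blocks m I)\<close> and the whole space is \<open>euclid (blocks m {1..p})\<close>.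
\<close>

definition blocks :: "(nat \<Rightarrow> nat) \<Rightarrow> nat set \<Rightarrow> (nat \<times> nat) set" where
  "blocks m I = Sigma I (\<lambda>i. {1..m i})"

definition proj :: "(nat \<Rightarrow> nat) \<Rightarrow> nat set \<Rightarrow> (nat \<times> nat) rvec \<Rightarrow> (nat \<times> nat) rvec" where
  "proj m I x = (\<Sum>k\<in>blocks m I. Poly_Mapping.single k (Poly_Mapping.lookup x k))"

definition pullback ::
    "nat \<Rightarrow> (nat \<Rightarrow> nat) \<Rightarrow> nat \<Rightarrow> (nat \<times> nat) tropical \<Rightarrow> (nat \<times> nat) tropical" where
  "pullback p m i D =
     \<lparr>cells = (\<lambda>\<sigma>. {x \<in> euclid (blocks m {1..p}). proj m {i} x \<in> \<sigma>}) ` cells D,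
      weight = (\<lambda>\<sigma>. weight D (proj m {i} ` \<sigma>))\<rparr>"

text \<open>Exponents are finitely supported functions on the positive integers.\<close>

definition exponents :: "nat \<Rightarrow> nat \<Rightarrow> (nat \<Rightarrow>\<^sub>0 nat) set" where
  "exponents p d =
     {n. Poly_Mapping.keys n \<subseteq> {1..p} \<and> (\<Sum>i=1..p. Poly_Mapping.lookup n i) = d}"

definition multidegree ::
    "nat \<Rightarrow> (nat \<Rightarrow> nat) \<Rightarrow> (nat \<times> nat) tropical \<Rightarrow> (nat \<Rightarrow> (nat \<times> nat) tropical) \<Rightarrow>
     (nat \<Rightarrow>\<^sub>0 nat) \<Rightarrow> nat" where
  "multidegree p m \<Gamma> \<Lambda> n =
     (let J = blocks m {1..p} in
      tropical_degree
        (foldl (\<lambda>\<Delta> i. stable_intersection J \<Delta>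
                        (stable_power J (pullback p m i (\<Lambda> i)) (Poly_Mapping.lookup n i)))
               \<Gamma> [1..<Suc p]))"

text \<open>
  A polynomial is the finitely supported function sending an exponent to its coefficient.
\<close>

type_synonym rpoly = "(nat \<Rightarrow>\<^sub>0 nat) \<Rightarrow>\<^sub>0 real"

definition tvol ::
    "nat \<Rightarrow> (nat \<Rightarrow> nat) \<Rightarrow> (nat \<times> nat) tropical \<Rightarrow> (nat \<Rightarrow> (nat \<times> nat) tropical) \<Rightarrow> rpoly" where
  "tvol p m \<Gamma> \<Lambda> =
     (\<Sum>n\<in>exponents p (tdim \<Gamma>).
        Poly_Mapping.single n
          (fact (tdim \<Gamma>) / (\<Prod>i=1..p. fact (Poly_Mapping.lookup n i))
             * real (multidegree p m \<Gamma> \<Lambda> n)))"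

definition projection_pure :: "nat \<Rightarrow> (nat \<Rightarrow> nat) \<Rightarrow> (nat \<times> nat) tropical \<Rightarrow> bool" where
  "projection_pure p m \<Gamma> \<longleftrightarrow>
     (\<forall>I\<subseteq>{1..p}. \<exists>\<Delta>. tropical_variety (blocks m I) \<Delta> \<and> support \<Delta> = proj m I ` support \<Gamma>)"

text \<open>The image of the support is a finite union of polyhedra: its dimension is the largest one.\<close>

definition proj_dim :: "(nat \<Rightarrow> nat) \<Rightarrow> nat set \<Rightarrow> (nat \<times> nat) tropical \<Rightarrow> nat" where
  "proj_dim m I \<Gamma> = Max ((\<lambda>\<sigma>. cell_dim (proj m I ` \<sigma>)) ` cells \<Gamma>)"

definition facet_selectable :: "nat \<Rightarrow> (nat \<Rightarrow> nat) \<Rightarrow> (nat \<times> nat) tropical \<Rightarrow> bool" where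
  "facet_selectable p m \<Gamma> \<longleftrightarrow>
     (\<forall>n\<in>exponents p (tdim \<Gamma>).
        (\<forall>I\<subseteq>{1..p}. (\<Sum>i\<in>I. Poly_Mapping.lookup n i) \<le> proj_dim m I \<Gamma>) \<longrightarrow>
        (\<exists>\<sigma>\<in>facets \<Gamma>. \<forall>I\<subseteq>{1..p}.
           (\<Sum>i\<in>I. Poly_Mapping.lookup n i) \<le> cell_dim (proj m I ` \<sigma>)))"

definition rational_subspace :: "'k set \<Rightarrow> 'k rvec set \<Rightarrow> bool" where
  "rational_subspace J V \<longleftrightarrow> subspace V \<and> V \<subseteq> euclid J \<and> V = span (V \<inter> int_lattice J)"

definition translation_admissible :: "'k set \<Rightarrow> 'k tropical \<Rightarrow> bool" where
  "translation_admissible J \<Gamma> \<longleftrightarrow>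
     (\<forall>V. rational_subspace J V \<longrightarrow>
        (\<exists>\<Delta>. tropical_variety J \<Delta> \<and> support \<Delta> = sum_set (support \<Gamma>) V))"

section \<open>Lorentzian polynomials\<close>

definition partial_deriv :: "nat \<Rightarrow> rpoly \<Rightarrow> rpoly" where
  "partial_deriv i h =
     (\<Sum>n\<in>Poly_Mapping.keys h.
        Poly_Mapping.single (n - Poly_Mapping.single i 1)
          (real (Poly_Mapping.lookup n i) * Poly_Mapping.lookup h n))"

text \<open>The exchange property of discrete convex analysis.\<close>

definition M_convex :: "(nat \<Rightarrow>\<^sub>0 nat) set \<Rightarrow> bool" where
  "M_convex S \<longleftrightarrow>
     (\<forall>a\<in>S. \<forall>b\<in>S. \<forall>i. Poly_Mapping.lookup b i < Poly_Mapping.lookup a i \<longrightarrow>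
        (\<exists>j. Poly_Mapping.lookup a j < Poly_Mapping.lookup b j \<and>
             a - Poly_Mapping.single i 1 + Poly_Mapping.single j 1 \<in> S))"

text \<open>The symmetric matrix of a quadratic form in \<open>t\<^sub>1, \<dots>, t\<^sub>p\<close>; matrix indices start at 0.\<close>

definition quadratic_form_mat :: "nat \<Rightarrow> rpoly \<Rightarrow> real mat" where
  "quadratic_form_mat p q =
     mat p p (\<lambda>(i, j).
       Poly_Mapping.lookup q (Poly_Mapping.single (Suc i) 1 + Poly_Mapping.single (Suc j) 1)
         / (if i = j then 1 else 2))"

text \<open>Eigenvalues are counted with multiplicity.\<close>

definition num_pos_eigenvalues :: "real mat \<Rightarrow> nat" where
  "num_pos_eigenvalues A = (\<Sum>k | eigenvalue A k \<and> 0 < k. Polynomial.order k (char_poly A))"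

definition lorentzian :: "nat \<Rightarrow> nat \<Rightarrow> rpoly \<Rightarrow> bool" where
  "lorentzian p d h \<longleftrightarrow>
     Poly_Mapping.keys h \<subseteq> exponents p d \<and>
     (\<forall>n. 0 \<le> Poly_Mapping.lookup h n) \<and>
     M_convex (Poly_Mapping.keys h) \<and>
     (\<forall>is. length is + 2 = d \<and> sorted is \<and> set is \<subseteq> {1..p} \<longrightarrow>
        num_pos_eigenvalues (quadratic_form_mat p (foldr partial_deriv is h)) \<le> 1)"

end

theory Submission
  imports Defs
begin

text \<open>
  The example consists of two planes of \<open>\<real>\<^sup>4\<close> with weight \<open>1\<close>, placed in the parallel hyperplanes
  \<open>x\<^sub>5 = 0\<close> and \<open>x\<^sub>5 = 1\<close> of \<open>\<real>\<^sup>5 = \<real> \<times> \<dots> \<times> \<real>\<close>. Every divisor \<open>\<Lambda>\<^sub>i\<close> is the origin of the line.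
  The fifth factor serves only to make the planes disjoint: affine spaces that do not meet form a complex
  without cells of codimension one, so there is nothing to balance (\<open>disjoint_affine_tropical\<close>).

  The pullback of \<open>\<Lambda>\<^sub>i\<close> is the hyperplane \<open>x\<^sub>i = 0\<close>, and the degree of a plane with respect to the
  hyperplanes \<open>i\<close> and \<open>j\<close> is the absolute value of its Pluecker coordinate \<open>p\<^sub>i\<^sub>j\<close>. The volume polynomial is
  twice the quadratic form with coefficients \<open>\<bar>p\<^sub>i\<^sub>j\<bar> + \<bar>q\<^sub>i\<^sub>j\<bar>\<close>. For one plane this form has a single positive
  eigenvalue, but a sum of two such forms can have two: the spans of \<open>2 e\<^sub>1 + e\<^sub>4, 2 e\<^sub>2 + e\<^sub>3\<close> and of
  \<open>e\<^sub>1 + 2 e\<^sub>4, e\<^sub>2 + 2 e\<^sub>3\<close> give \<open>10 (t\<^sub>1 t\<^sub>2 + t\<^sub>3 t\<^sub>4) + 8 (t\<^sub>1 t\<^sub>3 + t\<^sub>2 t\<^sub>4)\<close>, whose matrix has the positive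
  eigenvalues \<open>9\<close> and \<open>1\<close>. All complexes that occur while these degrees are computed are families of
  disjoint affine spaces of the same dimension; \<open>stable_intersection_hyperplane\<close> describes how a coordinate
  hyperplane cuts such a family, and \<open>represents_cut_power\<close> follows the two planes through all the cuts.

  Both planes project to the same dimension under every \<open>\<Pi>\<^sub>I\<close>. Hence either of them can be selected for
  every exponent, and the image of their union is pure. It remains to see that the image supports a
  tropical variety. If \<open>5 \<in> I\<close>, it consists of disjoint affine spaces again. Otherwise it consists of two
  linear spaces that may cross, and has to be subdivided. Both planes are products of a line in the
  coordinates \<open>1, 4\<close> and a line in the coordinates \<open>2, 3\<close>; the origin cuts these lines into rays, and the
  products of the rays are the cones of a unimodular simplicial fan. Its set of cones is closed
  under replacing one generator of a cone by its negative, which makes it balanced (\<open>symmetric_fan_tropical\<close>,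
  \<open>crossing_planes_tropical\<close>).

  The sum of the two planes with a line contained in the direction of the first one consists of
  disjoint spaces of dimensions two and three, and is therefore not the support of a pure complex
  (\<open>affine_cover\<close> excludes that cells of dimension two cover the larger space).

  Finally, the origin of the line is a positive divisor because the support of a tropical curve in the
  line is the whole line (\<open>curve_support\<close>): at a boundary point of the support all edges would leave on
  the same side, against balancing.
\<close>

section \<open>Coordinates\<close>

abbreviation lookup :: "('k \<Rightarrow>\<^sub>0 'b::zero) \<Rightarrow> 'k \<Rightarrow> 'b" where
  "lookup \<equiv> Poly_Mapping.lookup"

abbreviation single :: "'k \<Rightarrow> 'b::zero \<Rightarrow> 'k \<Rightarrow>\<^sub>0 'b" where
  "single \<equiv> Poly_Mapping.single"

lemma lookup_scaleR [simp]: "lookup (r *\<^sub>R x) k = r * lookup (x :: 'k rvec) k"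
proof -
  have "{i. r * lookup x i \<noteq> 0} \<subseteq> {i. lookup x i \<noteq> 0}" by auto
  then have "finite {i. r * lookup x i \<noteq> 0}"
    using finite_lookup finite_subset by blast
  then show ?thesis by (simp add: scaleR_poly_mapping_def)
qed

lemma lookup_sum: "lookup (sum f A) k = (\<Sum>a\<in>A. lookup (f a) k)"
  by (induction A rule: infinite_finite_induct) (simp_all add: lookup_add)

lemma bounded_linear_lookup: "bounded_linear (\<lambda>x :: 'k rvec. lookup x k)"
proof (rule bounded_linear_intro[where K = 1])
  fix x :: "'k rvec"
  show "norm (lookup x k) \<le> norm x * 1"
  proof (cases "k \<in> Poly_Mapping.keys x")
    case True
    then have "norm (lookup x k) \<le> (\<Sum>n\<in>Poly_Mapping.keys x. norm (lookup x n))"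
      by (intro member_le_sum) auto
    then show ?thesis by (simp add: norm_poly_mapping_def dist_poly_mapping_def)
  qed (simp add: in_keys_iff)
qed (simp_all add: lookup_add)

lemma tendsto_lookup:
  "(f \<longlongrightarrow> x) F \<Longrightarrow> ((\<lambda>t. lookup (f t :: 'k rvec) k) \<longlongrightarrow> lookup x k) F"
  by (rule bounded_linear.tendsto[OF bounded_linear_lookup])

lemma continuous_on_lookup [continuous_intros]:
  "continuous_on S (\<lambda>x :: 'k rvec. lookup x k)"
  by (rule bounded_linear.continuous_on[OF bounded_linear_lookup continuous_on_id])

lemma euclid_iff: "x \<in> euclid J \<longleftrightarrow> (\<forall>k. k \<notin> J \<longrightarrow> lookup x k = 0)"
  by (auto simp: euclid_def in_keys_iff)

lemma subspace_euclid: "subspace (euclid J)"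
  by (auto simp: subspace_def euclid_iff lookup_add)

lemma euclid_mono: "J \<subseteq> K \<Longrightarrow> euclid J \<subseteq> euclid K"
  by (auto simp: euclid_def)

lemma single_in_euclid: "k \<in> J \<Longrightarrow> single k c \<in> euclid J"
  by (auto simp: euclid_iff lookup_single when_def)

lemma scaleR_single [simp]: "r *\<^sub>R single k c = single k (r * c :: real)"
  by (rule poly_mapping_eqI) (simp add: lookup_single when_def)

lemma euclid_expand:
  assumes "finite J" "x \<in> euclid J"
  shows "x = (\<Sum>k\<in>J. lookup x k *\<^sub>R single k 1)"
proof (rule poly_mapping_eqI)
  fix j
  show "lookup x j
        = lookup (\<Sum>k\<in>J. lookup x k *\<^sub>R single k 1) j"
    using assms by (auto simp: lookup_sum lookup_single when_def euclid_iff)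
qed

lemma span_units:
  assumes "finite J"
  shows "span ((\<lambda>k. single k (1::real)) ` J) = euclid J"
proof
  show "span ((\<lambda>k. single k (1::real)) ` J) \<subseteq> euclid J"
    by (rule span_minimal) (auto simp: single_in_euclid subspace_euclid)
  show "euclid J \<subseteq> span ((\<lambda>k. single k (1::real)) ` J)"
  proof
    fix x :: "'a rvec" assume "x \<in> euclid J"
    then have "x = (\<Sum>k\<in>J. lookup x k *\<^sub>R single k 1)"
      using assms euclid_expand by blast
    also have "\<dots> \<in> span ((\<lambda>k. single k (1::real)) ` J)"
      by (intro span_sum span_scale span_base) auto
    finally show "x \<in> span ((\<lambda>k. single k (1::real)) ` J)" .
  qed
qed

lemma independent_units: "independent ((\<lambda>k. single k (1::real)) ` J)"
proof (subst independent_explicit_finite_subsets, intro allI impI ballI)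
  fix S u v
  assume S: "S \<subseteq> (\<lambda>k. single k (1::real)) ` J" "finite S"
    and z: "(\<Sum>w\<in>S. u w *\<^sub>R w) = 0" and v: "v \<in> S"
  obtain k where k: "v = single k 1" using S v by auto
  have "u w * lookup w k = (if w = v then u v else 0)" if w: "w \<in> S" for w
  proof (cases "w = v")
    case False
    obtain j where j: "w = single j 1" using S w by auto
    then have "j \<noteq> k" using False k by auto
    then show ?thesis using False j by (simp add: lookup_single_not_eq)
  next
    case True
    then show ?thesis using k by simp
  qed
  then have "(\<Sum>w\<in>S. u w * lookup w k) = u v"
    using S v by simp
  moreover have "(\<Sum>w\<in>S. u w * lookup w k) = lookup (\<Sum>w\<in>S. u w *\<^sub>R w) k"
    by (simp add: lookup_sum)
  ultimately show "u v = 0" using z by simp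
qed

text \<open>
  The ambient type has infinite dimension, and \<open>dim\<close> is \<open>0\<close> by convention on its infinite-dimensional
  subspaces. Monotonicity therefore has to be confined to subspaces of some \<open>euclid J\<close> with \<open>J\<close> finite.
\<close>

lemma finite_basis:
  assumes "finite J" "V \<subseteq> euclid J"
  obtains B where "B \<subseteq> V" "independent B" "V \<subseteq> span B" "finite B" "card B = dim V"
proof -
  obtain B where B: "B \<subseteq> V" "independent B" "V \<subseteq> span B" "card B = dim V"
    by (rule basis_exists)
  have "B \<subseteq> span ((\<lambda>k. single k (1::real)) ` J)"
    using B assms by (simp add: span_units)
  then have "finite B"
    using independent_span_bound[of "(\<lambda>k. single k (1::real)) ` J" B] B assms by auto
  with B that show thesis by blast
qed

lemma dim_mono_euclid:
  assumes "finite J" "W \<subseteq> euclid J" "V \<subseteq> W"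
  shows "dim V \<le> dim W"
proof -
  obtain B where B: "W \<subseteq> span B" "finite B" "card B = dim W"
    using finite_basis[OF assms(1,2)] by metis
  then show ?thesis using dim_le_card[of V B] assms(3) by auto
qed

lemma dim_euclid:
  assumes "finite J"
  shows "dim (euclid J) = card J"
proof -
  have inj: "inj_on (\<lambda>k. single k (1::real)) J"
    by (rule inj_onI) (metis lookup_single_eq lookup_single_not_eq one_neq_zero)
  have "dim (euclid J) = card ((\<lambda>k. single k (1::real)) ` J)"
    using dim_span_eq_card_independent[OF independent_units[of J]] span_units[OF assms] by simp
  then show ?thesis using inj by (simp add: card_image)
qed

definition coord_part :: "'k set \<Rightarrow> 'k rvec \<Rightarrow> 'k rvec" where
  "coord_part K x = (\<Sum>k\<in>K. single k (lookup x k))"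

lemma lookup_coord_part:
  "finite K \<Longrightarrow> lookup (coord_part K x) j = (if j \<in> K then lookup x j else 0)"
  by (simp add: coord_part_def lookup_sum lookup_single when_def)

lemma coord_part_in_euclid: "finite K \<Longrightarrow> coord_part K x \<in> euclid K"
  by (simp add: euclid_iff lookup_coord_part)

lemma coord_part_id: "finite K \<Longrightarrow> x \<in> euclid K \<Longrightarrow> coord_part K x = x"
  by (rule poly_mapping_eqI) (auto simp: lookup_coord_part euclid_iff)

lemma linear_coord_part: "finite K \<Longrightarrow> linear (coord_part K)"
  by (rule linearI) (auto intro!: poly_mapping_eqI simp: lookup_coord_part lookup_add)

lemma coord_part_split:
  assumes "finite J" "finite K" "J \<inter> K = {}" "x \<in> euclid (J \<union> K)"
  shows "x = coord_part J x + coord_part K x"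
  using assms by (intro poly_mapping_eqI) (auto simp: lookup_coord_part lookup_add euclid_iff)

text \<open>Sums of vectors from complementary coordinate subspaces decompose uniquely.\<close>

lemma sum_disjoint_eq:
  assumes "J \<inter> K = {}" "a \<in> euclid J" "a' \<in> euclid J" "b \<in> euclid K" "b' \<in> euclid K"
    and "a + b = a' + b'"
  shows "a = a'" "b = b'"
proof -
  have *: "lookup a k + lookup b k
           = lookup a' k + lookup b' k" for k
    using assms(6) by (metis lookup_add)
  have "lookup a k = lookup a' k
      \<and> lookup b k = lookup b' k" for k
  proof -
    have "k \<notin> J \<or> k \<notin> K" using assms(1) by auto
    then show ?thesis using *[of k] assms(2-5) by (auto simp: euclid_iff)
  qed
  then show "a = a'" "b = b'" by (auto intro: poly_mapping_eqI)
qed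

section \<open>Rational polyhedra\<close>

lemma rational_polyhedron_in_euclid: "rational_polyhedron J P \<Longrightarrow> P \<subseteq> euclid J"
  by (auto simp: rational_polyhedron_def)

lemma pairing_add: "pairing J a (x + y) = pairing J a x + pairing J a y"
  by (simp add: pairing_def lookup_add algebra_simps sum.distrib)

lemma pairing_scaleR: "pairing J a (c *\<^sub>R x) = c * pairing J a x"
  by (simp add: pairing_def sum_distrib_left algebra_simps)

lemma pairing_single:
  "finite J \<Longrightarrow> k \<in> J \<Longrightarrow> pairing J (single k c) x = c * lookup x k"
  by (simp add: pairing_def lookup_single when_def if_distrib [of "\<lambda>z. z * _"] cong: if_cong)

lemma closed_rational_polyhedron:
  assumes "rational_polyhedron J P"
  shows "closed P"
proof -
  obtain F where F: "P = {x \<in> euclid J. \<forall>(a, b)\<in>F. pairing J a x \<le> b}"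
    using assms by (auto simp: rational_polyhedron_def)
  have "P = (\<Inter>k\<in>-J. {x. lookup x k = 0}) \<inter> (\<Inter>(a, b)\<in>F. {x. pairing J a x \<le> b})"
    by (auto simp: F euclid_iff)
  moreover have "closed {x :: 'a rvec. lookup x k = 0}" for k
    by (intro closed_Collect_eq continuous_intros)
  moreover have "closed {x :: 'a rvec. pairing J a x \<le> b}" for a b
    unfolding pairing_def by (intro closed_Collect_le continuous_intros)
  ultimately show ?thesis by (auto intro!: closed_Int closed_INT)
qed

lemma convex_rational_polyhedron:
  assumes "rational_polyhedron J P"
  shows "convex P"
proof -
  obtain F where F: "P = {x \<in> euclid J. \<forall>(a, b)\<in>F. pairing J a x \<le> b}"
    using assms by (auto simp: rational_polyhedron_def)
  have "pairing J a (s *\<^sub>R x + t *\<^sub>R y) \<le> b"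
    if "pairing J a x \<le> b" "pairing J a y \<le> b" "0 \<le> s" "0 \<le> t" "s + t = 1" for a b x y s t
    unfolding pairing_add pairing_scaleR using that
    by (metis convex_bound_le)
  note conv = this
  show ?thesis
    unfolding convex_def
  proof (intro ballI allI impI)
    fix x y :: "'a rvec" and s t :: real
    assume *: "x \<in> P" "y \<in> P" "0 \<le> s" "0 \<le> t" "s + t = 1"
    then have "s *\<^sub>R x + t *\<^sub>R y \<in> euclid J"
      by (intro subspace_add[OF subspace_euclid] subspace_scale[OF subspace_euclid]) (auto simp: F)
    moreover have "pairing J a (s *\<^sub>R x + t *\<^sub>R y) \<le> b" if "(a, b) \<in> F" for a b
      using conv[of a x b y s t] * that by (auto simp: F)
    ultimately show "s *\<^sub>R x + t *\<^sub>R y \<in> P" by (auto simp: F)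
  qed
qed

lemma int_lattice_iff:
  "x \<in> int_lattice J \<longleftrightarrow> x \<in> euclid J \<and> (\<forall>k. lookup x k \<in> \<int>)"
  by (simp add: int_lattice_def)

lemma int_lattice_add: "x \<in> int_lattice J \<Longrightarrow> y \<in> int_lattice J \<Longrightarrow> x + y \<in> int_lattice J"
  by (auto simp: int_lattice_iff lookup_add subspace_add[OF subspace_euclid])

lemma int_lattice_minus: "x \<in> int_lattice J \<Longrightarrow> - x \<in> int_lattice J"
  by (auto simp: int_lattice_iff subspace_neg[OF subspace_euclid])

lemma int_lattice_scale: "x \<in> int_lattice J \<Longrightarrow> c \<in> \<int> \<Longrightarrow> c *\<^sub>R x \<in> int_lattice J"
  by (auto simp: int_lattice_iff subspace_scale[OF subspace_euclid])

lemma int_lattice_0: "0 \<in> int_lattice J"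
  by (auto simp: int_lattice_iff subspace_0[OF subspace_euclid])

lemma int_lattice_single: "k \<in> J \<Longrightarrow> c \<in> \<int> \<Longrightarrow> single k c \<in> int_lattice J"
  by (auto simp: int_lattice_iff single_in_euclid lookup_single when_def)

text \<open>
  Every cell below is a sum of lines, rays and points in complementary sets of coordinates, so this
  lemma reduces its inequalities to those of one line or ray.
\<close>

lemma rational_polyhedron_sum:
  assumes fin: "finite J" "finite K" and dis: "J \<inter> K = {}"
    and P: "rational_polyhedron J P" and Q: "rational_polyhedron K Q"
  shows "rational_polyhedron (J \<union> K) (sum_set P Q)"
proof -
  obtain F where F: "finite F" "fst ` F \<subseteq> int_lattice J"
      "P = {x \<in> euclid J. \<forall>(a, b)\<in>F. pairing J a x \<le> b}"
    using P by (auto simp: rational_polyhedron_def)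
  obtain G where G: "finite G" "fst ` G \<subseteq> int_lattice K"
      "Q = {x \<in> euclid K. \<forall>(a, b)\<in>G. pairing K a x \<le> b}"
    using Q by (auto simp: rational_polyhedron_def)
  have pF: "pairing (J \<union> K) a (x + y) = pairing J a x" if "(a, b) \<in> F" "y \<in> euclid K" for a b x y
  proof -
    have "a \<in> euclid J" using that(1) F(2) by (force simp: int_lattice_iff)
    then have "pairing (J \<union> K) a (x + y) = pairing J a (x + y)"
      unfolding pairing_def using fin by (intro sum.mono_neutral_right) (auto simp: euclid_iff)
    also have "\<dots> = pairing J a x"
      unfolding pairing_def using that(2) dis
      by (intro sum.cong) (auto simp: euclid_iff lookup_add disjoint_iff)
    finally show ?thesis .
  qed
  have pG: "pairing (J \<union> K) a (x + y) = pairing K a y" if "(a, b) \<in> G" "x \<in> euclid J" for a b x y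
  proof -
    have "a \<in> euclid K" using that(1) G(2) by (force simp: int_lattice_iff)
    then have "pairing (J \<union> K) a (x + y) = pairing K a (x + y)"
      unfolding pairing_def using fin by (intro sum.mono_neutral_right) (auto simp: euclid_iff)
    also have "\<dots> = pairing K a y"
      unfolding pairing_def using that(2) dis
      by (intro sum.cong) (auto simp: euclid_iff lookup_add disjoint_iff)
    finally show ?thesis .
  qed
  have "sum_set P Q = {x \<in> euclid (J \<union> K). \<forall>(a, b)\<in>F \<union> G. pairing (J \<union> K) a x \<le> b}" (is "_ = ?R")
  proof
    show "sum_set P Q \<subseteq> ?R"
    proof
      fix z assume "z \<in> sum_set P Q"
      then obtain x y where z: "z = x + y" "x \<in> P" "y \<in> Q" by (auto simp: sum_set_def)
      then have e: "x \<in> euclid J" "y \<in> euclid K" by (auto simp: F(3) G(3))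
      then have "z \<in> euclid (J \<union> K)" by (auto simp: z euclid_iff lookup_add)
      moreover have "pairing (J \<union> K) a z \<le> b" if "(a, b) \<in> F \<union> G" for a b
        using that pF[of a b y x] pG[of a b x y] e z by (auto simp: F(3) G(3))
      ultimately show "z \<in> ?R" by auto
    qed
    show "?R \<subseteq> sum_set P Q"
    proof
      fix z assume z: "z \<in> ?R"
      define x where "x = coord_part J z"
      define y where "y = coord_part K z"
      have e: "x \<in> euclid J" "y \<in> euclid K" by (auto simp: x_def y_def fin coord_part_in_euclid)
      have zz: "z = x + y" using coord_part_split[OF fin dis] z by (auto simp: x_def y_def)
      have zle: "pairing (J \<union> K) a (x + y) \<le> b" if "(a, b) \<in> F \<union> G" for a b
        using z that unfolding zz[symmetric] by auto
      have "pairing J a x \<le> b" if "(a, b) \<in> F" for a b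
        using zle[of a b] pF[OF that e(2), of x] that by simp
      then have "x \<in> P" using e(1) by (auto simp: F(3))
      moreover have "pairing K a y \<le> b" if "(a, b) \<in> G" for a b
        using zle[of a b] pG[OF that e(1), of y] that by simp
      then have "y \<in> Q" using e(2) by (auto simp: G(3))
      ultimately show "z \<in> sum_set P Q" using zz by (auto simp: sum_set_def)
    qed
  qed
  moreover have "int_lattice J \<subseteq> int_lattice (J \<union> K)" "int_lattice K \<subseteq> int_lattice (J \<union> K)"
    by (auto simp: int_lattice_iff euclid_iff)
  ultimately show ?thesis
    unfolding rational_polyhedron_def using F(1,2) G(1,2)
    by (intro exI[of _ "F \<union> G"]) auto
qed

text \<open>Each coordinate is bounded on both sides by that of the point.\<close>

lemma rational_polyhedron_point:
  assumes J: "finite J" and p: "p \<in> euclid J"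
  shows "rational_polyhedron J {p}"
proof -
  define F :: "('a rvec \<times> real) set" where "F =
    (\<lambda>(s, k). (single k s, s * lookup p k)) ` ({1, -1} \<times> J)"
  have eq: "{x \<in> euclid J. \<forall>(a, b)\<in>F. pairing J a x \<le> b} = {p}" (is "?L = _")
  proof
    show "?L \<subseteq> {p}"
    proof
      fix x assume x: "x \<in> ?L"
      have "lookup x k = lookup p k" for k
      proof (cases "k \<in> J")
        case True
        have "pairing J (single k s) x \<le> s * lookup p k"
          if "s \<in> {1, -1}" for s
          using x that True by (force simp: F_def)
        from this[of 1] this[of "-1"] show ?thesis using True J by (simp add: pairing_single)
      qed (use x p in \<open>auto simp: euclid_iff\<close>)
      then show "x \<in> {p}" by (auto intro: poly_mapping_eqI)
    qed
    show "{p} \<subseteq> ?L" using p J by (auto simp: F_def pairing_single)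
  qed
  have "finite F" "fst ` F \<subseteq> int_lattice J"
    using J by (auto simp: F_def intro!: int_lattice_single)
  with eq show ?thesis unfolding rational_polyhedron_def by (intro exI[of _ F]) auto
qed

text \<open>
  The vectors parallel to \<open>g\<close> are cut out by the equations
  \<open>g\<^sub>i x\<^sub>j = g\<^sub>j x\<^sub>i\<close>, with integer coefficients when \<open>g\<close> is integral.
\<close>

lemma parallel_equations:
  assumes J: "finite J" and g: "g \<in> int_lattice J" "g \<noteq> 0"
  obtains F where "finite F" "fst ` F \<subseteq> int_lattice J"
    "{x \<in> euclid J. \<forall>(a, b)\<in>F. pairing J a x \<le> b} = range (\<lambda>c. c *\<^sub>R g)"
proof -
  define a where "a = (\<lambda>(i, j). single j (lookup g i)
                          - single i (lookup g j))"
  define F where "F = (\<lambda>ij. (a ij, 0::real)) ` (J \<times> J)"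
  have pa: "pairing J (a (i, j)) x = lookup g i * lookup x j
                - lookup g j * lookup x i" if "i \<in> J" "j \<in> J" for i j x
  proof -
    have "pairing J (a (i, j)) x = pairing J (single j (lookup g i)) x
             - pairing J (single i (lookup g j)) x"
      by (simp add: a_def pairing_def lookup_minus algebra_simps sum_subtractf)
    then show ?thesis using that J by (simp add: pairing_single)
  qed
  have ge: "g \<in> euclid J" using g by (simp add: int_lattice_iff)
  have gn: "\<exists>i\<in>J. lookup g i \<noteq> 0"
  proof (rule ccontr)
    assume "\<not> ?thesis"
    then have "g = 0" using ge by (intro poly_mapping_eqI) (auto simp: euclid_iff)
    with g show False by simp
  qed
  then obtain i where i: "i \<in> J" "lookup g i \<noteq> 0" by blast
  have "{x \<in> euclid J. \<forall>(a, b)\<in>F. pairing J a x \<le> b} = range (\<lambda>c. c *\<^sub>R g)" (is "?L = ?R")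
  proof
    show "?L \<subseteq> ?R"
    proof
      fix x assume x: "x \<in> ?L"
      have le: "lookup g i * lookup x j
                - lookup g j * lookup x i \<le> 0" if "i \<in> J" "j \<in> J" for i j
        using x that pa[OF that] by (force simp: F_def)
      have "x = (lookup x i / lookup g i) *\<^sub>R g"
      proof (rule poly_mapping_eqI)
        fix j
        show "lookup x j
          = lookup ((lookup x i / lookup g i) *\<^sub>R g) j"
        proof (cases "j \<in> J")
          case True
          then show ?thesis using le[of i j] le[of j i] i by (simp add: field_simps)
        qed (use x ge in \<open>auto simp: euclid_iff\<close>)
      qed
      then show "x \<in> ?R" by blast
    qed
    show "?R \<subseteq> ?L"
      using ge by (auto simp: F_def pa subspace_scale[OF subspace_euclid] simp del: split_paired_All)
  qed
  moreover have "finite F" using J by (simp add: F_def)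
  moreover have "a (i, j) \<in> int_lattice J" if "i \<in> J" "j \<in> J" for i j
    using that g unfolding a_def prod.case diff_conv_add_uminus
    by (intro int_lattice_add int_lattice_minus int_lattice_single) (auto simp: int_lattice_iff[of g])
  then have "fst ` F \<subseteq> int_lattice J" by (auto simp: F_def)
  ultimately show thesis using that by blast
qed

lemma rational_polyhedron_line:
  assumes "finite J" "g \<in> int_lattice J"
  shows "rational_polyhedron J (range (\<lambda>c. c *\<^sub>R g))"
proof (cases "g = 0")
  case True
  then show ?thesis
    using rational_polyhedron_point[OF assms(1), of 0] by (simp add: subspace_0[OF subspace_euclid])
next
  case False
  obtain F where "finite F" "fst ` F \<subseteq> int_lattice J"
    "{x \<in> euclid J. \<forall>(a, b)\<in>F. pairing J a x \<le> b} = range (\<lambda>c. c *\<^sub>R g)"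
    by (rule parallel_equations[OF assms False])
  then show ?thesis
    unfolding rational_polyhedron_def by (intro exI[of _ F]) auto
qed

lemma rational_polyhedron_ray:
  assumes J: "finite J" and g: "g \<in> int_lattice J"
  shows "rational_polyhedron J ((\<lambda>c. c *\<^sub>R g) ` {0..})"
proof (cases "g = 0")
  case True
  have "(\<lambda>c::real. c *\<^sub>R g) ` {0..} = {0}" using True by auto
  then show ?thesis
    using rational_polyhedron_point[OF assms(1), of 0] by (simp add: subspace_0[OF subspace_euclid])
next
  case False
  obtain F where F: "finite F" "fst ` F \<subseteq> int_lattice J"
    "{x \<in> euclid J. \<forall>(a, b)\<in>F. pairing J a x \<le> b} = range (\<lambda>c. c *\<^sub>R g)"
    by (rule parallel_equations[OF J g False])
  have neg: "pairing J (-g) (c *\<^sub>R g) \<le> 0 \<longleftrightarrow> 0 \<le> c" for c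
  proof -
    have e: "pairing J (-g) (c *\<^sub>R g) = - c * (\<Sum>k\<in>J. lookup g k ^ 2)"
      by (simp add: pairing_def sum_distrib_left sum_negf power2_eq_square algebra_simps)
    have "\<exists>i\<in>J. lookup g i \<noteq> 0"
    proof (rule ccontr)
      assume "\<not> ?thesis"
      then have "g = 0" using g by (intro poly_mapping_eqI) (auto simp: euclid_iff int_lattice_iff)
      with False show False by simp
    qed
    then have "0 < (\<Sum>k\<in>J. lookup g k ^ 2)"
      using J by (auto intro!: sum_pos2)
    then show ?thesis unfolding e by (simp add: zero_le_mult_iff)
  qed
  (* among the multiples of g, the inequality -g \<le> 0 singles out the nonnegative ones *)
  have "{x \<in> euclid J. \<forall>(a, b)\<in>insert (-g, 0) F. pairing J a x \<le> b}
      = {x \<in> range (\<lambda>c. c *\<^sub>R g). pairing J (-g) x \<le> 0}"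
    unfolding F(3)[symmetric] by auto
  also have "\<dots> = (\<lambda>c. c *\<^sub>R g) ` {0..}" using neg by auto
  finally show ?thesis
    unfolding rational_polyhedron_def using F(1,2) int_lattice_minus[OF g]
    by (intro exI[of _ "insert (-g, 0) F"]) auto
qed

section \<open>Affine cells\<close>

lemma subspace_lin_space: "subspace (lin_space \<sigma>)"
  by (simp add: lin_space_def)

lemma lin_space_mono: "\<sigma> \<subseteq> \<tau> \<Longrightarrow> lin_space \<sigma> \<subseteq> lin_space \<tau>"
  unfolding lin_space_def by (intro span_mono) blast

lemma diff_in_lin_space: "x \<in> \<sigma> \<Longrightarrow> y \<in> \<sigma> \<Longrightarrow> x - y \<in> lin_space \<sigma>"
  unfolding lin_space_def by (intro span_base) blast

lemma lin_space_euclid: "\<sigma> \<subseteq> euclid J \<Longrightarrow> lin_space \<sigma> \<subseteq> euclid J"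
  unfolding lin_space_def
  by (intro span_minimal subspace_euclid) (auto intro: subspace_diff[OF subspace_euclid])

lemma cell_dim_mono:
  "finite J \<Longrightarrow> \<tau> \<subseteq> euclid J \<Longrightarrow> \<sigma> \<subseteq> \<tau> \<Longrightarrow> cell_dim \<sigma> \<le> cell_dim \<tau>"
  unfolding cell_dim_def by (intro dim_mono_euclid lin_space_mono lin_space_euclid)

lemma lin_space_translate:
  assumes "subspace L"
  shows "lin_space ((+) p ` L) = L"
proof -
  have "{x - y |x y. x \<in> (+) p ` L \<and> y \<in> (+) p ` L} = L"
  proof
    show "{x - y |x y. x \<in> (+) p ` L \<and> y \<in> (+) p ` L} \<subseteq> L"
      using assms by (auto intro: subspace_diff)
    show "L \<subseteq> {x - y |x y. x \<in> (+) p ` L \<and> y \<in> (+) p ` L}"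
    proof
      fix z assume "z \<in> L"
      moreover have "z = (p + z) - (p + 0)" by simp
      ultimately show "z \<in> {x - y |x y. x \<in> (+) p ` L \<and> y \<in> (+) p ` L}"
        using subspace_0[OF assms] by blast
    qed
  qed
  then show ?thesis using assms by (simp add: lin_space_def span_eq_iff)
qed

lemma affine_translate_lin_space:
  assumes "affine \<sigma>" "p \<in> \<sigma>"
  shows "\<sigma> = (+) p ` lin_space \<sigma>"
proof -
  define L where "L = (\<lambda>x. - p + x) ` \<sigma>"
  have "subspace L" unfolding L_def by (rule affine_diffs_subspace[OF assms])
  moreover have e: "\<sigma> = (+) p ` L" by (force simp: L_def image_image)
  ultimately show ?thesis using lin_space_translate by metis
qed

lemma lin_space_subspace: "subspace L \<Longrightarrow> lin_space L = L"
  using lin_space_translate[of L 0] by simp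

lemma lin_space_point [simp]: "lin_space {p} = {0}"
  by (simp add: lin_space_def)

lemma cell_dim_point [simp]: "cell_dim {p} = 0"
  using dim_span[of "{}::'a rvec set"] dim_eq_card_independent[of "{}::'a rvec set"]
  by (simp add: cell_dim_def independent_empty)

text \<open>
  A vector space over an infinite field is not a finite union of proper affine subspaces: a line
  joining a point that avoids all members but one to a point that avoids this one meets each
  member at most once, so it has a point outside all of them.
\<close>

lemma affine_cover:
  fixes W :: "'k rvec set"
  assumes "finite \<A>" "affine W" "W \<noteq> {}" "\<And>A. A \<in> \<A> \<Longrightarrow> affine A" "W \<subseteq> \<Union>\<A>"
  shows "\<exists>A\<in>\<A>. W \<subseteq> A"
proof (rule ccontr)
  assume "\<not> ?thesis"
  then have neg: "\<And>A. A \<in> \<A> \<Longrightarrow> \<not> W \<subseteq> A" by blast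
  have "\<exists>x\<in>W. x \<notin> \<Union>\<A>"
    using assms(1,4) neg
  proof (induction \<A> rule: finite_induct)
    case empty
    then show ?case using assms(3) by blast
  next
    case (insert A \<A>)
    then obtain x where x: "x \<in> W" "x \<notin> \<Union>\<A>" by auto
    show ?case
    proof (cases "x \<in> A")
      case True
      obtain y where y: "y \<in> W" "y \<notin> A" using insert.prems(2)[of A] by auto
      define ln where "ln t = (1 - t) *\<^sub>R x + t *\<^sub>R y" for t :: real
      have two: "ln r \<in> B" if "affine B" "ln s \<in> B" "ln t \<in> B" "s \<noteq> t" for B r s t
      proof -
        have "ln r = ((t - r) / (t - s)) *\<^sub>R ln s + ((r - s) / (t - s)) *\<^sub>R ln t"
        proof -
          have c1: "(1 - r) = ((t - r) / (t - s)) * (1 - s) + ((r - s) / (t - s)) * (1 - t)"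
            and c2: "r = ((t - r) / (t - s)) * s + ((r - s) / (t - s)) * t"
            using that(4) by (simp_all add: divide_simps) (simp_all add: algebra_simps)
          have "((t - r) / (t - s)) *\<^sub>R ln s + ((r - s) / (t - s)) *\<^sub>R ln t
             = (((t - r) / (t - s)) * (1 - s) + ((r - s) / (t - s)) * (1 - t)) *\<^sub>R x
               + (((t - r) / (t - s)) * s + ((r - s) / (t - s)) * t) *\<^sub>R y"
            by (simp only: ln_def scaleR_add_left scaleR_add_right scaleR_scaleR add_ac)
          also have "\<dots> = ln r" unfolding c1[symmetric] c2[symmetric] by (simp add: ln_def)
          finally show ?thesis by simp
        qed
        moreover have "(t - r) / (t - s) + (r - s) / (t - s) = 1"
          using that(4) by (simp add: divide_simps)
        ultimately show ?thesis using that(1-3) mem_affine by metis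
      qed
      have ln0: "ln 0 = x" and ln1: "ln 1 = y" by (simp_all add: ln_def)
      have A: "t = 0" if "ln t \<in> A" for t
        using two[of A t 0 1] that True y insert.prems(1)[of A] ln0 ln1 by auto
      have once: "s = t" if "B \<in> \<A>" "ln s \<in> B" "ln t \<in> B" for B s t
        using two[of B s t 0] that x insert.prems(1)[of B] ln0 by auto
      have fin: "finite {t. ln t \<in> B}" if B: "B \<in> \<A>" for B
      proof (cases "\<exists>s. ln s \<in> B")
        case True
        then obtain s where s: "ln s \<in> B" by blast
        have "{t. ln t \<in> B} \<subseteq> {s}" using once[OF B _ s] by blast
        then show ?thesis using finite_subset by blast
      qed auto
      have "finite (insert 0 (\<Union>B\<in>\<A>. {t. ln t \<in> B}))" using insert.hyps(1) fin by auto
      then obtain t where t: "t \<notin> insert 0 (\<Union>B\<in>\<A>. {t. ln t \<in> B})"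
        using ex_new_if_finite infinite_UNIV_char_0 by blast
      have "ln t \<in> W"
        unfolding ln_def using mem_affine[OF assms(2) x(1) y(1), of "1 - t" t] by simp
      moreover have "ln t \<notin> \<Union>(insert A \<A>)" using t A by auto
      ultimately show ?thesis by blast
    qed (use x in auto)
  qed
  then show False using assms(5) by blast
qed

definition flat :: "'k rvec \<Rightarrow> 'k rvec \<Rightarrow> 'k rvec \<Rightarrow> 'k rvec set" where
  "flat b u w = (+) b ` span {u, w}"

lemma span2_iff: "z \<in> span {u, w} \<longleftrightarrow> (\<exists>x y. z = x *\<^sub>R u + y *\<^sub>R w)"
proof -
  have "z \<in> span {u, w} \<longleftrightarrow> (\<exists>x y. z - x *\<^sub>R u = y *\<^sub>R w)"
    by (auto simp: span_breakdown_eq[of _ u] span_singleton)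
  then show ?thesis by (simp add: diff_eq_eq add.commute)
qed

lemma flat_iff: "z \<in> flat b u w \<longleftrightarrow> (\<exists>x y. z = b + (x *\<^sub>R u + y *\<^sub>R w))"
  by (simp only: flat_def image_iff Bex_def span2_iff) blast

lemma lin_space_flat [simp]: "lin_space (flat b u w) = span {u, w}"
  by (simp add: flat_def lin_space_translate)

lemma affine_flat: "affine (flat b u w)"
  unfolding flat_def by (simp add: affine_translation[symmetric] subspace_imp_affine)

lemma base_in_flat: "b \<in> flat b u w"
  unfolding flat_def using span_zero by force

lemma flat_swap: "flat b u w = flat b w u"
  by (simp add: flat_def insert_commute)

lemma linear_image_flat:
  assumes "linear f"
  shows "f ` flat b u w = flat (f b) (f u) (f w)"
proof -
  have "f ` (+) b ` S = (+) (f b) ` f ` S" for S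
    by (simp only: image_image linear_add[OF assms])
  moreover have "f ` span {u, w} = span {f u, f w}"
    using linear_span_image[OF assms, of "{u, w}"] by simp
  ultimately show ?thesis by (simp add: flat_def)
qed

lemma rational_polyhedron_span2:
  assumes "finite J" "finite K" "J \<inter> K = {}" "u \<in> int_lattice J" "w \<in> int_lattice K"
  shows "rational_polyhedron (J \<union> K) (span {u, w})"
proof -
  have "span {u, w} = sum_set (range (\<lambda>c. c *\<^sub>R u)) (range (\<lambda>c. c *\<^sub>R w))"
    by (simp only: set_eq_iff sum_set_def span2_iff mem_Collect_eq) blast
  then show ?thesis
    using rational_polyhedron_sum[OF assms(1-3)] rational_polyhedron_line assms by metis
qed

lemma rational_polyhedron_flat:
  assumes "finite J" "finite K" "finite L" "J \<inter> K = {}" "L \<inter> (J \<union> K) = {}"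
    and "u \<in> int_lattice J" "w \<in> int_lattice K" "b \<in> euclid L"
  shows "rational_polyhedron (L \<union> (J \<union> K)) (flat b u w)"
proof -
  have "flat b u w = sum_set {b} (span {u, w})" by (auto simp: flat_def sum_set_def)
  then show ?thesis
    using rational_polyhedron_sum[OF assms(3) _ assms(5) rational_polyhedron_point[OF assms(3,8)]
        rational_polyhedron_span2[OF assms(1,2,4,6,7)]] assms(1,2) by simp
qed

lemma independent_disjoint_pair:
  assumes "J \<inter> K = {}" "u \<in> euclid J" "w \<in> euclid K" "u \<noteq> 0" "w \<noteq> 0"
  shows "independent {u, w}" "u \<noteq> w"
proof -
  have *: "u \<noteq> c *\<^sub>R w" for c
    using sum_disjoint_eq(1)[OF assms(1,2), of 0 0 "c *\<^sub>R w"] assms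
    by (auto simp: subspace_0[OF subspace_euclid] subspace_scale[OF subspace_euclid])
  have "u \<notin> span {w}" using * by (auto simp: span_singleton)
  moreover have "independent {w}" using assms by (simp add: independent_insert)
  ultimately show "independent {u, w}" by (simp add: independent_insert)
  show "u \<noteq> w" using *[of 1] by simp
qed

lemma dim_span_disjoint_pair:
  assumes "J \<inter> K = {}" "u \<in> euclid J" "w \<in> euclid K"
  shows "dim (span {u, w}) = of_bool (u \<noteq> 0) + of_bool (w \<noteq> 0)"
proof -
  have one: "dim (span {v}) = of_bool (v \<noteq> 0)" for v :: "'a rvec"
    using dim_span_eq_card_independent[of "{v} - {0}"] cell_dim_point[of 0]
    by (cases "v = 0") (simp_all add: independent_insert independent_empty cell_dim_def)
  consider "u = 0" | "w = 0" | "u \<noteq> 0" "w \<noteq> 0" by blast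
  then show ?thesis
  proof cases
    case 1 then show ?thesis using one[of w] by simp
  next
    case 2
    then show ?thesis using one[of u] by (simp add: insert_commute[of u 0])
  next
    case 3
    then show ?thesis
      using independent_disjoint_pair[OF assms 3] dim_span_eq_card_independent[of "{u, w}"] by simp
  qed
qed

section \<open>Disjoint affine cells form a tropical variety\<close>

abbreviation unweighted :: "'k rvec set set \<Rightarrow> 'k tropical" where
  "unweighted K \<equiv> \<lparr>cells = K, weight = \<lambda>_. 1\<rparr>"

text \<open>
  A complex whose cells are disjoint affine spaces of the same dimension has no cell of codimension
  one, so that there is nothing to balance.
\<close>

lemma disjoint_affine_tropical:
  assumes "finite K" "K \<noteq> {}"
    and "\<And>\<sigma>. \<sigma> \<in> K \<Longrightarrow> \<sigma> \<noteq> {} \<and> affine \<sigma> \<and> rational_polyhedron J \<sigma> \<and> cell_dim \<sigma> = d"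
    and "disjoint K"
  shows "tropical_variety J (unweighted K)" (is "tropical_variety J ?\<Gamma>")
    and "tdim (unweighted K) = d"
proof -
  have "cell_dim ` K = {d}" using assms(2,3) by (auto simp: image_iff)
  then show td: "tdim ?\<Gamma> = d" by (simp add: tdim_def)
  then have f: "facets ?\<Gamma> = K" using assms(3) by (auto simp: facets_def)
  have "polyhedral_complex J K"
    unfolding polyhedral_complex_def
  proof (intro conjI ballI allI impI)
    fix \<sigma> \<rho> assume "\<sigma> \<in> K" "\<rho> face_of \<sigma> \<and> \<rho> \<noteq> {}"
    then show "\<rho> \<in> K" using assms(3) face_of_affine_trivial by metis
  next
    fix \<sigma> \<sigma>' assume K: "\<sigma> \<in> K" "\<sigma>' \<in> K"
    have "\<sigma> \<inter> \<sigma>' = {} \<or> \<sigma> = \<sigma>'" using K assms(4) by (auto simp: disjoint_def)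
    moreover have "convex \<sigma>" "convex \<sigma>'" using K assms(3) affine_imp_convex by auto
    ultimately show "\<sigma> \<inter> \<sigma>' face_of \<sigma>" "\<sigma> \<inter> \<sigma>' face_of \<sigma>'" by (auto intro: face_of_refl)
  qed (use assms in auto)
  then show "tropical_variety J ?\<Gamma>"
    using assms(2,3) td f by (auto simp: tropical_variety_def balanced_def)
qed

section \<open>Stable intersection of disjoint affine cells with a coordinate hyperplane\<close>

lemma limit_cell_subset_closed:
  assumes "closed \<sigma>"
  shows "limit_cell v \<sigma> \<sigma>' \<subseteq> \<sigma>"
proof
  fix x assume "x \<in> limit_cell v \<sigma> \<sigma>'"
  then obtain y :: "real \<Rightarrow> _" where y: "\<forall>\<^sub>F \<epsilon> in at_right 0. y \<epsilon> \<in> \<sigma> \<inter> (+) (\<epsilon> *\<^sub>R v) ` \<sigma>'"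
      "(y \<longlongrightarrow> x) (at_right 0)"
    by (auto simp: limit_cell_def)
  have "\<forall>\<^sub>F \<epsilon> in at_right 0. y \<epsilon> \<in> \<sigma>" by (rule eventually_mono[OF y(1)]) simp
  then show "x \<in> \<sigma>" by (rule Lim_in_closed_set[OF assms _ _ y(2)]) simp
qed

lemma translate_hyperplane_iff:
  assumes "v \<in> euclid J" "k \<in> J"
  shows "x \<in> (+) (t *\<^sub>R v) ` euclid (J - {k})
     \<longleftrightarrow> x \<in> euclid J \<and> lookup x k = t * lookup v k"
proof
  assume "x \<in> (+) (t *\<^sub>R v) ` euclid (J - {k})"
  then show "x \<in> euclid J \<and> lookup x k = t * lookup v k"
    using assms by (auto simp: euclid_iff lookup_add)
next
  assume "x \<in> euclid J \<and> lookup x k = t * lookup v k"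
  then have "x - t *\<^sub>R v \<in> euclid (J - {k})" using assms by (auto simp: euclid_iff lookup_minus)
  then show "x \<in> (+) (t *\<^sub>R v) ` euclid (J - {k})" by (auto simp: image_iff intro: bexI[of _ "x - t *\<^sub>R v"])
qed

definition transverse :: "'k \<Rightarrow> 'k rvec set \<Rightarrow> bool" where
  "transverse k \<sigma> \<longleftrightarrow> (\<exists>g\<in>lin_space \<sigma>. lookup g k \<noteq> 0)"

lemma limit_cell_transverse:
  assumes v: "v \<in> euclid J" and k: "k \<in> J"
    and \<sigma>: "affine \<sigma>" "closed \<sigma>" "\<sigma> \<subseteq> euclid J" and tr: "transverse k \<sigma>"
  shows "limit_cell v \<sigma> (euclid (J - {k})) = \<sigma> \<inter> euclid (J - {k})"
proof
  show "limit_cell v \<sigma> (euclid (J - {k})) \<subseteq> \<sigma> \<inter> euclid (J - {k})"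
  proof
    fix x assume x: "x \<in> limit_cell v \<sigma> (euclid (J - {k}))"
    then have "x \<in> \<sigma>" using limit_cell_subset_closed[OF \<sigma>(2)] by blast
    obtain y :: "real \<Rightarrow> _"
      where y: "\<forall>\<^sub>F \<epsilon> in at_right 0. y \<epsilon> \<in> \<sigma> \<inter> (+) (\<epsilon> *\<^sub>R v) ` euclid (J - {k})"
        "(y \<longlongrightarrow> x) (at_right 0)"
      using x by (auto simp: limit_cell_def)
    have "((\<lambda>\<epsilon>. lookup (y \<epsilon>) k) \<longlongrightarrow> lookup x k) (at_right 0)"
      by (rule tendsto_lookup[OF y(2)])
    moreover have "\<forall>\<^sub>F \<epsilon> in at_right 0. lookup (y \<epsilon>) k = \<epsilon> * lookup v k"
      using y(1) by (rule eventually_mono) (simp add: translate_hyperplane_iff[OF v k])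
    ultimately have "((\<lambda>\<epsilon>. \<epsilon> * lookup v k) \<longlongrightarrow> lookup x k) (at_right 0)"
      by (simp add: tendsto_cong)
    moreover have "((\<lambda>\<epsilon>. \<epsilon> * lookup v k) \<longlongrightarrow> 0 * lookup v k) (at_right (0::real))"
      by (intro tendsto_intros)
    ultimately have "lookup x k = 0"
      using tendsto_unique[of "at_right (0::real)"] by fastforce
    with \<open>x \<in> \<sigma>\<close> \<sigma>(3) show "x \<in> \<sigma> \<inter> euclid (J - {k})" by (auto simp: euclid_iff)
  qed
next
  show "\<sigma> \<inter> euclid (J - {k}) \<subseteq> limit_cell v \<sigma> (euclid (J - {k}))"
  proof
    fix x assume x: "x \<in> \<sigma> \<inter> euclid (J - {k})"
    obtain g where g: "g \<in> lin_space \<sigma>" "lookup g k \<noteq> 0"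
      using tr by (auto simp: transverse_def)
    define y where "y \<epsilon> = x + (\<epsilon> * lookup v k / lookup g k) *\<^sub>R g" for \<epsilon> :: real
    have "y \<epsilon> \<in> \<sigma> \<inter> (+) (\<epsilon> *\<^sub>R v) ` euclid (J - {k})" for \<epsilon>
    proof -
      have "\<sigma> = (+) x ` lin_space \<sigma>" using affine_translate_lin_space[OF \<sigma>(1)] x by blast
      then have "y \<epsilon> \<in> \<sigma>"
        unfolding y_def using subspace_scale[OF subspace_lin_space g(1)] by blast
      moreover have "lookup (y \<epsilon>) k = \<epsilon> * lookup v k"
        using x g(2) by (simp add: y_def lookup_add euclid_iff)
      ultimately show ?thesis using \<sigma>(3) by (auto simp: translate_hyperplane_iff[OF v k])
    qed
    moreover have "(y \<longlongrightarrow> x + (0 * lookup v k / lookup g k) *\<^sub>R g) (at_right 0)"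
      unfolding y_def by (intro tendsto_intros) (rule g(2))
    ultimately show "x \<in> limit_cell v \<sigma> (euclid (J - {k}))"
      unfolding limit_cell_def mem_Collect_eq
      by (intro exI[of _ y] conjI always_eventually allI) simp_all
  qed
qed

lemma not_transverse_const:
  assumes "\<not> transverse k \<sigma>" "x \<in> \<sigma>" "y \<in> \<sigma>"
  shows "lookup x k = lookup y k"
  using assms diff_in_lin_space[of x \<sigma> y] by (auto simp: transverse_def lookup_minus)

text \<open>
  A cell parallel to the hyperplane meets the displaced hyperplanes in the empty set or in the whole
  cell. Either way it contributes no facet, because the dimension of the limit is not the expected one.
\<close>

lemma limit_cell_parallel:
  assumes v: "v \<in> euclid J" and k: "k \<in> J"
    and \<sigma>: "closed \<sigma>" "\<sigma> \<subseteq> euclid J" and tr: "\<not> transverse k \<sigma>"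
    and ne: "limit_cell v \<sigma> (euclid (J - {k})) \<noteq> {}"
  shows "limit_cell v \<sigma> (euclid (J - {k})) = \<sigma>"
proof
  show "limit_cell v \<sigma> (euclid (J - {k})) \<subseteq> \<sigma>" by (rule limit_cell_subset_closed[OF \<sigma>(1)])
  obtain x y where xy: "\<forall>\<^sub>F \<epsilon> in at_right (0::real). y \<epsilon> \<in> \<sigma> \<inter> (+) (\<epsilon> *\<^sub>R v) ` euclid (J - {k})"
      "(y \<longlongrightarrow> x) (at_right 0)"
    using ne by (auto simp: limit_cell_def)
  show "\<sigma> \<subseteq> limit_cell v \<sigma> (euclid (J - {k}))"
  proof
    fix z assume z: "z \<in> \<sigma>"
    have "z \<in> \<sigma> \<inter> (+) (\<epsilon> *\<^sub>R v) ` euclid (J - {k})" if "y \<epsilon> \<in> \<sigma> \<inter> (+) (\<epsilon> *\<^sub>R v) ` euclid (J - {k})" for \<epsilon>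
      using that z \<sigma>(2) not_transverse_const[OF tr z, of "y \<epsilon>"]
      by (auto simp: translate_hyperplane_iff[OF v k])
    then have "\<forall>\<^sub>F \<epsilon> in at_right (0::real). z \<in> \<sigma> \<inter> (+) (\<epsilon> *\<^sub>R v) ` euclid (J - {k})"
      by (rule eventually_mono[OF xy(1)])
    then show "z \<in> limit_cell v \<sigma> (euclid (J - {k}))"
      unfolding limit_cell_def mem_Collect_eq by (intro exI[of _ "\<lambda>_. z"] conjI) auto
  qed
qed

text \<open>A basis of the section becomes a basis of \<open>L\<close> when \<open>g\<close> is added.\<close>

lemma dim_hyperplane_section:
  assumes J: "finite J" and L: "subspace L" "L \<subseteq> euclid J" and g: "g \<in> L" "lookup g k \<noteq> 0"
  shows "dim (L \<inter> euclid (J - {k})) + 1 = dim L"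
proof -
  let ?H = "euclid (J - {k}) :: 'a rvec set"
  obtain B where B: "B \<subseteq> L \<inter> ?H" "independent B" "L \<inter> ?H \<subseteq> span B" "finite B" "card B = dim (L \<inter> ?H)"
    using finite_basis[OF J, of "L \<inter> ?H"] L(2) by blast
  have "span B \<subseteq> ?H" using B(1) by (intro span_minimal subspace_euclid) auto
  then have g': "g \<notin> span B" using g(2) by (auto simp: euclid_iff)
  then have ind: "independent (insert g B)" using B(2) by (simp add: independent_insert)
  have "L \<subseteq> span (insert g B)"
  proof
    fix x assume x: "x \<in> L"
    let ?c = "lookup x k / lookup g k"
    have "x - ?c *\<^sub>R g \<in> L" using x g L(1) by (intro subspace_diff subspace_scale)
    moreover have "x - ?c *\<^sub>R g \<in> ?H"
      using calculation L(2) g(2) by (auto simp: euclid_iff lookup_minus)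
    ultimately show "x \<in> span (insert g B)" using B(3) by (auto simp: span_breakdown_eq[of x g])
  qed
  then have "dim L = card (insert g B)"
    using B(1) g(1) ind by (intro dim_unique) auto
  moreover have "g \<notin> B" using g' span_base by blast
  ultimately show ?thesis using B(4,5) by simp
qed

lemma hyperplane_section:
  assumes J: "finite J" and k: "k \<in> J" and \<sigma>: "affine \<sigma>" "\<sigma> \<subseteq> euclid J" "\<sigma> \<noteq> {}" and tr: "transverse k \<sigma>"
  shows "\<sigma> \<inter> euclid (J - {k}) \<noteq> {}"
    and "lin_space (\<sigma> \<inter> euclid (J - {k})) = lin_space \<sigma> \<inter> euclid (J - {k})"
    and "cell_dim (\<sigma> \<inter> euclid (J - {k})) + 1 = cell_dim \<sigma>"
proof -
  let ?H = "euclid (J - {k}) :: 'a rvec set"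
  obtain g where g: "g \<in> lin_space \<sigma>" "lookup g k \<noteq> 0"
    using tr by (auto simp: transverse_def)
  obtain q where q: "q \<in> \<sigma>" using \<sigma>(3) by blast
  define p where "p = q - (lookup q k / lookup g k) *\<^sub>R g"
  have tq: "\<sigma> = (+) q ` lin_space \<sigma>" by (rule affine_translate_lin_space[OF \<sigma>(1) q])
  have "- ((lookup q k / lookup g k) *\<^sub>R g) \<in> lin_space \<sigma>"
    using g(1) by (intro subspace_neg subspace_scale subspace_lin_space)
  then have "q + - ((lookup q k / lookup g k) *\<^sub>R g) \<in> \<sigma>"
    using tq by blast
  then have p1: "p \<in> \<sigma>" by (simp add: p_def)
  have p2: "p \<in> ?H"
    using p1 \<sigma>(2) g(2) by (auto simp: euclid_iff p_def lookup_minus)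
  show "\<sigma> \<inter> ?H \<noteq> {}" using p1 p2 by blast
  have tp: "\<sigma> = (+) p ` lin_space \<sigma>" by (rule affine_translate_lin_space[OF \<sigma>(1) p1])
  have "\<sigma> \<inter> ?H = (+) p ` (lin_space \<sigma> \<inter> ?H)"
  proof (intro equalityI subsetI)
    fix x assume x: "x \<in> \<sigma> \<inter> ?H"
    have "x - p \<in> lin_space \<sigma> \<inter> ?H"
      using x p1 p2 by (auto intro: diff_in_lin_space subspace_diff[OF subspace_euclid])
    then show "x \<in> (+) p ` (lin_space \<sigma> \<inter> ?H)" by (auto simp: image_iff intro!: bexI[of _ "x - p"])
  next
    fix x assume "x \<in> (+) p ` (lin_space \<sigma> \<inter> ?H)"
    then show "x \<in> \<sigma> \<inter> ?H" using tp p2 by (auto intro: subspace_add[OF subspace_euclid])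
  qed
  then show lin: "lin_space (\<sigma> \<inter> ?H) = lin_space \<sigma> \<inter> ?H"
    by (simp add: lin_space_translate subspace_inter subspace_lin_space subspace_euclid)
  show "cell_dim (\<sigma> \<inter> ?H) + 1 = cell_dim \<sigma>"
    unfolding cell_dim_def lin
    by (rule dim_hyperplane_section[OF J subspace_lin_space lin_space_euclid[OF \<sigma>(2)] g])
qed

text \<open>
  The stable intersection is formed with a displacement picked by the choice operator, which is only
  known to lie in \<open>euclid J\<close> once some generic displacement exists. The unit vector orthogonal to the
  hyperplane is one: it moves the hyperplane off every cell parallel to it.
\<close>

lemma generic_hyperplane_exists:
  assumes k: "k \<in> J" and fin: "finite (cells \<Delta>)" and \<Delta>: "\<And>\<sigma>. \<sigma> \<in> cells \<Delta> \<Longrightarrow> \<sigma> \<subseteq> euclid J"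
    and E: "cells E = {euclid (J - {k})}"
  shows "\<exists>v. generic J \<Delta> E v"
proof
  let ?v = "single k (1::real)" and ?H = "euclid (J - {k}) :: 'a rvec set"
  have v: "?v \<in> euclid J" using k by (rule single_in_euclid)
  have "\<forall>\<^sub>F \<epsilon> in at_right 0. \<sigma> \<inter> (+) (\<epsilon> *\<^sub>R ?v) ` ?H \<noteq> {}
      \<longrightarrow> sum_set (lin_space \<sigma>) (lin_space ?H) = euclid J" if \<sigma>: "\<sigma> \<in> cells \<Delta>" for \<sigma>
  proof (cases "transverse k \<sigma>")
    case True
    then obtain g where g: "g \<in> lin_space \<sigma>" "lookup g k \<noteq> 0"
      by (auto simp: transverse_def)
    have gJ: "lin_space \<sigma> \<subseteq> euclid J" by (rule lin_space_euclid[OF \<Delta>[OF \<sigma>]])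
    have "sum_set (lin_space \<sigma>) ?H = euclid J"
    proof (intro equalityI subsetI)
      fix x assume "x \<in> sum_set (lin_space \<sigma>) ?H"
      then show "x \<in> euclid J"
        using gJ euclid_mono[of "J - {k}" J] by (auto simp: sum_set_def intro!: subspace_add[OF subspace_euclid])
    next
      fix x :: "'a rvec" assume x: "x \<in> euclid J"
      let ?c = "lookup x k / lookup g k"
      have "?c *\<^sub>R g \<in> lin_space \<sigma>" by (rule subspace_scale[OF subspace_lin_space g(1)])
      moreover have "x - ?c *\<^sub>R g \<in> ?H"
        using x g gJ by (auto simp: euclid_iff lookup_minus)
      moreover have "x = ?c *\<^sub>R g + (x - ?c *\<^sub>R g)" by simp
      ultimately show "x \<in> sum_set (lin_space \<sigma>) ?H" unfolding sum_set_def by blast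
    qed
    then show ?thesis by (simp add: lin_space_subspace subspace_euclid)
  next
    case False
    show ?thesis
    proof (cases "\<sigma> = {}")
      case False
      then obtain q where q: "q \<in> \<sigma>" by blast
      have "\<forall>\<^sub>F \<epsilon> in at_right 0. \<epsilon> \<noteq> lookup q k"
        by (rule eventually_neq_at_within)
      then show ?thesis
      proof (rule eventually_mono, intro impI)
        fix \<epsilon> assume ne: "\<epsilon> \<noteq> lookup q k" and "\<sigma> \<inter> (+) (\<epsilon> *\<^sub>R ?v) ` ?H \<noteq> {}"
        then obtain x where x: "x \<in> \<sigma>" "x \<in> (+) (\<epsilon> *\<^sub>R ?v) ` ?H" by blast
        then have "lookup x k = \<epsilon>"
          using translate_hyperplane_iff[OF v k, of x \<epsilon>] by simp
        then have False using ne not_transverse_const[OF \<open>\<not> transverse k \<sigma>\<close> x(1) q] by simp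
        then show "sum_set (lin_space \<sigma>) (lin_space ?H) = euclid J" ..
      qed
    qed simp
  qed
  then show "generic J \<Delta> E ?v"
    unfolding generic_def E using fin v by (auto intro: eventually_ball_finite)
qed

text \<open>
  Modulo the lattice of the hyperplane, a lattice vector is determined by its \<open>k\<close>-th coordinate, so the
  index is that of the \<open>k\<close>-th coordinates of \<open>A\<close> in the integers.
\<close>

lemma subgroup_index_hyperplane:
  assumes k: "k \<in> J" and g: "0 < g" and A: "A \<subseteq> int_lattice J"
    and im: "(\<lambda>x. lookup x k) ` A = range (\<lambda>z::int. real g * of_int z)"
  shows "subgroup_index (int_lattice J) (sum_set A (int_lattice (J - {k}))) = g"
proof -
  let ?L = "int_lattice J" and ?M = "sum_set A (int_lattice (J - {k}))"
  define f where "f x = \<lfloor>lookup x k\<rfloor> mod int g" for x :: "'a rvec"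
  have M: "x \<in> ?M \<longleftrightarrow> (\<exists>z::int. lookup x k = real g * of_int z)" if x: "x \<in> ?L" for x
  proof
    assume "x \<in> ?M"
    then obtain a b where "x = a + b" "a \<in> A" "b \<in> int_lattice (J - {k})" by (auto simp: sum_set_def)
    moreover have "lookup a k \<in> range (\<lambda>z::int. real g * of_int z)"
      using calculation(2) im by blast
    ultimately show "\<exists>z::int. lookup x k = real g * of_int z"
      by (auto simp: lookup_add int_lattice_iff euclid_iff)
  next
    assume "\<exists>z::int. lookup x k = real g * of_int z"
    then obtain a where a: "a \<in> A" "lookup a k = lookup x k"
      using im by (metis (no_types, lifting) imageE rangeI)
    have "x - a \<in> int_lattice (J - {k})"
      using x a A by (auto simp: int_lattice_iff euclid_iff lookup_minus)
    moreover have "x = a + (x - a)" by simp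
    ultimately show "x \<in> ?M" using a(1) unfolding sum_set_def by blast
  qed
  have R: "x - y \<in> ?M \<longleftrightarrow> f x = f y" if x: "x \<in> ?L" and y: "y \<in> ?L" for x y
  proof -
    obtain a b where ab: "lookup x k = of_int a" "lookup y k = of_int b"
      using x y by (metis Ints_cases int_lattice_iff)
    have "x - y \<in> ?L" using int_lattice_add[OF x int_lattice_minus[OF y]] by simp
    then have "x - y \<in> ?M \<longleftrightarrow> (\<exists>z::int. real_of_int (a - b) = of_int (int g * z))"
      by (simp add: M lookup_minus ab)
    also have "\<dots> \<longleftrightarrow> int g dvd a - b" unfolding of_int_eq_iff dvd_def ..
    also have "\<dots> \<longleftrightarrow> f x = f y" by (simp add: f_def ab mod_eq_dvd_iff)
    finally show ?thesis .
  qed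
  have fL: "f ` ?L = {0..<int g}"
  proof (intro equalityI subsetI)
    fix c assume c: "c \<in> {0..<int g}"
    have "f (single k (of_int c)) = c" using c by (simp add: f_def)
    moreover have "single k (of_int c) \<in> ?L" using k by (intro int_lattice_single) auto
    ultimately show "c \<in> f ` ?L" by (metis imageI)
  qed (use g in \<open>auto simp: f_def\<close>)
  have "?L // {(x, y). x \<in> ?L \<and> y \<in> ?L \<and> x - y \<in> ?M} = (\<lambda>c. {x \<in> ?L. f x = c}) ` f ` ?L"
  proof -
    have "{(x, y). x \<in> ?L \<and> y \<in> ?L \<and> x - y \<in> ?M} `` {x} = {y \<in> ?L. f y = f x}" if "x \<in> ?L" for x
      using that R[OF that] by (auto simp: Image_def)
    then show ?thesis unfolding quotient_def by (auto simp: image_iff)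
  qed
  moreover have "inj_on (\<lambda>c. {x \<in> ?L. f x = c}) (f ` ?L)" by (auto simp: inj_on_def)
  ultimately show ?thesis unfolding subgroup_index_def using fL by (simp add: card_image)
qed

text \<open>
  Such families are closed under stable intersection with coordinate hyperplanes, and all complexes
  occurring in the multidegrees are of this kind.
\<close>

definition flat_family :: "'k set \<Rightarrow> nat \<Rightarrow> 'k tropical \<Rightarrow> bool" where
  "flat_family J d \<Delta> \<longleftrightarrow> finite (cells \<Delta>) \<and> disjoint (cells \<Delta>) \<and>
     (\<forall>\<sigma>\<in>cells \<Delta>. \<sigma> \<noteq> {} \<and> affine \<sigma> \<and> closed \<sigma> \<and> \<sigma> \<subseteq> euclid J \<and> cell_dim \<sigma> = d)"

lemma facets_flat_family:
  assumes "flat_family J d \<Delta>"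
  shows "facets \<Delta> = cells \<Delta>"
proof (cases "cells \<Delta> = {}")
  case False
  then have "cell_dim ` cells \<Delta> = {d}" using assms by (auto simp: flat_family_def image_iff)
  then show ?thesis using assms by (auto simp: facets_def tdim_def flat_family_def)
qed (simp add: facets_def)

lemma faces_of_affine_cells:
  assumes "\<And>\<tau>. \<tau> \<in> D \<Longrightarrow> affine \<tau> \<and> \<tau> \<noteq> {}"
  shows "{\<rho>. \<rho> \<noteq> {} \<and> (\<exists>\<tau>\<in>D. \<rho> face_of \<tau>)} = D"
proof (intro equalityI subsetI)
  fix \<rho> assume "\<rho> \<in> {\<rho>. \<rho> \<noteq> {} \<and> (\<exists>\<tau>\<in>D. \<rho> face_of \<tau>)}"
  then obtain \<tau> where "\<rho> \<noteq> {}" "\<tau> \<in> D" "\<rho> face_of \<tau>" by blast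
  then show "\<rho> \<in> D" using assms face_of_affine_trivial[of \<tau> \<rho>] by auto
next
  fix \<rho> assume "\<rho> \<in> D"
  then show "\<rho> \<in> {\<rho>. \<rho> \<noteq> {} \<and> (\<exists>\<tau>\<in>D. \<rho> face_of \<tau>)}"
    using assms[of \<rho>] face_of_refl[OF affine_imp_convex] by blast
qed

text \<open>
  Transverse cells are cut, and parallel ones are discarded. The sections of disjoint cells are
  disjoint, so each section carries the weight of a single pair of facets.
\<close>

lemma stable_intersection_hyperplane:
  assumes J: "finite J" and k: "k \<in> J" and \<Delta>: "flat_family J d \<Delta>"
    and E: "cells E = {euclid (J - {k})}"
  shows "cells (stable_intersection J \<Delta> E)
           = (\<lambda>\<sigma>. \<sigma> \<inter> euclid (J - {k})) ` {\<sigma> \<in> cells \<Delta>. transverse k \<sigma>}"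
    and "\<And>\<sigma>. \<sigma> \<in> cells \<Delta> \<Longrightarrow> transverse k \<sigma> \<Longrightarrow>
           weight (stable_intersection J \<Delta> E) (\<sigma> \<inter> euclid (J - {k}))
             = weight \<Delta> \<sigma> * weight E (euclid (J - {k})) *
               subgroup_index (int_lattice J) (sum_set (cell_lattice J \<sigma>) (int_lattice (J - {k})))"
proof -
  let ?H = "euclid (J - {k}) :: 'a rvec set"
  define v where "v = (SOME v. generic J \<Delta> E v)"
  have c: "\<sigma> \<noteq> {}" "affine \<sigma>" "closed \<sigma>" "\<sigma> \<subseteq> euclid J" "cell_dim \<sigma> = d" if "\<sigma> \<in> cells \<Delta>" for \<sigma>
    using that \<Delta> by (auto simp: flat_family_def)
  have "finite (cells \<Delta>)" using \<Delta> by (simp add: flat_family_def)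
  then have "\<exists>v. generic J \<Delta> E v" by (rule generic_hyperplane_exists[OF k _ c(4) E])
  then have "generic J \<Delta> E v" unfolding v_def by (rule someI_ex)
  then have v: "v \<in> euclid J" by (simp add: generic_def)
  have SI: "stable_intersection J \<Delta> E = displaced_intersection J v \<Delta> E"
    by (simp add: stable_intersection_def v_def)
  have fD: "facets \<Delta> = cells \<Delta>" by (rule facets_flat_family[OF \<Delta>])
  have fE: "facets E = {?H}" using E by (auto simp: facets_def tdim_def)
  have cH: "card J = cell_dim ?H + 1"
  proof -
    have "cell_dim ?H = card (J - {k})"
      using J by (simp add: cell_dim_def lin_space_subspace subspace_euclid dim_euclid)
    then show ?thesis using card_Suc_Diff1[OF J k] by linarith
  qed
  have lim: "limit_cell v \<sigma> ?H = \<sigma> \<inter> ?H" if "\<sigma> \<in> cells \<Delta>" "transverse k \<sigma>" for \<sigma>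
    by (rule limit_cell_transverse[OF v k c(2-4)[OF that(1)] that(2)])
  have disp: "displaced_facets J v \<Delta> E = (\<lambda>\<sigma>. \<sigma> \<inter> ?H) ` {\<sigma> \<in> cells \<Delta>. transverse k \<sigma>}" (is "?l = ?r")
  proof (intro equalityI subsetI)
    fix \<tau> assume "\<tau> \<in> ?l"
    then obtain \<sigma> where \<sigma>: "\<tau> \<noteq> {}" "\<sigma> \<in> cells \<Delta>" "\<tau> = limit_cell v \<sigma> ?H"
        "cell_dim \<tau> + card J = cell_dim \<sigma> + cell_dim ?H"
      by (auto simp: displaced_facets_def fD fE)
    have "transverse k \<sigma>"
    proof (rule ccontr)
      assume "\<not> transverse k \<sigma>"
      then have "\<tau> = \<sigma>" using limit_cell_parallel[OF v k c(3,4)[OF \<sigma>(2)]] \<sigma>(1,3) by blast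
      with \<sigma>(4) cH show False by simp
    qed
    then show "\<tau> \<in> ?r" using \<sigma> lim by auto
  next
    fix \<tau> assume "\<tau> \<in> ?r"
    then obtain \<sigma> where \<sigma>: "\<sigma> \<in> cells \<Delta>" "transverse k \<sigma>" "\<tau> = \<sigma> \<inter> ?H" by blast
    have "\<tau> \<noteq> {}" "cell_dim \<tau> + 1 = cell_dim \<sigma>"
      using hyperplane_section[OF J k c(2,4,1)[OF \<sigma>(1)] \<sigma>(2)] \<sigma> by auto
    moreover from this have "cell_dim \<tau> + card J = cell_dim \<sigma> + cell_dim ?H" using cH by linarith
    moreover have "\<tau> = limit_cell v \<sigma> ?H" using lim[OF \<sigma>(1,2)] \<sigma>(3) by simp
    ultimately show "\<tau> \<in> ?l"
      unfolding displaced_facets_def fD fE using \<sigma>(1) by blast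
  qed
  have "affine \<tau> \<and> \<tau> \<noteq> {}" if "\<tau> \<in> displaced_facets J v \<Delta> E" for \<tau>
  proof -
    obtain \<sigma> where \<sigma>: "\<sigma> \<in> cells \<Delta>" "transverse k \<sigma>" "\<tau> = \<sigma> \<inter> ?H" using \<open>\<tau> \<in> _\<close> disp by blast
    then show ?thesis
      using hyperplane_section(1)[OF J k c(2,4,1)[OF \<sigma>(1)] \<sigma>(2)] c(2)[OF \<sigma>(1)] \<sigma>(3)
      by (auto intro!: affine_Int subspace_imp_affine[OF subspace_euclid])
  qed
  then show "cells (stable_intersection J \<Delta> E) = ?r"
    unfolding SI displaced_intersection_def tropical.simps disp[symmetric]
    by (rule faces_of_affine_cells)
  fix \<sigma> assume \<sigma>: "\<sigma> \<in> cells \<Delta>" "transverse k \<sigma>"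
  have "{(\<rho>, \<rho>'). \<rho> \<in> facets \<Delta> \<and> \<rho>' \<in> facets E \<and> limit_cell v \<rho> \<rho>' = \<sigma> \<inter> ?H} = {(\<sigma>, ?H)}"
  proof -
    (* a limit cell lies in its closed cell, and the cells are disjoint *)
    have "\<rho> = \<sigma>" if \<rho>: "\<rho> \<in> cells \<Delta>" "limit_cell v \<rho> ?H = \<sigma> \<inter> ?H" for \<rho>
    proof -
      have "\<sigma> \<inter> ?H \<subseteq> \<rho>" using limit_cell_subset_closed[OF c(3)[OF \<rho>(1)], of v ?H] \<rho>(2) by simp
      moreover have "\<sigma> \<inter> ?H \<noteq> {}" by (rule hyperplane_section(1)[OF J k c(2,4,1)[OF \<sigma>(1)] \<sigma>(2)])
      ultimately have "\<sigma> \<inter> \<rho> \<noteq> {}" by blast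
      moreover have "disjoint (cells \<Delta>)" using \<Delta> by (simp add: flat_family_def)
      ultimately show ?thesis using \<sigma>(1) \<rho>(1) unfolding disjoint_def by blast
    qed
    then show ?thesis using \<sigma> lim by (auto simp: fD fE)
  qed
  moreover have "cell_lattice J ?H = int_lattice (J - {k})"
    by (auto simp: cell_lattice_def lin_space_subspace subspace_euclid int_lattice_iff euclid_iff)
  ultimately show "weight (stable_intersection J \<Delta> E) (\<sigma> \<inter> ?H)
             = weight \<Delta> \<sigma> * weight E ?H *
               subgroup_index (int_lattice J) (sum_set (cell_lattice J \<sigma>) (int_lattice (J - {k})))"
    unfolding SI displaced_intersection_def tropical.simps by simp
qed

lemma flat_family_whole_space:
  "finite J \<Longrightarrow> flat_family J (card J) (whole_space J :: 'k tropical)"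
proof -
  assume J: "finite J"
  have "(euclid J :: 'k rvec set) = (\<Inter>k\<in>-J. {x. lookup x k = 0})"
    by (auto simp: euclid_iff)
  moreover have "closed {x :: 'k rvec. lookup x k = 0}" for k
    by (intro closed_Collect_eq continuous_intros)
  ultimately have "closed (euclid J :: 'k rvec set)" by (auto intro: closed_INT)
  moreover have "(0 :: 'k rvec) \<in> euclid J" by (rule subspace_0[OF subspace_euclid])
  ultimately show ?thesis
    using J by (auto simp: flat_family_def whole_space_def subspace_imp_affine subspace_euclid
        cell_dim_def lin_space_subspace dim_euclid disjoint_def)
qed

lemma subgroup_index_self:
  assumes "0 \<in> A" "A \<subseteq> int_lattice J"
  shows "subgroup_index (int_lattice J) (sum_set A (int_lattice J)) = 1"
proof -
  have "sum_set A (int_lattice J) = int_lattice J"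
  proof (intro equalityI subsetI)
    fix x assume "x \<in> int_lattice J"
    then have "x = 0 + x" "x \<in> int_lattice J" by auto
    then show "x \<in> sum_set A (int_lattice J)" using assms(1) unfolding sum_set_def by blast
  qed (use assms in \<open>auto simp: sum_set_def intro: int_lattice_add\<close>)
  moreover have "{(x, y). x \<in> int_lattice J \<and> y \<in> int_lattice J \<and> x - y \<in> int_lattice J}
      = int_lattice J \<times> int_lattice J"
    using int_lattice_add[OF _ int_lattice_minus] by (auto simp: diff_conv_add_uminus simp del: add_uminus_conv_diff)
  moreover have "int_lattice J // (int_lattice J \<times> int_lattice J) = {int_lattice J}"
    using int_lattice_0[of J] by (auto simp: quotient_def)
  ultimately show ?thesis by (simp add: subgroup_index_def)
qed

lemma stable_intersection_whole_space:
  assumes J: "finite J" and \<Delta>: "flat_family J d \<Delta>"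
  shows "cells (stable_intersection J \<Delta> (whole_space J)) = cells \<Delta>"
    and "\<And>\<sigma>. \<sigma> \<in> cells \<Delta> \<Longrightarrow> weight (stable_intersection J \<Delta> (whole_space J)) \<sigma> = weight \<Delta> \<sigma>"
proof -
  let ?E = "whole_space J :: 'a tropical"
  define v where "v = (SOME v. generic J \<Delta> ?E v)"
  have c: "\<sigma> \<noteq> {}" "affine \<sigma>" "closed \<sigma>" "\<sigma> \<subseteq> euclid J" "cell_dim \<sigma> = d" if "\<sigma> \<in> cells \<Delta>" for \<sigma>
    using that \<Delta> by (auto simp: flat_family_def)
  have "generic J \<Delta> ?E 0"
  proof -
    have "sum_set (lin_space \<sigma>) (euclid J) = euclid J" if "\<sigma> \<in> cells \<Delta>" for \<sigma>
    proof (intro equalityI subsetI)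
      fix x assume "x \<in> sum_set (lin_space \<sigma>) (euclid J)"
      then show "x \<in> euclid J"
        using lin_space_euclid[OF c(4)[OF that]] by (auto simp: sum_set_def intro!: subspace_add[OF subspace_euclid])
    next
      fix x :: "'a rvec" assume "x \<in> euclid J"
      then have "x = 0 + x" "x \<in> euclid J" by auto
      then show "x \<in> sum_set (lin_space \<sigma>) (euclid J)"
        using subspace_0[OF subspace_lin_space[of \<sigma>]] unfolding sum_set_def by blast
    qed
    then show ?thesis
      by (auto simp: generic_def whole_space_def lin_space_subspace subspace_euclid subspace_0)
  qed
  then have "generic J \<Delta> ?E v" unfolding v_def by (rule someI)
  then have v: "v \<in> euclid J" by (simp add: generic_def)
  have SI: "stable_intersection J \<Delta> ?E = displaced_intersection J v \<Delta> ?E"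
    by (simp add: stable_intersection_def v_def)
  have fD: "facets \<Delta> = cells \<Delta>" by (rule facets_flat_family[OF \<Delta>])
  have fE: "facets ?E = {euclid J}"
    using facets_flat_family[OF flat_family_whole_space[OF J]] by (simp add: whole_space_def)
  have cE: "cell_dim (euclid J :: 'a rvec set) = card J"
    by (simp add: cell_dim_def lin_space_subspace subspace_euclid dim_euclid[OF J])
  have tr: "(+) (t *\<^sub>R v) ` euclid J = euclid J" for t
  proof (intro equalityI subsetI)
    fix x assume "x \<in> euclid J"
    then have "x - t *\<^sub>R v \<in> euclid J"
      by (intro subspace_diff[OF subspace_euclid] subspace_scale[OF subspace_euclid] v)
    then show "x \<in> (+) (t *\<^sub>R v) ` euclid J" by (auto simp: image_iff intro!: bexI[of _ "x - t *\<^sub>R v"])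
  qed (auto intro: subspace_add[OF subspace_euclid] subspace_scale[OF subspace_euclid] v)
  have lim: "limit_cell v \<sigma> (euclid J) = \<sigma>" if "\<sigma> \<in> cells \<Delta>" for \<sigma>
  proof
    show "limit_cell v \<sigma> (euclid J) \<subseteq> \<sigma>" by (rule limit_cell_subset_closed[OF c(3)[OF that]])
    show "\<sigma> \<subseteq> limit_cell v \<sigma> (euclid J)"
    proof
      fix x assume "x \<in> \<sigma>"
      then show "x \<in> limit_cell v \<sigma> (euclid J)"
        unfolding limit_cell_def tr mem_Collect_eq using c(4)[OF that]
        by (intro exI[of _ "\<lambda>_. x"] conjI) auto
    qed
  qed
  have disp: "displaced_facets J v \<Delta> ?E = cells \<Delta>"
    using c lim by (auto simp: displaced_facets_def fD fE cE)
  show "cells (stable_intersection J \<Delta> ?E) = cells \<Delta>"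
    unfolding SI displaced_intersection_def tropical.simps disp
    by (rule faces_of_affine_cells) (use c in auto)
  fix \<sigma> assume \<sigma>: "\<sigma> \<in> cells \<Delta>"
  have "{(\<rho>, \<rho>'). \<rho> \<in> facets \<Delta> \<and> \<rho>' \<in> facets ?E \<and> limit_cell v \<rho> \<rho>' = \<sigma>} = {(\<sigma>, euclid J)}"
    using \<sigma> lim by (auto simp: fD fE)
  moreover have "cell_lattice J (euclid J) = int_lattice J"
    by (auto simp: cell_lattice_def lin_space_subspace subspace_euclid int_lattice_iff)
  moreover have "subgroup_index (int_lattice J) (sum_set (cell_lattice J \<sigma>) (int_lattice J)) = 1"
    by (rule subgroup_index_self)
       (auto simp: cell_lattice_def int_lattice_0 subspace_0[OF subspace_lin_space])
  ultimately show "weight (stable_intersection J \<Delta> ?E) \<sigma> = weight \<Delta> \<sigma>"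
    unfolding SI displaced_intersection_def tropical.simps by (simp add: whole_space_def)
qed

lemma stable_intersection_empty:
  assumes "cells \<Delta> = {} \<or> cells E = {}"
  shows "cells (stable_intersection J \<Delta> E) = {}"
  using assms by (auto simp: stable_intersection_def displaced_intersection_def displaced_facets_def facets_def)

section \<open>Simplicial fans that are symmetric under flipping a generator\<close>

definition pos_hull :: "'k rvec set \<Rightarrow> 'k rvec set" where
  "pos_hull V = {\<Sum>v\<in>V. c v *\<^sub>R v | c. \<forall>v\<in>V. 0 \<le> c v}"

text \<open>
  \<open>V\<close> is part of a lattice basis: the coefficients of an integral combination are integers. Linear
  independence is a consequence.
\<close>

definition unimodular :: "'k set \<Rightarrow> 'k rvec set \<Rightarrow> bool" where
  "unimodular J V \<longleftrightarrow> finite V \<and> V \<subseteq> int_lattice J \<and>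
     (\<forall>c. (\<Sum>v\<in>V. c v *\<^sub>R v) \<in> int_lattice J \<longrightarrow> (\<forall>v\<in>V. c v \<in> \<int>))"

lemma pos_hullI: "x = (\<Sum>v\<in>V. c v *\<^sub>R v) \<Longrightarrow> (\<And>v. v \<in> V \<Longrightarrow> 0 \<le> c v) \<Longrightarrow> x \<in> pos_hull V"
  unfolding pos_hull_def by (intro CollectI exI[of _ c]) auto

lemma unimodularD:
  assumes "unimodular J V" "(\<Sum>v\<in>V. c v *\<^sub>R v) \<in> int_lattice J" "v \<in> V"
  shows "c v \<in> \<int>"
  using assms unfolding unimodular_def by (elim conjE allE[of _ c]) simp

lemma unimodular_coeffs:
  assumes V: "unimodular J V" and z: "(\<Sum>v\<in>V. c v *\<^sub>R v) = 0" and v: "v \<in> V"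
  shows "c v = 0"
proof (rule ccontr)
  (* otherwise scale the relation so that the coefficient of v is 1/2 *)
  assume nz: "c v \<noteq> 0"
  have "(\<Sum>w\<in>V. (c w / (2 * c v)) *\<^sub>R w) = (1 / (2 * c v)) *\<^sub>R (\<Sum>w\<in>V. c w *\<^sub>R w)"
    by (simp add: scaleR_sum_right)
  then have "(\<Sum>w\<in>V. (c w / (2 * c v)) *\<^sub>R w) \<in> int_lattice J" using z by (simp add: int_lattice_0)
  then have "c v / (2 * c v) \<in> \<int>" by (rule unimodularD[OF V _ v])
  then have "1 / 2 \<in> (\<int> :: real set)" using nz by simp
  then obtain n :: int where "1 / 2 = (of_int n :: real)" by (elim Ints_cases)
  then have "of_int (2 * n) = (of_int 1 :: real)" by simp
  then have "2 * n = 1" by (simp only: of_int_eq_iff)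
  then show False by presburger
qed

lemma unimodular_unique:
  assumes "unimodular J V" "(\<Sum>v\<in>V. c v *\<^sub>R v) = (\<Sum>v\<in>V. d v *\<^sub>R v)" "v \<in> V"
  shows "c v = d v"
  using unimodular_coeffs[OF assms(1) _ assms(3), of "\<lambda>v. c v - d v"] assms(2)
  by (simp add: scaleR_diff_left sum_subtractf)

lemma unimodular_independent: "unimodular J V \<Longrightarrow> independent V"
  using unimodular_coeffs by (subst dependent_finite) (auto simp: unimodular_def)

lemma unimodular_euclid: "unimodular J V \<Longrightarrow> V \<subseteq> euclid J"
  by (auto simp: unimodular_def int_lattice_iff)

lemma pos_hull_mono:
  assumes "W \<subseteq> V" "finite V"
  shows "pos_hull W \<subseteq> pos_hull V"
proof
  fix x assume "x \<in> pos_hull W"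
  then obtain c where c: "x = (\<Sum>v\<in>W. c v *\<^sub>R v)" "\<forall>v\<in>W. 0 \<le> c v" by (auto simp: pos_hull_def)
  have "x = (\<Sum>v\<in>V. (if v \<in> W then c v else 0) *\<^sub>R v)"
    unfolding c(1) using assms by (intro sum.mono_neutral_cong_left) auto
  then show "x \<in> pos_hull V"
    unfolding pos_hull_def using c(2) by (auto intro!: exI[of _ "\<lambda>v. if v \<in> W then c v else 0"])
qed

lemma pos_hull_scale: "x \<in> pos_hull V \<Longrightarrow> 0 \<le> t \<Longrightarrow> t *\<^sub>R x \<in> pos_hull V"
  unfolding pos_hull_def by (force simp: scaleR_sum_right)

lemma pos_hull_add:
  assumes "x \<in> pos_hull V" "y \<in> pos_hull V"
  shows "x + y \<in> pos_hull V"
proof -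
  obtain c d where "x = (\<Sum>v\<in>V. c v *\<^sub>R v)" "\<forall>v\<in>V. 0 \<le> c v"
      "y = (\<Sum>v\<in>V. d v *\<^sub>R v)" "\<forall>v\<in>V. 0 \<le> d v"
    using assms by (auto simp: pos_hull_def)
  then have "x + y = (\<Sum>v\<in>V. (c v + d v) *\<^sub>R v)" "\<forall>v\<in>V. 0 \<le> c v + d v"
    by (auto simp: scaleR_add_left sum.distrib)
  then show ?thesis by (intro pos_hullI[of _ "\<lambda>v. c v + d v"]) auto
qed

lemma zero_in_pos_hull: "0 \<in> pos_hull V"
  unfolding pos_hull_def by (auto intro!: exI[of _ "\<lambda>_. 0"])

lemma generator_in_pos_hull: "finite V \<Longrightarrow> v \<in> V \<Longrightarrow> v \<in> pos_hull V"
  unfolding pos_hull_def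
  by (auto intro!: exI[of _ "\<lambda>w. if w = v then 1 else 0"] simp: if_distrib[of "\<lambda>c. c *\<^sub>R _"] cong: if_cong)

lemma convex_pos_hull: "convex (pos_hull V)"
  unfolding convex_def using pos_hull_add pos_hull_scale by blast

lemma pos_hull_subset_span: "pos_hull V \<subseteq> span V"
  unfolding pos_hull_def by (auto intro!: span_sum span_scale intro: span_base)

lemma lin_space_pos_hull:
  assumes "finite V"
  shows "lin_space (pos_hull V) = span V"
proof
  show "lin_space (pos_hull V) \<subseteq> span V"
    unfolding lin_space_def using pos_hull_subset_span
    by (intro span_minimal subspace_span) (auto intro!: span_diff)
  show "span V \<subseteq> lin_space (pos_hull V)"
  proof (rule span_minimal[OF _ subspace_lin_space])
    show "V \<subseteq> lin_space (pos_hull V)"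
      using diff_in_lin_space[OF generator_in_pos_hull[OF assms] zero_in_pos_hull] by auto
  qed
qed

lemma pos_hull_subset_imp:
  assumes V: "unimodular J V" and W: "W \<subseteq> V" and v: "v \<in> V" "v \<in> pos_hull W"
  shows "v \<in> W"
proof (rule ccontr)
  assume nW: "v \<notin> W"
  have "v \<in> span W" using v(2) pos_hull_subset_span by blast
  then have "v \<in> span (V - {v})" using W nW span_mono[of W "V - {v}"] by blast
  then show False using unimodular_independent[OF V] v(1) by (auto simp: dependent_def)
qed

text \<open>
  If a point of the smaller cone lies between \<open>a\<close> and \<open>b\<close>, then the nonnegative coefficients of \<open>a\<close> and
  \<open>b\<close> outside \<open>W\<close> average to zero, hence vanish.
\<close>

lemma face_pos_hull:
  assumes V: "unimodular J V" and W: "W \<subseteq> V"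
  shows "pos_hull W face_of pos_hull V"
  unfolding face_of_def
proof (intro conjI ballI impI)
  have fV: "finite V" using V by (simp add: unimodular_def)
  show "pos_hull W \<subseteq> pos_hull V" by (rule pos_hull_mono[OF W fV])
  show "convex (pos_hull W)" by (rule convex_pos_hull)
  fix a b x assume a: "a \<in> pos_hull V" and b: "b \<in> pos_hull V" and x: "x \<in> pos_hull W" "x \<in> open_segment a b"
  obtain ca where ca: "a = (\<Sum>v\<in>V. ca v *\<^sub>R v)" "\<forall>v\<in>V. 0 \<le> ca v" using a by (auto simp: pos_hull_def)
  obtain cb where cb: "b = (\<Sum>v\<in>V. cb v *\<^sub>R v)" "\<forall>v\<in>V. 0 \<le> cb v" using b by (auto simp: pos_hull_def)
  obtain cx where cx: "x = (\<Sum>v\<in>W. cx v *\<^sub>R v)" using x by (auto simp: pos_hull_def)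
  obtain u where u: "0 < u" "u < 1" "x = (1 - u) *\<^sub>R a + u *\<^sub>R b" using x(2) by (auto simp: in_segment)
  have x1: "x = (\<Sum>v\<in>V. (if v \<in> W then cx v else 0) *\<^sub>R v)"
    unfolding cx using W fV by (intro sum.mono_neutral_cong_left) auto
  have x2: "x = (\<Sum>v\<in>V. ((1 - u) * ca v + u * cb v) *\<^sub>R v)"
    unfolding u(3) ca(1) cb(1) by (simp add: scaleR_sum_right scaleR_add_left sum.distrib)
  have eq: "(if v \<in> W then cx v else 0) = (1 - u) * ca v + u * cb v" if "v \<in> V" for v
    by (rule unimodular_unique[OF V trans[OF x1[symmetric] x2] that])
  have zero: "ca v = 0 \<and> cb v = 0" if v: "v \<in> V" "v \<notin> W" for v
  proof -
    have "(1 - u) * ca v + u * cb v = 0" using eq[OF v(1)] v(2) by simp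
    moreover have "0 \<le> (1 - u) * ca v" "0 \<le> u * cb v" using u ca(2) cb(2) v by auto
    ultimately have "(1 - u) * ca v = 0" "u * cb v = 0" by linarith+
    then show ?thesis using u by simp
  qed
  have "a = (\<Sum>v\<in>W. ca v *\<^sub>R v)" unfolding ca(1) using W fV zero
    by (intro sum.mono_neutral_right) auto
  then show "a \<in> pos_hull W" by (rule pos_hullI) (use ca(2) W in auto)
  have "b = (\<Sum>v\<in>W. cb v *\<^sub>R v)" unfolding cb(1) using W fV zero
    by (intro sum.mono_neutral_right) auto
  then show "b \<in> pos_hull W" by (rule pos_hullI) (use cb(2) W in auto)
qed

text \<open>
  A nonempty face of a convex cone contains the summands of its elements: it contains \<open>0\<close>, hence all
  multiples of its elements, and \<open>y + z\<close> is the midpoint of \<open>2y\<close> and \<open>2z\<close>.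
\<close>

lemma face_of_pos_hull_scale:
  assumes F: "F face_of pos_hull V" and x: "x \<in> F" and t: "0 \<le> t"
  shows "t *\<^sub>R x \<in> F"
proof (cases "x = 0")
  case False
  have xV: "x \<in> pos_hull V" using F x face_of_imp_subset by blast
  have seg: "x \<in> open_segment 0 (s *\<^sub>R x)" if "1 < s" for s :: real
    unfolding in_segment using that False by (auto intro!: exI[of _ "1 / s"])
  have big: "0 \<in> F \<and> s *\<^sub>R x \<in> F" if "1 < s" for s
    using face_ofD[OF F seg[OF that] zero_in_pos_hull pos_hull_scale[OF xV] x] that by simp
  have "0 \<in> F" using big[of 2] by simp
  show ?thesis
  proof (cases "1 < t")
    case False
    have "(1 - t) *\<^sub>R 0 + t *\<^sub>R x \<in> F"
      using face_of_imp_convex[OF F] \<open>0 \<in> F\<close> x t False by (intro convexD) auto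
    then show ?thesis by simp
  qed (use big in simp)
qed (use x in simp)

lemma face_of_pos_hull_summand:
  assumes F: "F face_of pos_hull V" and y: "y \<in> pos_hull V" and z: "z \<in> pos_hull V" and s: "y + z \<in> F"
  shows "y \<in> F"
proof (cases "y = z")
  case True
  then have "(1 / 2) *\<^sub>R (y + z) = y" by (simp add: scaleR_2[symmetric])
  then show ?thesis using face_of_pos_hull_scale[OF F s, of "1 / 2"] by simp
next
  case False
  have "y + z \<in> open_segment (2 *\<^sub>R y) (2 *\<^sub>R z)"
    unfolding in_segment using False by (auto intro!: exI[of _ "1 / 2"])
  then have "2 *\<^sub>R y \<in> F"
    using face_ofD[OF F _ pos_hull_scale[OF y] pos_hull_scale[OF z] s] by simp
  then show ?thesis using face_of_pos_hull_scale[OF F, of "2 *\<^sub>R y" "1 / 2"] by simp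
qed

lemma faces_of_pos_hull:
  assumes V: "finite V" and F: "F face_of pos_hull V" "F \<noteq> {}"
  shows "F = pos_hull (V \<inter> F)"
proof
  have "0 \<in> F" using F(2) face_of_pos_hull_scale[OF F(1), of _ 0] by auto
  show "F \<subseteq> pos_hull (V \<inter> F)"
  proof
    fix x assume x: "x \<in> F"
    then obtain c where c: "x = (\<Sum>v\<in>V. c v *\<^sub>R v)" "\<forall>v\<in>V. 0 \<le> c v"
      using face_of_imp_subset[OF F(1)] by (auto simp: pos_hull_def)
    have part: "(\<Sum>v\<in>U. c v *\<^sub>R v) \<in> pos_hull V" if "U \<subseteq> V" for U
      using pos_hull_mono[OF that V] pos_hullI[OF refl, of U c] c(2) that by blast
    have "v \<in> F" if v: "v \<in> V" "c v \<noteq> 0" for v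
    proof -
      have "x = c v *\<^sub>R v + (\<Sum>v\<in>V - {v}. c v *\<^sub>R v)" unfolding c(1) by (rule sum.remove[OF V v(1)])
      then have "c v *\<^sub>R v \<in> F"
        using face_of_pos_hull_summand[OF F(1), of "c v *\<^sub>R v" "\<Sum>v\<in>V - {v}. c v *\<^sub>R v"] x
          part[of "{v}"] part[of "V - {v}"] v(1) by auto
      then have "(1 / c v) *\<^sub>R (c v *\<^sub>R v) \<in> F" using c(2) v(1) by (intro face_of_pos_hull_scale[OF F(1) \<open>c v *\<^sub>R v \<in> F\<close>]) auto
      then show ?thesis using v(2) by simp
    qed
    then have "x = (\<Sum>v\<in>V \<inter> F. c v *\<^sub>R v)"
      unfolding c(1) using V by (intro sum.mono_neutral_right) auto
    then show "x \<in> pos_hull (V \<inter> F)" by (rule pos_hullI) (use c(2) in auto)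
  qed
  show "pos_hull (V \<inter> F) \<subseteq> F"
  proof
    fix x assume "x \<in> pos_hull (V \<inter> F)"
    then obtain c where c: "x = (\<Sum>v\<in>V \<inter> F. c v *\<^sub>R v)" "\<forall>v\<in>V \<inter> F. 0 \<le> c v"
      by (auto simp: pos_hull_def)
    have add: "y + z \<in> F" if "y \<in> F" "z \<in> F" for y z
    proof -
      have "(1 / 2) *\<^sub>R y + (1 / 2) *\<^sub>R z \<in> F" using face_of_imp_convex[OF F(1)] that by (intro convexD) auto
      then have "2 *\<^sub>R ((1 / 2) *\<^sub>R y + (1 / 2) *\<^sub>R z) \<in> F" by (intro face_of_pos_hull_scale[OF F(1)]) auto
      then show ?thesis by (simp add: scaleR_add_right)
    qed
    have "(\<Sum>v\<in>U. c v *\<^sub>R v) \<in> F" if "U \<subseteq> V \<inter> F" for U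
      using finite_subset[OF that] V that
    proof (induction U rule: infinite_finite_induct)
      case (insert v U)
      then show ?case using c(2) by (auto intro!: add face_of_pos_hull_scale[OF F(1)])
    qed (use \<open>0 \<in> F\<close> V in auto)
    then show "x \<in> F" unfolding c(1) by blast
  qed
qed

text \<open>
  For \<open>g\<close> completing \<open>W\<close> to a cone of the fan, \<open>g\<close> itself is the primitive generator of that cone
  modulo \<open>W\<close>. If \<open>-g\<close> completes \<open>W\<close> whenever \<open>g\<close> does, the balancing sum at \<open>W\<close> is its own negative.
\<close>

lemma symmetric_fan_tropical:
  assumes fin: "finite \<V>" and ne: "\<V> \<noteq> {}"
    and uni: "\<And>V. V \<in> \<V> \<Longrightarrow> unimodular J V"
    and sub: "\<And>V W. V \<in> \<V> \<Longrightarrow> W \<subseteq> V \<Longrightarrow> W \<in> \<V>"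
    and poly: "\<And>V. V \<in> \<V> \<Longrightarrow> rational_polyhedron J (pos_hull V)"
    and inter: "\<And>V W. V \<in> \<V> \<Longrightarrow> W \<in> \<V> \<Longrightarrow> pos_hull V \<inter> pos_hull W \<subseteq> pos_hull (V \<inter> W)"
    and pure: "\<And>V. V \<in> \<V> \<Longrightarrow> \<exists>W\<in>\<V>. V \<subseteq> W \<and> card W = d"
    and flip: "\<And>g W. insert g W \<in> \<V> \<Longrightarrow> g \<notin> W \<Longrightarrow> insert (- g) W \<in> \<V>"
  shows "tropical_variety J (unweighted (pos_hull ` \<V>))" (is "tropical_variety J ?\<Gamma>")
proof -
  have fV: "finite V" if "V \<in> \<V>" for V using uni[OF that] by (simp add: unimodular_def)
  have cd: "cell_dim (pos_hull V) = card V" if "V \<in> \<V>" for V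
    unfolding cell_dim_def lin_space_pos_hull[OF fV[OF that]]
    by (rule dim_span_eq_card_independent[OF unimodular_independent[OF uni[OF that]]])
  have sub_iff: "V \<subseteq> W" if "V \<in> \<V>" "W \<in> \<V>" "pos_hull V \<subseteq> pos_hull W" for V W
  proof
    fix v assume v: "v \<in> V"
    then have "v \<in> pos_hull V" using generator_in_pos_hull fV that(1) by blast
    then have "v \<in> pos_hull (V \<inter> W)" using inter[OF that(1,2)] that(3) by blast
    then show "v \<in> W" using pos_hull_subset_imp[OF uni[OF that(1)], of "V \<inter> W" v] v by auto
  qed
  have inj: "inj_on pos_hull \<V>" using sub_iff by (auto intro!: inj_onI)
  have le: "card V \<le> d" if "V \<in> \<V>" for V
    using pure[OF that] card_mono fV by metis
  obtain V0 where V0: "V0 \<in> \<V>" "card V0 = d" using ne pure by blast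
  have td: "tdim ?\<Gamma> = d"
    unfolding tdim_def
  proof (rule Max_eqI)
    show "finite (cell_dim ` cells ?\<Gamma>)" using fin by simp
    show "y \<le> d" if "y \<in> cell_dim ` cells ?\<Gamma>" for y using that cd le by auto
    show "d \<in> cell_dim ` cells ?\<Gamma>" using V0 cd by (auto simp: image_iff intro!: bexI[of _ V0])
  qed
  have fac: "facets ?\<Gamma> = pos_hull ` {V \<in> \<V>. card V = d}"
    unfolding facets_def td using cd by auto
  have "polyhedral_complex J (pos_hull ` \<V>)"
    unfolding polyhedral_complex_def
  proof (intro conjI ballI allI impI)
    show "finite (pos_hull ` \<V>)" using fin by simp
    fix \<sigma> assume "\<sigma> \<in> pos_hull ` \<V>"
    then obtain V where V: "V \<in> \<V>" "\<sigma> = pos_hull V" by blast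
    show "\<sigma> \<noteq> {}" using zero_in_pos_hull V(2) by blast
    show "rational_polyhedron J \<sigma>" using poly V by simp
    show "\<rho> \<in> pos_hull ` \<V>" if "\<rho> face_of \<sigma> \<and> \<rho> \<noteq> {}" for \<rho>
      using faces_of_pos_hull[OF fV[OF V(1)], of \<rho>] that V sub[OF V(1), of "V \<inter> \<rho>"] by blast
    fix \<sigma>' assume "\<sigma>' \<in> pos_hull ` \<V>"
    then obtain W where W: "W \<in> \<V>" "\<sigma>' = pos_hull W" by blast
    have eq: "\<sigma> \<inter> \<sigma>' = pos_hull (V \<inter> W)"
      using inter[OF V(1) W(1)] pos_hull_mono[of "V \<inter> W" V] pos_hull_mono[of "V \<inter> W" W] fV V W by auto
    show "\<sigma> \<inter> \<sigma>' face_of \<sigma>" "\<sigma> \<inter> \<sigma>' face_of \<sigma>'"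
      unfolding eq unfolding V(2) W(2)
      by (rule face_pos_hull[OF uni[OF V(1)]], blast) (rule face_pos_hull[OF uni[OF W(1)]], blast)
  qed
  moreover have "\<exists>\<rho>\<in>facets ?\<Gamma>. \<sigma> \<subseteq> \<rho>" if \<sigma>: "\<sigma> \<in> cells ?\<Gamma>" for \<sigma>
  proof -
    obtain V where V: "V \<in> \<V>" "\<sigma> = pos_hull V" using \<sigma> by auto
    obtain W where W: "W \<in> \<V>" "V \<subseteq> W" "card W = d" using pure[OF V(1)] by blast
    show ?thesis unfolding fac using W V pos_hull_mono[OF W(2) fV[OF W(1)]] by auto
  qed
  moreover have "balanced J ?\<Gamma>"
    unfolding balanced_def
  proof (intro ballI impI)
    fix \<tau> assume "\<tau> \<in> cells ?\<Gamma>" and dim: "cell_dim \<tau> + 1 = tdim ?\<Gamma>"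
    then obtain W where W: "W \<in> \<V>" "\<tau> = pos_hull W" by auto
    have cW: "card W + 1 = d" using dim td cd W by simp
    define G where "G = {g. g \<notin> W \<and> insert g W \<in> \<V>}"
    define v where "v \<sigma> = (THE g. g \<in> G \<and> \<sigma> = pos_hull (insert g W))" for \<sigma>
    have injG: "inj_on (\<lambda>g. pos_hull (insert g W)) G"
    proof (rule inj_onI)
      fix g h assume gh: "g \<in> G" "h \<in> G" "pos_hull (insert g W) = pos_hull (insert h W)"
      then have "insert g W = insert h W" using inj by (auto simp: G_def dest: inj_onD)
      then show "g = h" using gh by (auto simp: G_def)
    qed
    have v: "v (pos_hull (insert g W)) = g" if "g \<in> G" for g
      unfolding v_def using that injG by (intro the_equality) (auto dest: inj_onD)
    have star: "{\<sigma>. \<sigma> \<in> facets ?\<Gamma> \<and> \<tau> \<subseteq> \<sigma>} = (\<lambda>g. pos_hull (insert g W)) ` G" (is "?l = ?r")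
    proof (intro equalityI subsetI)
      fix \<sigma> assume "\<sigma> \<in> ?l"
      then obtain V where V: "V \<in> \<V>" "card V = d" "\<sigma> = pos_hull V" "pos_hull W \<subseteq> pos_hull V"
        unfolding fac W(2) by blast
      have "W \<subseteq> V" using sub_iff W V by blast
      then have "card (V - W) = 1" using V(2) cW fV[OF W(1)] by (simp add: card_Diff_subset)
      then obtain g where "V - W = {g}" by (auto simp: card_1_singleton_iff)
      then have "V = insert g W" "g \<notin> W" using \<open>W \<subseteq> V\<close> by auto
      then show "\<sigma> \<in> ?r" using V by (auto simp: G_def)
    next
      fix \<sigma> assume "\<sigma> \<in> ?r"
      then obtain g where g: "g \<in> G" "\<sigma> = pos_hull (insert g W)" by blast
      then have "card (insert g W) = d" "insert g W \<in> \<V>" using fV[OF W(1)] cW by (auto simp: G_def)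
      then have "\<sigma> \<in> facets ?\<Gamma>" unfolding fac using g(2) by blast
      moreover have "\<tau> \<subseteq> \<sigma>"
        unfolding W(2) g(2) by (rule pos_hull_mono[OF subset_insertI]) (simp add: fV[OF W(1)])
      ultimately show "\<sigma> \<in> ?l" by blast
    qed
    have neg: "- g \<in> G" if "g \<in> G" for g
    proof -
      have g: "g \<notin> W" "insert g W \<in> \<V>" using that by (auto simp: G_def)
      have "- g \<notin> W"
      proof
        assume "- g \<in> W"
        then have "g \<in> span W" using span_neg[OF span_base[of "- g" W]] by simp
        moreover have "independent (insert g W)" by (rule unimodular_independent[OF uni[OF g(2)]])
        ultimately show False using g(1) by (simp add: independent_insert)
      qed
      then show ?thesis using flip[OF g(2,1)] by (simp add: G_def)
    qed
    have "(\<Sum>g\<in>G. g) = (\<Sum>g\<in>G. - g)"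
      by (rule sum.reindex_bij_witness[where i = uminus and j = uminus]) (use neg in auto)
    then have "(\<Sum>g\<in>G. g) = - (\<Sum>g\<in>G. g)" by (simp add: sum_negf)
    then have "2 *\<^sub>R (\<Sum>g\<in>G. g) = 0" by (metis add.right_inverse scaleR_2)
    then have sum0: "(\<Sum>g\<in>G. g) = 0" by simp
    have "(\<Sum>\<sigma> | \<sigma> \<in> facets ?\<Gamma> \<and> \<tau> \<subseteq> \<sigma>. of_nat (weight ?\<Gamma> \<sigma>) *\<^sub>R v \<sigma>) = (\<Sum>g\<in>G. g)"
      unfolding star using v by (subst sum.reindex[OF injG]) simp
    then have bal: "(\<Sum>\<sigma> | \<sigma> \<in> facets ?\<Gamma> \<and> \<tau> \<subseteq> \<sigma>. of_nat (weight ?\<Gamma> \<sigma>) *\<^sub>R v \<sigma>) \<in> lin_space \<tau>"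
      using sum0 subspace_0[OF subspace_lin_space] by simp
    have "primitive_generator J \<tau> \<sigma> (v \<sigma>)" if \<sigma>: "\<sigma> \<in> facets ?\<Gamma>" "\<tau> \<subseteq> \<sigma>" for \<sigma>
    proof -
      obtain g where g: "g \<in> G" "\<sigma> = pos_hull (insert g W)" using \<sigma> star by blast
      have gW: "insert g W \<in> \<V>" "g \<notin> W" using g by (auto simp: G_def)
      have fW: "finite W" using fV W by blast
      have U: "unimodular J (insert g W)" by (rule uni[OF gW(1)])
      have gl: "g \<in> int_lattice J" using U by (auto simp: unimodular_def)
      have ls: "lin_space \<sigma> = span (insert g W)" "lin_space \<tau> = span W"
        unfolding g(2) W(2) using lin_space_pos_hull fW by auto
      have "cell_lattice J \<sigma> = {w + of_int k *\<^sub>R g |w k. w \<in> cell_lattice J \<tau>}"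
      proof (intro equalityI subsetI)
        fix x assume "x \<in> cell_lattice J \<sigma>"
        then have x: "x \<in> int_lattice J" "x \<in> span (insert g W)" by (auto simp: cell_lattice_def ls)
        obtain c where c: "x = (\<Sum>v\<in>insert g W. c v *\<^sub>R v)"
          using x(2) span_finite[of "insert g W"] fW by auto
        then have "c g \<in> \<int>" using unimodularD[OF U, of c g] x(1) by simp
        then obtain k where k: "c g = of_int k" by (auto elim: Ints_cases)
        define w where "w = (\<Sum>v\<in>W. c v *\<^sub>R v)"
        have xw: "x = w + of_int k *\<^sub>R g" using gW fW by (simp add: c w_def k add.commute)
        have "w \<in> span W" unfolding w_def by (intro span_sum span_scale span_base)
        moreover have "w \<in> int_lattice J"
          using int_lattice_add[OF x(1) int_lattice_minus[OF int_lattice_scale[OF gl, of "of_int k"]]] xw by simp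
        ultimately show "x \<in> {w + of_int k *\<^sub>R g |w k. w \<in> cell_lattice J \<tau>}"
          using xw by (auto simp: cell_lattice_def ls)
      next
        fix x assume "x \<in> {w + of_int k *\<^sub>R g |w k. w \<in> cell_lattice J \<tau>}"
        then obtain w k where w: "x = w + of_int k *\<^sub>R g" "w \<in> int_lattice J" "w \<in> span W"
          by (auto simp: cell_lattice_def ls)
        have "w \<in> span (insert g W)" using w(3) span_mono[of W "insert g W"] by blast
        then have "x \<in> span (insert g W)"
          unfolding w(1) by (intro span_add span_scale) (auto intro: span_base)
        moreover have "x \<in> int_lattice J" unfolding w(1) by (intro int_lattice_add int_lattice_scale w gl) auto
        ultimately show "x \<in> cell_lattice J \<sigma>" by (auto simp: cell_lattice_def ls)
      qed
      moreover have "g \<in> cell_lattice J \<sigma>" using gl span_base[of g "insert g W"] by (auto simp: cell_lattice_def ls)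
      moreover have "\<exists>x\<in>\<tau>. \<exists>t>0. x + t *\<^sub>R g \<in> \<sigma>"
        unfolding g(2) W(2) using zero_in_pos_hull generator_in_pos_hull[of "insert g W" g] fW
        by (intro bexI[of _ 0] exI[of _ 1]) auto
      ultimately show ?thesis unfolding primitive_generator_def using v[OF g(1)] g(2) by simp
    qed
    with bal show "\<exists>v. (\<forall>\<sigma>\<in>facets ?\<Gamma>. \<tau> \<subseteq> \<sigma> \<longrightarrow> primitive_generator J \<tau> \<sigma> (v \<sigma>)) \<and>
       (\<Sum>\<sigma> | \<sigma> \<in> facets ?\<Gamma> \<and> \<tau> \<subseteq> \<sigma>. of_nat (weight ?\<Gamma> \<sigma>) *\<^sub>R v \<sigma>) \<in> lin_space \<tau>"
      by blast
  qed
  ultimately show ?thesis using ne by (simp add: tropical_variety_def)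
qed

section \<open>Tropical curves in the line\<close>

lemma complex_cellD:
  assumes "polyhedral_complex J K" "\<sigma> \<in> K"
  shows "\<sigma> \<noteq> {}" "rational_polyhedron J \<sigma>" "\<sigma> \<subseteq> euclid J"
  using assms rational_polyhedron_in_euclid unfolding polyhedral_complex_def by metis+

lemma euclid_singleton: "x \<in> euclid {k} \<longleftrightarrow> x = single k (lookup x k)"
proof
  assume "x \<in> euclid {k}"
  then show "x = single k (lookup x k)"
    by (intro poly_mapping_eqI) (auto simp: lookup_single when_def euclid_iff)
next
  assume "x = single k (lookup x k)"
  then show "x \<in> euclid {k}" using single_in_euclid[of k "{k}"] by (metis singletonI)
qed

lemma euclid_singletonE:
  assumes "x \<in> euclid {k}"
  obtains a where "x = single k a"
  by (rule that) (rule iffD1[OF euclid_singleton assms])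

lemma lin_space_transverse_line:
  assumes "\<sigma> \<subseteq> euclid {k}" "transverse k \<sigma>"
  shows "lin_space \<sigma> = euclid {k}"
proof
  show "lin_space \<sigma> \<subseteq> euclid {k}" by (rule lin_space_euclid[OF assms(1)])
  obtain g where g: "g \<in> lin_space \<sigma>" "lookup g k \<noteq> 0"
    using assms(2) by (auto simp: transverse_def)
  show "euclid {k} \<subseteq> lin_space \<sigma>"
  proof
    fix x assume x: "x \<in> euclid {k}"
    have ge: "g \<in> euclid {k}" using g lin_space_euclid[OF assms(1)] by blast
    have "x = (lookup x k / lookup g k) *\<^sub>R g"
    proof (rule poly_mapping_eqI)
      fix j
      show "lookup x j
          = lookup ((lookup x k / lookup g k) *\<^sub>R g) j"
        using x ge g(2) by (cases "j = k") (auto simp: euclid_iff)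
    qed
    then show "x \<in> lin_space \<sigma>" using subspace_scale[OF subspace_lin_space g(1)] by metis
  qed
qed

lemma transverse_line_iff_dim:
  assumes "\<sigma> \<subseteq> euclid {k}"
  shows "transverse k \<sigma> \<longleftrightarrow> cell_dim \<sigma> = 1"
proof
  assume "transverse k \<sigma>"
  then show "cell_dim \<sigma> = 1"
    unfolding cell_dim_def by (simp add: lin_space_transverse_line[OF assms] dim_euclid)
next
  assume d: "cell_dim \<sigma> = 1"
  show "transverse k \<sigma>"
  proof (rule ccontr)
    assume n: "\<not> transverse k \<sigma>"
    have "lin_space \<sigma> \<subseteq> {0}"
    proof
      fix x assume x: "x \<in> lin_space \<sigma>"
      then have "lookup x k = 0" using n by (auto simp: transverse_def)
      moreover have "x \<in> euclid {k}" using x lin_space_euclid[OF assms] by blast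
      ultimately show "x \<in> {0}" using euclid_singleton[of x k] by simp
    qed
    then have "lin_space \<sigma> = lin_space {0}" using subspace_0[OF subspace_lin_space[of \<sigma>]] by auto
    then have "cell_dim \<sigma> = cell_dim {0 :: 'a rvec}" unfolding cell_dim_def by simp
    with d show False by simp
  qed
qed

text \<open>
  A boundary point of the support would be a vertex all of whose edges leave on the same side, which
  contradicts balancing. The sign \<open>s\<close> treats both directions of the line at once.
\<close>

lemma curve_support_one_sided:
  assumes C: "tropical_curve {k} C" and s: "s * s = (1::real)"
    and t0: "single k (s * t0) \<in> support C" and lt: "t0 < t1"
  shows "single k (s * t1) \<in> support C"
proof (rule ccontr)
  assume no: "single k (s * t1) \<notin> support C"
  let ?f = "\<lambda>t. single k (s * t)"
  have tv: "tropical_variety {k} C" and td: "tdim C = 1" using C by (auto simp: tropical_curve_def)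
  have pc: "polyhedral_complex {k} (cells C)" using tv by (simp add: tropical_variety_def)
  have rp: "rational_polyhedron {k} \<sigma>" if "\<sigma> \<in> cells C" for \<sigma>
    by (rule complex_cellD(2)[OF pc that])
  have fin: "finite (cells C)" using pc by (auto simp: polyhedral_complex_def)
  have clS: "closed (support C)"
    unfolding support_def using fin rp closed_rational_polyhedron by (intro closed_Union) auto
  (* m is the last point of the support before the gap that contains t1 *)
  define A where "A = {t. t \<le> t1 \<and> ?f t \<in> support C}"
  have fe: "?f = (\<lambda>t. t *\<^sub>R single k s)" by (simp add: mult.commute)
  have "continuous_on UNIV ?f" unfolding fe by (intro continuous_intros)
  then have "closed (?f -` support C)" using clS by (simp add: continuous_on_closed_vimage)
  moreover have "A = {..t1} \<inter> ?f -` support C" by (auto simp: A_def)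
  ultimately have clA: "closed A" by (auto intro: closed_Int)
  have neA: "A \<noteq> {}" using t0 lt by (auto simp: A_def intro: exI[of _ t0])
  have bA: "bdd_above A" by (auto simp: A_def)
  define m where "m = Sup A"
  have mA: "m \<in> A" unfolding m_def by (rule closed_contains_Sup[OF neA bA clA])
  then have mt: "m < t1" using no by (auto simp: A_def order.order_iff_strict)
  have gap: "?f t \<notin> support C" if "m < t" "t \<le> t1" for t
    using cSup_upper[OF _ bA, of t] that by (fastforce simp: A_def m_def)
  define p where "p = ?f m"
  have pS: "p \<in> support C" using mA by (simp add: A_def p_def)
  have sc: "y = ?f (s * lookup y k)" if "y \<in> euclid {k}" for y
    using that s unfolding euclid_singleton by (metis mult.assoc mult_1)
  have sm: "s * (s * t) = t" for t using s by (metis mult.assoc mult_1)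
  have side: "s * lookup y k \<le> m" if \<sigma>: "\<sigma> \<in> cells C" "p \<in> \<sigma>" and y: "y \<in> \<sigma>" for \<sigma> y
  proof (rule ccontr)
    assume gt: "\<not> ?thesis"
    define t where "t = s * lookup y k"
    have t: "m < t" using gt by (simp add: t_def)
    have yf: "y = ?f t" using sc rational_polyhedron_in_euclid[OF rp[OF \<sigma>(1)]] y by (auto simp: t_def)
    define t' where "t' = min t t1"
    have t': "m < t'" "t' \<le> t1" "t' \<le> t" using t mt by (auto simp: t'_def)
    define u where "u = (t' - m) / (t - m)"
    have "u * (t - m) = t' - m" using t by (simp add: u_def)
    then have "t' = (1 - u) * m + u * t" by (simp add: algebra_simps)
    moreover have "0 \<le> u" "u \<le> 1" using t t' by (simp_all add: u_def)
    ultimately have u: "0 \<le> u" "u \<le> 1" "t' = (1 - u) * m + u * t" by blast+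
    have "?f t' = (1 - u) *\<^sub>R p + u *\<^sub>R y"
      unfolding u(3) p_def yf by (simp add: single_add[symmetric] algebra_simps)
    also have "\<dots> \<in> \<sigma>" using convex_rational_polyhedron[OF rp[OF \<sigma>(1)]] \<sigma>(2) y u by (intro convexD) auto
    finally show False using gap[OF t'(1,2)] \<sigma>(1) by (auto simp: support_def)
  qed
  obtain \<rho> where \<rho>: "\<rho> \<in> facets C" "p \<in> \<rho>"
  proof -
    obtain \<sigma> where "\<sigma> \<in> cells C" "p \<in> \<sigma>" using pS by (auto simp: support_def)
    moreover obtain \<rho> where "\<rho> \<in> facets C" "\<sigma> \<subseteq> \<rho>" using tv calculation unfolding tropical_variety_def by blast
    ultimately show thesis using that by blast
  qed
  have \<rho>c: "\<rho> \<in> cells C" using \<rho> by (simp add: facets_def)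
  have pk: "s * lookup p k = m" by (simp add: p_def sm)
  have "{p} face_of \<rho>"
    unfolding face_of_def
  proof (intro conjI ballI impI)
    fix a b x assume ab: "a \<in> \<rho>" "b \<in> \<rho>" and x: "x \<in> {p}" "x \<in> open_segment a b"
    obtain u where u: "0 < u" "u < 1" "p = (1 - u) *\<^sub>R a + u *\<^sub>R b" using x by (auto simp: in_segment)
    let ?a = "s * lookup a k" and ?b = "s * lookup b k"
    have le: "?a \<le> m" "?b \<le> m" using side[OF \<rho>c \<rho>(2)] ab by auto
    have "m = (1 - u) * ?a + u * ?b" unfolding pk[symmetric] u(3) lookup_add lookup_scaleR
      by (simp add: algebra_simps)
    then have "(1 - u) * (m - ?a) + u * (m - ?b) = 0" by (simp add: algebra_simps)
    moreover have "0 \<le> (1 - u) * (m - ?a)" "0 \<le> u * (m - ?b)" using u le by auto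
    ultimately have "(1 - u) * (m - ?a) = 0" "u * (m - ?b) = 0" by linarith+
    then have "?a = m" "?b = m" using u by auto
    moreover have "a \<in> euclid {k}" "b \<in> euclid {k}"
      using rational_polyhedron_in_euclid[OF rp[OF \<rho>c]] ab by auto
    ultimately show "a \<in> {p}" "b \<in> {p}" using sc[of a] sc[of b] by (auto simp: p_def)
  qed (use \<rho> in auto)
  then have pcell: "{p} \<in> cells C" 
    using pc \<rho>c unfolding polyhedral_complex_def by (metis insert_not_empty)
  have "balanced {k} C" using tv by (simp add: tropical_variety_def)
  moreover have "cell_dim {p} + 1 = tdim C" using td by simp
  ultimately obtain v where
    v: "\<forall>\<sigma>\<in>facets C. {p} \<subseteq> \<sigma> \<longrightarrow> primitive_generator {k} {p} \<sigma> (v \<sigma>)"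
      "(\<Sum>\<sigma> | \<sigma> \<in> facets C \<and> {p} \<subseteq> \<sigma>. of_nat (weight C \<sigma>) *\<^sub>R v \<sigma>) \<in> lin_space {p}"
    using pcell unfolding balanced_def by blast
  have vneg: "s * lookup (v \<sigma>) k < 0" if \<sigma>: "\<sigma> \<in> facets C" "p \<in> \<sigma>" for \<sigma>
  proof -
    have \<sigma>c: "\<sigma> \<in> cells C" "cell_dim \<sigma> = 1" using \<sigma> td by (auto simp: facets_def)
    have \<sigma>e: "\<sigma> \<subseteq> euclid {k}" by (rule rational_polyhedron_in_euclid[OF rp[OF \<sigma>c(1)]])
    have pg: "primitive_generator {k} {p} \<sigma> (v \<sigma>)" using v(1) \<sigma> by simp
    obtain t where t: "t > 0" "p + t *\<^sub>R v \<sigma> \<in> \<sigma>" using pg by (auto simp: primitive_generator_def)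
    have "s * lookup (p + t *\<^sub>R v \<sigma>) k \<le> m" by (rule side[OF \<sigma>c(1) \<sigma>(2) t(2)])
    then have "t * (s * lookup (v \<sigma>) k) \<le> 0"
      using pk by (simp add: lookup_add algebra_simps)
    then have le: "s * lookup (v \<sigma>) k \<le> 0" using t(1) by (simp add: mult_le_0_iff)
    have ls: "lin_space \<sigma> = euclid {k}"
      using lin_space_transverse_line[OF \<sigma>e] transverse_line_iff_dim[OF \<sigma>e] \<sigma>c(2) by simp
    have "single k 1 \<in> cell_lattice {k} \<sigma>"
      by (simp add: cell_lattice_def ls int_lattice_single single_in_euclid)
    then obtain w n where w: "single k 1 = w + of_int n *\<^sub>R v \<sigma>" "w \<in> cell_lattice {k} {p}"
      using pg unfolding primitive_generator_def by blast
    have "w = 0" using w(2) by (simp add: cell_lattice_def)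
    then have "(1::real) = of_int n * lookup (v \<sigma>) k"
      using arg_cong[OF w(1), of "\<lambda>x. lookup x k"] by simp
    then have "lookup (v \<sigma>) k \<noteq> 0" by auto
    moreover have "s \<noteq> 0" using s by auto
    ultimately show ?thesis using le by (auto simp: order.order_iff_strict)
  qed
  let ?S = "{\<sigma>. \<sigma> \<in> facets C \<and> {p} \<subseteq> \<sigma>}"
  have "finite ?S" using fin by (auto simp: facets_def)
  moreover have "?S \<noteq> {}" using \<rho> by auto
  moreover have "of_nat (weight C \<sigma>) * (s * lookup (v \<sigma>) k) < 0" if "\<sigma> \<in> ?S" for \<sigma>
    using vneg[of \<sigma>] that tv by (auto simp: tropical_variety_def mult_less_0_iff)
  ultimately have "(\<Sum>\<sigma>\<in>?S. of_nat (weight C \<sigma>) * (s * lookup (v \<sigma>) k)) < 0"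
    using sum_strict_mono[of ?S _ "\<lambda>_. 0::real"] by simp
  moreover have "(\<Sum>\<sigma>\<in>?S. of_nat (weight C \<sigma>) * (s * lookup (v \<sigma>) k))
      = s * lookup (\<Sum>\<sigma>\<in>?S. of_nat (weight C \<sigma>) *\<^sub>R v \<sigma>) k"
    by (simp add: lookup_sum sum_distrib_left algebra_simps)
  moreover have "(\<Sum>\<sigma>\<in>?S. of_nat (weight C \<sigma>) *\<^sub>R v \<sigma>) = 0" using v(2) by simp
  ultimately show False by simp
qed

lemma curve_support:
  assumes C: "tropical_curve {k} C"
  shows "support C = euclid {k}"
proof
  have pc: "polyhedral_complex {k} (cells C)" "cells C \<noteq> {}"
    using C by (auto simp: tropical_curve_def tropical_variety_def)
  then show "support C \<subseteq> euclid {k}"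
    unfolding support_def using complex_cellD(3) by blast
  obtain \<sigma> where \<sigma>: "\<sigma> \<in> cells C" using pc(2) by blast
  then obtain x0 where x0: "x0 \<in> \<sigma>" using complex_cellD(1)[OF pc(1)] by blast
  have x0S: "x0 \<in> support C" using \<sigma> x0 by (auto simp: support_def)
  then have "x0 \<in> euclid {k}" using \<open>support C \<subseteq> euclid {k}\<close> by blast
  then obtain a where a: "x0 = single k a" by (rule euclid_singletonE)
  show "euclid {k} \<subseteq> support C"
  proof
    fix x assume "x \<in> euclid {k}"
    then obtain b where b: "x = single k b" by (rule euclid_singletonE)
    consider "a = b" | "a < b" | "- a < - b" by linarith
    then show "x \<in> support C"
    proof cases
      case 1
      then show ?thesis using x0S a b by simp
    next
      case 2
      then show ?thesis using curve_support_one_sided[OF C _ _ 2, of 1] x0S a b by simp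
    next
      case 3
      then show ?thesis using curve_support_one_sided[OF C _ _ 3, of "-1"] x0S a b by simp
    qed
  qed
qed

text \<open>
  For a displacement \<open>v\<close>, the curve covers all points \<open>-\<epsilon>v\<close>, hence one of its finitely many convex
  facets contains \<open>-\<epsilon>v\<close> for all small \<open>\<epsilon>\<close>, and this facet contributes to the intersection.
\<close>

lemma positive_divisor_origin:
  fixes k :: 'k
  defines "D \<equiv> unweighted {{0 :: 'k rvec}}"
  shows "positive_divisor {k} D"
  unfolding positive_divisor_def
proof (intro conjI allI impI)
  have z: "(0 :: 'k rvec) \<in> euclid {k}" by (rule subspace_0[OF subspace_euclid])
  note var = disjoint_affine_tropical[of "{{0 :: 'k rvec}}" "{k}" 0, folded D_def]
  have D: "tropical_variety {k} D" "tdim D = 0"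
    using var rational_polyhedron_point[of "{k}" "0 :: 'k rvec"] z by (simp_all add: disjoint_def)
  then show "tropical_divisor {k} D" by (simp add: tropical_divisor_def)
  have fD: "facets D = {{0}}" unfolding facets_def D(2) by (auto simp: D_def)
  fix C assume C: "tropical_curve {k} C"
  then have tv: "tropical_variety {k} C" and td: "tdim C = 1" by (auto simp: tropical_curve_def)
  then have pc: "polyhedral_complex {k} (cells C)" by (simp add: tropical_variety_def)
  have rp: "rational_polyhedron {k} \<sigma>" if "\<sigma> \<in> cells C" for \<sigma>
    by (rule complex_cellD(2)[OF pc that])
  have sub: "\<sigma> \<subseteq> euclid {k}" if "\<sigma> \<in> cells C" for \<sigma>
    by (rule rational_polyhedron_in_euclid[OF rp[OF that]])
  have fin: "finite (cells C)" using pc by (auto simp: polyhedral_complex_def)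
  have finF: "finite (facets C)" using fin by (simp add: facets_def)
  (* a vertex of the curve is met by the displaced origin for at most one value of \<epsilon> *)
  have "generic {k} D C (single k 1)"
  proof -
    let ?v = "single k (1::real)"
    have "\<forall>\<^sub>F \<epsilon> in at_right 0. {0} \<inter> (+) (\<epsilon> *\<^sub>R ?v) ` \<sigma> \<noteq> {}
        \<longrightarrow> sum_set (lin_space {0}) (lin_space \<sigma>) = euclid {k}" if \<sigma>: "\<sigma> \<in> cells C" for \<sigma>
    proof (cases "transverse k \<sigma>")
      case True
      then show ?thesis by (simp add: lin_space_transverse_line[OF sub[OF \<sigma>]] sum_set_def)
    next
      case False
      obtain q where q: "q \<in> \<sigma>" using complex_cellD(1)[OF pc \<sigma>] by blast
      have "\<forall>\<^sub>F \<epsilon> in at_right 0. \<epsilon> \<noteq> - lookup q k"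
        by (rule eventually_neq_at_within)
      then show ?thesis
      proof (rule eventually_mono, intro impI)
        fix \<epsilon> assume ne: "\<epsilon> \<noteq> - lookup q k" and "{0} \<inter> (+) (\<epsilon> *\<^sub>R ?v) ` \<sigma> \<noteq> {}"
        then obtain x where x: "x \<in> \<sigma>" "0 = \<epsilon> *\<^sub>R ?v + x" by blast
        have "lookup x k = - \<epsilon>"
          using arg_cong[OF x(2), of "\<lambda>x. lookup x k"] by (simp add: lookup_add)
        then have False using ne not_transverse_const[OF False x(1) q] by simp
        then show "sum_set (lin_space {0}) (lin_space \<sigma>) = euclid {k}" ..
      qed
    qed
    then have "\<forall>\<^sub>F \<epsilon> in at_right 0. \<forall>\<sigma>\<in>cells C. {0} \<inter> (+) (\<epsilon> *\<^sub>R ?v) ` \<sigma> \<noteq> {}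
        \<longrightarrow> sum_set (lin_space {0}) (lin_space \<sigma>) = euclid {k}"
      using fin by (intro eventually_ball_finite) auto
    then show ?thesis by (simp add: generic_def D_def single_in_euclid)
  qed
  define v where "v = (SOME v. generic {k} D C v)"
  have "generic {k} D C v" unfolding v_def by (rule someI) fact
  then have v: "v \<in> euclid {k}" by (simp add: generic_def)
  have SI: "stable_intersection {k} D C = displaced_intersection {k} v D C"
    by (simp add: stable_intersection_def v_def)
  have cover: "\<exists>\<sigma>\<in>facets C. - (\<epsilon> *\<^sub>R v) \<in> \<sigma>" for \<epsilon>
  proof -
    have "- (\<epsilon> *\<^sub>R v) \<in> support C"
      unfolding curve_support[OF C] by (intro subspace_neg subspace_scale subspace_euclid v)
    then obtain \<sigma> where "\<sigma> \<in> cells C" "- (\<epsilon> *\<^sub>R v) \<in> \<sigma>" by (auto simp: support_def)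
    then show ?thesis using tv unfolding tropical_variety_def by blast
  qed
  have "\<exists>\<sigma>\<in>facets C. \<exists>\<^sub>F \<epsilon> in at_right 0. - (\<epsilon> *\<^sub>R v) \<in> \<sigma>"
  proof (rule ccontr)
    assume "\<not> ?thesis"
    then have "\<forall>\<sigma>\<in>facets C. \<forall>\<^sub>F \<epsilon> in at_right 0. - (\<epsilon> *\<^sub>R v) \<notin> \<sigma>" by (simp add: not_frequently)
    then have "\<forall>\<^sub>F \<epsilon> in at_right 0. \<forall>\<sigma>\<in>facets C. - (\<epsilon> *\<^sub>R v) \<notin> \<sigma>"
      by (rule eventually_ball_finite[OF finF])
    then have "\<forall>\<^sub>F \<epsilon> in at_right (0::real). False" by (rule eventually_mono) (use cover in blast)
    then show False by simp
  qed
  then obtain \<sigma> where \<sigma>: "\<sigma> \<in> facets C" and freq: "\<exists>\<^sub>F \<epsilon> in at_right 0. - (\<epsilon> *\<^sub>R v) \<in> \<sigma>" by blast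
  have \<sigma>c: "\<sigma> \<in> cells C" "cell_dim \<sigma> = 1" using \<sigma> td by (auto simp: facets_def)
  have small: "\<exists>\<epsilon>. 0 < \<epsilon> \<and> \<epsilon> < b \<and> - (\<epsilon> *\<^sub>R v) \<in> \<sigma>" if "0 < b" for b :: real
  proof (rule ccontr)
    assume "\<not> ?thesis"
    then have "\<forall>\<^sub>F \<epsilon> in at_right 0. - (\<epsilon> *\<^sub>R v) \<notin> \<sigma>"
      unfolding eventually_at_right_field using that by blast
    then show False using freq by (simp add: frequently_def)
  qed
  obtain e0 where e0: "0 < e0" "- (e0 *\<^sub>R v) \<in> \<sigma>" using small[of 1] by auto
  have ev: "\<forall>\<^sub>F \<epsilon> in at_right 0. - (\<epsilon> *\<^sub>R v) \<in> \<sigma>"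
    unfolding eventually_at_right_field
  proof (intro exI[of _ e0] conjI allI impI)
    fix e assume e: "0 < e" "e < e0"
    obtain e1 where e1: "0 < e1" "e1 < e" "- (e1 *\<^sub>R v) \<in> \<sigma>" using small[OF e(1)] by blast
    define u where "u = (e - e1) / (e0 - e1)"
    have "u * (e0 - e1) = e - e1" using e e1 by (simp add: u_def)
    then have "e = (1 - u) * e1 + u * e0" by (simp add: algebra_simps)
    moreover have "0 \<le> u" "u \<le> 1" using e e1 by (simp_all add: u_def)
    ultimately have u: "0 \<le> u" "u \<le> 1" "e = (1 - u) * e1 + u * e0" by blast+
    have "(1 - u) *\<^sub>R (- (e1 *\<^sub>R v)) + u *\<^sub>R (- (e0 *\<^sub>R v)) \<in> \<sigma>"
      using convex_rational_polyhedron[OF rp[OF \<sigma>c(1)]] e0 e1 u by (intro convexD) auto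
    moreover have "(1 - u) *\<^sub>R (- (e1 *\<^sub>R v)) + u *\<^sub>R (- (e0 *\<^sub>R v)) = - (((1 - u) * e1 + u * e0) *\<^sub>R v)"
      by (simp add: scaleR_add_left)
    ultimately show "- (e *\<^sub>R v) \<in> \<sigma>" using u(3) by simp
  qed (rule e0)
  have lim: "limit_cell v {0} \<sigma> = {0}"
  proof
    show "limit_cell v {0} \<sigma> \<subseteq> {0}" by (rule limit_cell_subset_closed) simp
    have "\<forall>\<^sub>F \<epsilon> in at_right 0. 0 \<in> {0} \<inter> (+) (\<epsilon> *\<^sub>R v) ` \<sigma>"
    proof (rule eventually_mono[OF ev])
      fix \<epsilon> assume "- (\<epsilon> *\<^sub>R v) \<in> \<sigma>"
      then have "\<epsilon> *\<^sub>R v + - (\<epsilon> *\<^sub>R v) \<in> (+) (\<epsilon> *\<^sub>R v) ` \<sigma>" by blast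
      then show "0 \<in> {0} \<inter> (+) (\<epsilon> *\<^sub>R v) ` \<sigma>" by simp
    qed
    then show "{0} \<subseteq> limit_cell v {0} \<sigma>"
      unfolding limit_cell_def by (auto intro!: exI[of _ "\<lambda>_. 0"])
  qed
  have disp: "displaced_facets {k} v D C = {{0}}"
  proof (intro equalityI subsetI)
    fix \<tau> assume "\<tau> \<in> displaced_facets {k} v D C"
    then obtain \<sigma>' where \<tau>: "\<tau> \<noteq> {}" "\<tau> = limit_cell v {0} \<sigma>'"
      unfolding displaced_facets_def fD by blast
    have "\<tau> \<subseteq> {0}" unfolding \<tau>(2) by (rule limit_cell_subset_closed) simp
    then show "\<tau> \<in> {{0}}" using \<tau>(1) subset_singletonD by blast
  next
    fix \<tau> :: "'k rvec set" assume "\<tau> \<in> {{0}}"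
    then have \<tau>: "\<tau> = {0}" by simp
    show "\<tau> \<in> displaced_facets {k} v D C"
      unfolding displaced_facets_def fD \<tau> mem_Collect_eq
      by (intro conjI bexI[of _ "{0}"] bexI[of _ \<sigma>]) (simp_all only: lim \<sigma>c(2) \<sigma> cell_dim_point, simp_all)
  qed
  have cl: "cells (stable_intersection {k} D C) = {{0}}"
    unfolding SI displaced_intersection_def tropical.simps disp by (rule faces_of_affine_cells) auto
  have fc: "facets (stable_intersection {k} D C) = {{0}}"
    unfolding facets_def tdim_def cl by auto
  let ?P = "{(\<rho>, \<rho>'). \<rho> \<in> facets D \<and> \<rho>' \<in> facets C \<and> limit_cell v \<rho> \<rho>' = {0}}"
  let ?w = "\<lambda>(\<rho>, \<rho>'). weight D \<rho> * weight C \<rho>' *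
    subgroup_index (int_lattice {k}) (sum_set (cell_lattice {k} \<rho>) (cell_lattice {k} \<rho>'))"
  have finP: "finite ?P"
    by (rule finite_subset[of _ "facets D \<times> facets C"]) (use finF fD in auto)
  have inP: "({0}, \<sigma>) \<in> ?P" using \<sigma> lim fD by simp
  have "transverse k \<sigma>" using transverse_line_iff_dim[OF sub[OF \<sigma>c(1)]] \<sigma>c(2) by simp
  then have ls: "lin_space \<sigma> = euclid {k}" by (rule lin_space_transverse_line[OF sub[OF \<sigma>c(1)]])
  have cl\<sigma>: "cell_lattice {k} \<sigma> = int_lattice {k}"
    unfolding cell_lattice_def ls int_lattice_def by blast
  have "(0 :: 'k rvec) \<in> cell_lattice {k} {0}" "cell_lattice {k} {0 :: 'k rvec} \<subseteq> int_lattice {k}"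
    unfolding cell_lattice_def by (simp_all add: int_lattice_0)
  then have idx: "subgroup_index (int_lattice {k}) (sum_set (cell_lattice {k} {0 :: 'k rvec}) (int_lattice {k})) = 1"
    by (rule subgroup_index_self)
  have "0 < weight C \<sigma>" using tv \<sigma> unfolding tropical_variety_def by blast
  then have "0 < ?w ({0}, \<sigma>)" unfolding prod.case cl\<sigma> idx by (simp add: D_def)
  also have "?w ({0}, \<sigma>) \<le> sum ?w ?P" by (rule member_le_sum[OF inP _ finP]) simp
  also have "sum ?w ?P = tropical_degree (stable_intersection {k} D C)"
    unfolding tropical_degree_def fc by (simp add: SI displaced_intersection_def)
  finally show "0 < tropical_degree (stable_intersection {k} D C)" .
qed

section \<open>Two crossing planes as a fan\<close>

text \<open>Generating sets of the cones of the fan that subdivides the line spanned by \<open>u\<close> at the origin.\<close>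

definition line_fan :: "'k rvec \<Rightarrow> 'k rvec set set" where
  "line_fan u = insert {} {{s *\<^sub>R u} | s. s \<in> {1, - 1} \<and> u \<noteq> 0}"

text \<open>
  The condition under which the rays of two lines form one unimodular fan: the generators are primitive,
  and a line that occurs twice must come with the same generator, so that its rays coincide as cells.
  The degenerate case of two zero vectors occurs for projections that kill both lines; a single
  vanishing generator would destroy purity.
\<close>

definition crossing :: "'k set \<Rightarrow> (bool \<Rightarrow> 'k rvec) \<Rightarrow> bool" where
  "crossing J U \<longleftrightarrow> (\<forall>k. U k = 0) \<or>
     (\<forall>k. unimodular J {U k}) \<and>
     (U False = U True \<or> (\<forall>a b. a *\<^sub>R U False = b *\<^sub>R U True \<longrightarrow> a = 0 \<and> b = 0))"

lemma unimodular_empty: "unimodular J {}"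
  by (simp add: unimodular_def)

lemma unimodular_singleton:
  "unimodular J {u} \<longleftrightarrow> u \<in> int_lattice J \<and> (\<forall>c. c *\<^sub>R u \<in> int_lattice J \<longrightarrow> c \<in> \<int>)"
proof
  assume u: "unimodular J {u}"
  have "c \<in> \<int>" if "c *\<^sub>R u \<in> int_lattice J" for c
    using unimodularD[OF u, of "\<lambda>_. c" u] that by simp
  then show "u \<in> int_lattice J \<and> (\<forall>c. c *\<^sub>R u \<in> int_lattice J \<longrightarrow> c \<in> \<int>)"
    using u by (auto simp: unimodular_def)
qed (simp add: unimodular_def)

lemma unimodular_nonzero: "unimodular J V \<Longrightarrow> 0 \<notin> V"
  using unimodular_independent dependent_zero by blast

lemma line_fan_cases:
  assumes "S \<in> line_fan u"
  obtains "S = {}" | s where "S = {s *\<^sub>R u}" "s = 1 \<or> s = - 1" "u \<noteq> 0"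
  using assms by (auto simp: line_fan_def)

lemma line_fan_subset: "S \<in> line_fan u \<Longrightarrow> T \<subseteq> S \<Longrightarrow> T \<in> line_fan u"
  by (auto simp: line_fan_def subset_singleton_iff)

lemma line_fan_flip:
  assumes "{g} \<in> line_fan u"
  shows "{- g} \<in> line_fan u"
  using assms
proof (cases rule: line_fan_cases)
  case (2 s)
  then have "- g = (- s) *\<^sub>R u" "- s \<in> {1, - 1}" by auto
  then show ?thesis using 2(3) unfolding line_fan_def by blast
qed simp

lemma finite_line_fan: "finite (line_fan u)"
  by (rule finite_subset[of _ "{{}, {u}, {- u}}"]) (auto simp: line_fan_def)

lemma pos_hull_empty: "pos_hull {} = {0}"
  by (auto simp: pos_hull_def)

lemma pos_hull_singleton: "pos_hull {u} = (\<lambda>c. c *\<^sub>R u) ` {0..}"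
  unfolding pos_hull_def by (auto intro: exI[of _ "\<lambda>_. _"])

lemma crossing_zero_iff:
  assumes "crossing J U"
  shows "U k = 0 \<longleftrightarrow> U l = 0"
  using assms unfolding crossing_def
proof
  assume "(\<forall>k. unimodular J {U k}) \<and>
     (U False = U True \<or> (\<forall>a b. a *\<^sub>R U False = b *\<^sub>R U True \<longrightarrow> a = 0 \<and> b = 0))"
  then have "U k \<noteq> 0" "U l \<noteq> 0"
    using unimodular_nonzero[of J "{U k}"] unimodular_nonzero[of J "{U l}"] by auto
  then show ?thesis by simp
qed simp

lemma line_fan_unimodular:
  assumes "crossing J U" "S \<in> line_fan (U k)"
  shows "unimodular J S"
  using assms(2)
proof (cases rule: line_fan_cases)
  case (2 s)
  then have u: "unimodular J {U k}" using assms(1) by (auto simp: crossing_def)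
  have s: "s \<in> \<int>" "s * s = 1" using 2(2) by auto
  have "s *\<^sub>R U k \<in> int_lattice J" using u s(1) by (intro int_lattice_scale) (simp_all add: unimodular_singleton)
  moreover have "c \<in> \<int>" if "c *\<^sub>R s *\<^sub>R U k \<in> int_lattice J" for c
  proof -
    have "c * s \<in> \<int>" using u that by (simp add: unimodular_singleton)
    then have "c * s * s \<in> \<int>" using s(1) by (rule Ints_mult)
    then show ?thesis using s(2) by (simp add: mult.assoc)
  qed
  ultimately show ?thesis
    unfolding 2(1) unimodular_singleton by blast
qed (simp add: unimodular_empty)

lemma line_fan_polyhedron:
  assumes "finite J" "crossing J U" "S \<in> line_fan (U k)"
  shows "rational_polyhedron J (pos_hull S)"
  using assms(3)
proof (cases rule: line_fan_cases)
  case 1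
  then show ?thesis
    using rational_polyhedron_point[OF assms(1), of 0] by (simp add: pos_hull_empty subspace_0[OF subspace_euclid])
next
  case (2 s)
  then have "s *\<^sub>R U k \<in> int_lattice J"
    using line_fan_unimodular[OF assms(2,3)] by (simp add: unimodular_singleton)
  then show ?thesis unfolding 2(1) pos_hull_singleton by (rule rational_polyhedron_ray[OF assms(1)])
qed

lemma line_fan_inter:
  assumes U: "crossing J U" and S: "S \<in> line_fan (U k)" and T: "T \<in> line_fan (U l)"
  shows "pos_hull S \<inter> pos_hull T \<subseteq> pos_hull (S \<inter> T)"
proof -
  consider "S = T" | "S = {} \<or> T = {}" | s t where "S \<noteq> T" "S = {s *\<^sub>R U k}" "s = 1 \<or> s = - 1"
      "T = {t *\<^sub>R U l}" "t = 1 \<or> t = - 1" "U k \<noteq> 0"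
    using S T by (cases rule: line_fan_cases; cases rule: line_fan_cases[OF T]) metis+
  then show ?thesis
  proof cases
    case 3
    have "x = 0" if x: "x \<in> pos_hull S" "x \<in> pos_hull T" for x
    proof -
      have "x \<in> (\<lambda>c. c *\<^sub>R s *\<^sub>R U k) ` {0..}" "x \<in> (\<lambda>c. c *\<^sub>R t *\<^sub>R U l) ` {0..}"
        using x unfolding 3(2,4) pos_hull_singleton by blast+
      then obtain a b where ab: "x = a *\<^sub>R s *\<^sub>R U k" "0 \<le> a" "x = b *\<^sub>R t *\<^sub>R U l" "0 \<le> b"
        unfolding image_iff Bex_def atLeast_iff by blast
      then have eq: "(a * s) *\<^sub>R U k = (b * t) *\<^sub>R U l" by simp
      show ?thesis
      proof (cases "U k = U l")
        case True
        then have "a * s = b * t" using eq 3(6) by simp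
        moreover have "s \<noteq> t" using 3 True by auto
        ultimately have "a = 0" using 3(3,5) ab(2,4) by auto
        then show ?thesis using ab(1) by simp
      next
        case False
        then have "U False \<noteq> U True" by (metis (full_types))
        then have ind: "\<And>a b. a *\<^sub>R U False = b *\<^sub>R U True \<Longrightarrow> a = 0 \<and> b = 0"
          using U 3(6) unfolding crossing_def by blast
        have "k \<noteq> l" using False by (rule contrapos_nn) simp
        have "a * s = 0"
        proof (cases k)
          case True
          then have "l = False" using \<open>k \<noteq> l\<close> by simp
          then show ?thesis using ind[of "b * t" "a * s"] eq True by simp
        next
          case False
          then have "l = True" using \<open>k \<noteq> l\<close> by simp
          then show ?thesis using ind[of "a * s" "b * t"] eq False by simp
        qed
        then have "(a * s) *\<^sub>R U k = 0" by (simp only: scaleR_zero_left)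
        then show ?thesis unfolding ab(1) by (simp only: scaleR_scaleR)
      qed
    qed
    then show ?thesis using zero_in_pos_hull by blast
  qed (auto simp: pos_hull_empty zero_in_pos_hull)
qed

lemma line_fan_cover: "(\<Union>S\<in>line_fan u. pos_hull S) = range (\<lambda>c. c *\<^sub>R u)"
proof (intro equalityI subsetI)
  fix x assume "x \<in> (\<Union>S\<in>line_fan u. pos_hull S)"
  then obtain S where S: "S \<in> line_fan u" "x \<in> pos_hull S" by blast
  from S(1) show "x \<in> range (\<lambda>c. c *\<^sub>R u)"
  proof (cases rule: line_fan_cases)
    case 1
    then have "x = 0 *\<^sub>R u" using S(2) by (simp add: pos_hull_empty)
    then show ?thesis by blast
  next
    case (2 s)
    then obtain c where "x = (c * s) *\<^sub>R u" using S(2) by (auto simp: pos_hull_singleton)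
    then show ?thesis by blast
  qed
next
  fix x assume "x \<in> range (\<lambda>c. c *\<^sub>R u)"
  then obtain c where c: "x = c *\<^sub>R u" by blast
  show "x \<in> (\<Union>S\<in>line_fan u. pos_hull S)"
  proof (cases "u = 0")
    case True
    then show ?thesis using c zero_in_pos_hull by (auto simp: line_fan_def)
  next
    case False
    define s where "s = (if 0 \<le> c then 1 else - 1 :: real)"
    have "{s *\<^sub>R u} \<in> line_fan u" using False by (auto simp: line_fan_def s_def)
    moreover have "x \<in> pos_hull {s *\<^sub>R u}"
      unfolding pos_hull_singleton c by (rule image_eqI[of _ _ "\<bar>c\<bar>"]) (auto simp: s_def)
    ultimately show ?thesis by blast
  qed
qed

lemma pos_hull_union:
  assumes "finite S" "finite T" "S \<inter> T = {}"
  shows "pos_hull (S \<union> T) = sum_set (pos_hull S) (pos_hull T)"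
proof (intro equalityI subsetI)
  fix x assume "x \<in> pos_hull (S \<union> T)"
  then obtain c where c: "x = (\<Sum>v\<in>S \<union> T. c v *\<^sub>R v)" "\<forall>v\<in>S \<union> T. 0 \<le> c v"
    by (auto simp: pos_hull_def)
  have "x = (\<Sum>v\<in>S. c v *\<^sub>R v) + (\<Sum>v\<in>T. c v *\<^sub>R v)"
    unfolding c(1) by (rule sum.union_disjoint[OF assms])
  moreover have "(\<Sum>v\<in>S. c v *\<^sub>R v) \<in> pos_hull S" "(\<Sum>v\<in>T. c v *\<^sub>R v) \<in> pos_hull T"
    using c(2) by (auto intro: pos_hullI[OF refl])
  ultimately show "x \<in> sum_set (pos_hull S) (pos_hull T)" unfolding sum_set_def by blast
next
  fix x assume "x \<in> sum_set (pos_hull S) (pos_hull T)"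
  then obtain y z where "x = y + z" "y \<in> pos_hull S" "z \<in> pos_hull T" by (auto simp: sum_set_def)
  then show "x \<in> pos_hull (S \<union> T)"
    using pos_hull_mono[of S "S \<union> T"] pos_hull_mono[of T "S \<union> T"] assms pos_hull_add by blast
qed

lemma unimodular_disjoint:
  assumes "J \<inter> K = {}" "unimodular J S" "unimodular K T"
  shows "S \<inter> T = {}"
proof -
  have "v = 0" if "v \<in> S" "v \<in> T" for v
    using sum_disjoint_eq(1)[OF assms(1), of v 0 0 v] that unimodular_euclid[OF assms(2)]
      unimodular_euclid[OF assms(3)] subspace_0[OF subspace_euclid] by auto
  then show ?thesis using unimodular_nonzero[OF assms(2)] by blast
qed

text \<open>An integral vector has integral parts in complementary sets of coordinates.\<close>

lemma unimodular_union:
  assumes dis: "J \<inter> K = {}" and S: "unimodular J S" and T: "unimodular K T"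
  shows "unimodular (J \<union> K) (S \<union> T)"
proof -
  have fin: "finite S" "finite T" using S T by (auto simp: unimodular_def)
  have ST: "S \<inter> T = {}" by (rule unimodular_disjoint[OF assms])
  have "c v \<in> \<int>" if c: "(\<Sum>v\<in>S \<union> T. c v *\<^sub>R v) \<in> int_lattice (J \<union> K)" and v: "v \<in> S \<union> T" for c v
  proof -
    define x where "x = (\<Sum>v\<in>S. c v *\<^sub>R v)"
    define y where "y = (\<Sum>v\<in>T. c v *\<^sub>R v)"
    have x: "x \<in> euclid J" unfolding x_def using unimodular_euclid[OF S]
      by (intro subspace_sum[OF subspace_euclid] subspace_scale[OF subspace_euclid]) auto
    have y: "y \<in> euclid K" unfolding y_def using unimodular_euclid[OF T]
      by (intro subspace_sum[OF subspace_euclid] subspace_scale[OF subspace_euclid]) auto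
    have "x + y \<in> int_lattice (J \<union> K)" 
      unfolding x_def y_def sum.union_disjoint[OF fin ST, symmetric] by (rule c)
    then have xy: "lookup x j + lookup y j \<in> \<int>" for j
      by (simp add: int_lattice_iff lookup_add)
    have "lookup x j \<in> \<int> \<and> lookup y j \<in> \<int>" for j
    proof -
      have "j \<notin> J \<or> j \<notin> K" using dis by blast
      then show ?thesis using xy[of j] x y by (auto simp: euclid_iff)
    qed
    then have "x \<in> int_lattice J" "y \<in> int_lattice K" using x y by (auto simp: int_lattice_iff)
    then show ?thesis
      using v unimodularD[OF S, of c v] unimodularD[OF T, of c v] by (auto simp: x_def y_def)
  qed
  moreover have "S \<union> T \<subseteq> int_lattice (J \<union> K)"
  proof -
    have "int_lattice J \<subseteq> int_lattice (J \<union> K)" "int_lattice K \<subseteq> int_lattice (J \<union> K)"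
      by (auto simp: int_lattice_iff euclid_iff)
    then show ?thesis using S T by (auto simp: unimodular_def)
  qed
  ultimately show ?thesis unfolding unimodular_def using fin by blast
qed

text \<open>
  Both planes are products of a line in the coordinates \<open>J\<close> and a line in the coordinates \<open>K\<close>, hence
  so are the cones of the fan. Cones of different planes meet in a common face because this holds in
  each of the two factors.
\<close>

lemma crossing_planes_tropical:
  assumes fin: "finite J" "finite K" and dis: "J \<inter> K = {}" and U: "crossing J U" and W: "crossing K W"
  shows "\<exists>\<Delta>. tropical_variety (J \<union> K) \<Delta> \<and> support \<Delta> = (\<Union>k. span {U k, W k})"
proof -
  define \<V> where "\<V> = (\<Union>k. (\<lambda>(S, T). S \<union> T) ` (line_fan (U k) \<times> line_fan (W k)))"
  have V: "V \<in> \<V> \<longleftrightarrow> (\<exists>k. \<exists>S\<in>line_fan (U k). \<exists>T\<in>line_fan (W k). V = S \<union> T)" for V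
    by (auto simp: \<V>_def)
  have uS: "unimodular J S" if "S \<in> line_fan (U k)" for S k by (rule line_fan_unimodular[OF U that])
  have uT: "unimodular K T" if "T \<in> line_fan (W k)" for T k by (rule line_fan_unimodular[OF W that])
  have fS: "finite S" if "S \<in> line_fan (U k)" for S k using uS[OF that] by (simp add: unimodular_def)
  have fT: "finite T" if "T \<in> line_fan (W k)" for T k using uT[OF that] by (simp add: unimodular_def)
  have ST: "S \<inter> T = {}" if "S \<in> line_fan (U k)" "T \<in> line_fan (W l)" for S T k l
    by (rule unimodular_disjoint[OF dis uS[OF that(1)] uT[OF that(2)]])
  have hull: "pos_hull (S \<union> T) = sum_set (pos_hull S) (pos_hull T)"
    if "S \<in> line_fan (U k)" "T \<in> line_fan (W l)" for S T k l
    by (rule pos_hull_union[OF fS[OF that(1)] fT[OF that(2)] ST[OF that]])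
  have hS: "pos_hull S \<subseteq> euclid J" if "S \<in> line_fan (U k)" for S k
    using pos_hull_subset_span span_minimal[OF unimodular_euclid[OF uS[OF that]] subspace_euclid] by blast
  have hT: "pos_hull T \<subseteq> euclid K" if "T \<in> line_fan (W k)" for T k
    using pos_hull_subset_span span_minimal[OF unimodular_euclid[OF uT[OF that]] subspace_euclid] by blast
  define mx where "mx u = (if u = 0 then {} else {u})" for u :: "'a rvec"
  have mx: "mx u \<in> line_fan u" "card (mx u) = of_bool (u \<noteq> 0)" for u
    by (auto simp: mx_def line_fan_def intro: exI[of _ 1])
  have ext: "\<exists>S'\<in>line_fan u. S \<subseteq> S' \<and> card S' = of_bool (u \<noteq> 0)" if "S \<in> line_fan u" for S and u :: "'a rvec"
    using that
  proof (cases rule: line_fan_cases)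
    case 1
    then show ?thesis using mx[of u] by blast
  next
    case (2 s)
    then show ?thesis using that by (intro bexI[of _ S]) auto
  qed
  have "tropical_variety (J \<union> K) (unweighted (pos_hull ` \<V>))"
  proof (rule symmetric_fan_tropical[where d = "of_bool (U True \<noteq> 0) + of_bool (W True \<noteq> 0)"])
    show "finite \<V>" unfolding \<V>_def by (auto intro: finite_line_fan)
    show "\<V> \<noteq> {}" using V[of "{} \<union> {}"] by (auto simp: line_fan_def)
  next
    fix V assume "V \<in> \<V>"
    then obtain k S T where k: "S \<in> line_fan (U k)" "T \<in> line_fan (W k)" "V = S \<union> T" using V by blast
    show "unimodular (J \<union> K) V"
      unfolding k(3) by (rule unimodular_union[OF dis uS[OF k(1)] uT[OF k(2)]])
    show "rational_polyhedron (J \<union> K) (pos_hull V)"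
      unfolding k(3) hull[OF k(1,2)]
      by (rule rational_polyhedron_sum[OF fin dis line_fan_polyhedron[OF fin(1) U k(1)]
            line_fan_polyhedron[OF fin(2) W k(2)]])
    show "\<exists>V'\<in>\<V>. V \<subseteq> V' \<and> card V' = of_bool (U True \<noteq> 0) + of_bool (W True \<noteq> 0)"
    proof -
      obtain S' where S': "S' \<in> line_fan (U k)" "S \<subseteq> S'" "card S' = of_bool (U k \<noteq> 0)" using ext[OF k(1)] by blast
      obtain T' where T': "T' \<in> line_fan (W k)" "T \<subseteq> T'" "card T' = of_bool (W k \<noteq> 0)" using ext[OF k(2)] by blast
      have "card (S' \<union> T') = card S' + card T'"
        by (rule card_Un_disjoint[OF fS[OF S'(1)] fT[OF T'(1)] ST[OF S'(1) T'(1)]])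
      then have "card (S' \<union> T') = of_bool (U True \<noteq> 0) + of_bool (W True \<noteq> 0)"
        using S'(3) T'(3) crossing_zero_iff[OF U, of k True] crossing_zero_iff[OF W, of k True] by simp
      moreover have "S' \<union> T' \<in> \<V>" using V S'(1) T'(1) by blast
      moreover have "V \<subseteq> S' \<union> T'" using k(3) S'(2) T'(2) by blast
      ultimately show ?thesis by blast
    qed
    show "X \<in> \<V>" if X: "X \<subseteq> V" for X
    proof -
      have "X = (X \<inter> S) \<union> (X \<inter> T)" using X k(3) by blast
      moreover have "X \<inter> S \<in> line_fan (U k)" "X \<inter> T \<in> line_fan (W k)"
        using line_fan_subset k by blast+
      ultimately show ?thesis using V by blast
    qed
    show "pos_hull V \<inter> pos_hull V' \<subseteq> pos_hull (V \<inter> V')" if V': "V' \<in> \<V>" for V'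
    proof -
      obtain l S' T' where l: "S' \<in> line_fan (U l)" "T' \<in> line_fan (W l)" "V' = S' \<union> T'" using V V' by blast
      show ?thesis
      proof
        fix x assume x: "x \<in> pos_hull V \<inter> pos_hull V'"
        obtain a b where ab: "x = a + b" "a \<in> pos_hull S" "b \<in> pos_hull T"
          using x unfolding k(3) hull[OF k(1,2)] sum_set_def by blast
        obtain a' b' where ab': "x = a' + b'" "a' \<in> pos_hull S'" "b' \<in> pos_hull T'"
          using x unfolding l(3) hull[OF l(1,2)] sum_set_def by blast
        have e: "a \<in> euclid J" "a' \<in> euclid J" "b \<in> euclid K" "b' \<in> euclid K"
          using hS[OF k(1)] hS[OF l(1)] hT[OF k(2)] hT[OF l(2)] ab ab' by auto
        have "a + b = a' + b'" using ab(1) ab'(1) by simp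
        note eq = sum_disjoint_eq[OF dis e this]
        have "a \<in> pos_hull (S \<inter> S')" using line_fan_inter[OF U k(1) l(1)] ab(2) ab'(2) eq(1) by blast
        moreover have "b \<in> pos_hull (T \<inter> T')" using line_fan_inter[OF W k(2) l(2)] ab(3) ab'(3) eq(2) by blast
        moreover have "finite (V \<inter> V')" using fS[OF k(1)] fT[OF k(2)] k(3) by simp
        moreover have "S \<inter> S' \<subseteq> V \<inter> V'" "T \<inter> T' \<subseteq> V \<inter> V'" using k(3) l(3) by auto
        ultimately have "a \<in> pos_hull (V \<inter> V')" "b \<in> pos_hull (V \<inter> V')"
          using pos_hull_mono by blast+
        then show "x \<in> pos_hull (V \<inter> V')" unfolding ab(1) by (rule pos_hull_add)
      qed
    qed
  next
    fix g X assume "insert g X \<in> \<V>" and g: "g \<notin> X"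
    then obtain k S T where k: "S \<in> line_fan (U k)" "T \<in> line_fan (W k)" "insert g X = S \<union> T" using V by blast
    have dST: "S \<inter> T = {}" by (rule ST[OF k(1,2)])
    show "insert (- g) X \<in> \<V>"
    proof (cases "g \<in> S")
      case True
      then have S: "S = {g}" using k(1) by (auto simp: line_fan_def)
      then have "X = T" using k(3) g dST by auto
      then have "insert (- g) X = {- g} \<union> T" by simp
      moreover have "{- g} \<in> line_fan (U k)" using line_fan_flip k(1) S by blast
      ultimately show ?thesis using V k(2) by blast
    next
      case False
      then have "g \<in> T" using k(3) by blast
      then have T: "T = {g}" using k(2) by (auto simp: line_fan_def)
      then have "X = S" using k(3) g dST by auto
      then have "insert (- g) X = S \<union> {- g}" by simp
      moreover have "{- g} \<in> line_fan (W k)" using line_fan_flip k(2) T by blast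
      ultimately show ?thesis using V k(1) by blast
    qed
  qed
  moreover have "support (unweighted (pos_hull ` \<V>)) = (\<Union>k. span {U k, W k})"
  proof -
    have *: "x \<in> support (unweighted (pos_hull ` \<V>)) \<longleftrightarrow>
        (\<exists>k. \<exists>a\<in>(\<Union>S\<in>line_fan (U k). pos_hull S). \<exists>b\<in>(\<Union>T\<in>line_fan (W k). pos_hull T). x = a + b)" for x
    proof
      assume "x \<in> support (unweighted (pos_hull ` \<V>))"
      then obtain X where X: "X \<in> \<V>" "x \<in> pos_hull X" by (auto simp: support_def)
      then obtain k S T where k: "S \<in> line_fan (U k)" "T \<in> line_fan (W k)" "X = S \<union> T" using V by blast
      show "\<exists>k. \<exists>a\<in>(\<Union>S\<in>line_fan (U k). pos_hull S). \<exists>b\<in>(\<Union>T\<in>line_fan (W k). pos_hull T). x = a + b"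
        using X(2) k(1,2) unfolding k(3) hull[OF k(1,2)] sum_set_def by blast
    next
      assume "\<exists>k. \<exists>a\<in>(\<Union>S\<in>line_fan (U k). pos_hull S). \<exists>b\<in>(\<Union>T\<in>line_fan (W k). pos_hull T). x = a + b"
      then obtain k S T a b where k: "S \<in> line_fan (U k)" "T \<in> line_fan (W k)"
          and ab: "a \<in> pos_hull S" "b \<in> pos_hull T" "x = a + b" by blast
      have "x \<in> pos_hull (S \<union> T)" unfolding hull[OF k] sum_set_def using ab by blast
      moreover have "S \<union> T \<in> \<V>" using V k by blast
      ultimately show "x \<in> support (unweighted (pos_hull ` \<V>))" by (auto simp: support_def)
    qed
    show ?thesis
      unfolding set_eq_iff * line_fan_cover UN_iff span2_iff by blast
  qed
  ultimately show ?thesis by blast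
qed

section \<open>The example\<close>

(* keeps coordinates in the form (i, 1) *)
declare One_nat_def [simp del]

definition one_dim :: "nat \<Rightarrow> nat" where
  "one_dim i = 1"

text \<open>
  The plane of index \<open>k\<close> is spanned by the two vectors \<open>gen 1 4 k\<close> and \<open>gen 2 3 k\<close>, that is by
  \<open>2 e\<^sub>1 + e\<^sub>4\<close>, \<open>2 e\<^sub>2 + e\<^sub>3\<close> for \<open>k = False\<close> and by \<open>e\<^sub>1 + 2 e\<^sub>4\<close>, \<open>e\<^sub>2 + 2 e\<^sub>3\<close> for \<open>k = True\<close>. The mixed
  degrees of a plane are the absolute values of its \<open>2 \<times> 2\<close> minors: \<open>4, 1\<close> in the columns \<open>12, 34\<close> of
  the first plane and \<open>1, 4\<close> for the second one, \<open>2\<close> in the columns \<open>13, 24\<close> of both, and \<open>0\<close> otherwise.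
\<close>

definition gen :: "nat \<Rightarrow> nat \<Rightarrow> bool \<Rightarrow> (nat \<times> nat) rvec" where
  "gen a b k = single (a, 1) (if k then 1 else 2) + single (b, 1) (if k then 2 else 1)"

definition base :: "bool \<Rightarrow> (nat \<times> nat) rvec" where
  "base k = single (5, 1) (of_bool k)"

definition two_planes :: "(nat \<times> nat) tropical" where
  "two_planes = unweighted (range (\<lambda>k. flat (base k) (gen 1 4 k) (gen 2 3 k)))"

lemma mem_blocks: "(i, j) \<in> blocks one_dim I \<longleftrightarrow> i \<in> I \<and> j = 1"
  by (auto simp: blocks_def one_dim_def)

lemma finite_blocks: "finite I \<Longrightarrow> finite (blocks one_dim I)"
  by (simp add: blocks_def one_dim_def)

lemma proj_coord_part: "proj m I = coord_part (blocks m I)"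
  by (simp add: fun_eq_iff proj_def coord_part_def)

lemma lookup_gen:
  "a \<noteq> b \<Longrightarrow> lookup (gen a b k) (i, j) =
     (if j = 1 then if i = a then (if k then 1 else 2) else if i = b then (if k then 2 else 1) else 0 else 0)"
  by (auto simp: gen_def lookup_add lookup_single when_def)

lemma lookup_proj:
  "finite I \<Longrightarrow> lookup (proj one_dim I x) (i, j)
     = (if i \<in> I \<and> j = 1 then lookup x (i, j) else 0)"
  by (simp add: proj_coord_part lookup_coord_part finite_blocks mem_blocks)

lemma linear_proj: "finite I \<Longrightarrow> linear (proj one_dim I)"
  by (simp add: proj_coord_part linear_coord_part finite_blocks)

definition coords :: "nat set \<Rightarrow> nat set \<Rightarrow> (nat \<times> nat) set" where
  "coords I A = blocks one_dim (I \<inter> A)"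

lemma mem_coords: "(i, j) \<in> coords I A \<longleftrightarrow> i \<in> I \<and> i \<in> A \<and> j = 1"
  by (auto simp: coords_def mem_blocks)

lemma finite_coords: "finite A \<Longrightarrow> finite (coords I A)"
  by (simp add: coords_def finite_blocks)

lemma proj_gen_lattice:
  assumes "finite I" "a \<noteq> b"
  shows "proj one_dim I (gen a b k) \<in> int_lattice (coords I {a, b})"
  using assms by (auto simp: int_lattice_iff euclid_iff lookup_proj lookup_gen mem_coords)

lemma proj_gen_zero_iff:
  assumes "finite I" "a \<noteq> b"
  shows "proj one_dim I (gen a b k) = 0 \<longleftrightarrow> a \<notin> I \<and> b \<notin> I"
proof
  assume z: "proj one_dim I (gen a b k) = 0"
  have "lookup (proj one_dim I (gen a b k)) (i, 1) = 0" for i by (simp add: z)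
  from this[of a] this[of b] show "a \<notin> I \<and> b \<notin> I"
    using assms by (auto simp: lookup_proj lookup_gen split: if_splits)
next
  assume "a \<notin> I \<and> b \<notin> I"
  then show "proj one_dim I (gen a b k) = 0"
    using assms by (intro poly_mapping_eqI) (auto simp: lookup_proj lookup_gen)
qed

lemma proj_base_euclid:
  assumes "finite I"
  shows "proj one_dim I (base k) \<in> euclid (coords I {5})"
  using assms by (auto simp: euclid_iff lookup_proj base_def lookup_single when_def mem_coords)

lemma blocks_split:
  assumes "I \<subseteq> {1..5}"
  shows "blocks one_dim I = coords I {5} \<union> (coords I {1, 4} \<union> coords I {2, 3})"
proof -
  have "i = 5 \<or> i = 1 \<or> i = 4 \<or> i = 2 \<or> i = 3" if "i \<in> I" for i
  proof -
    have "1 \<le> i" "i \<le> 5" using that assms by auto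
    then show ?thesis by linarith
  qed
  note cases = this
  have "x \<in> blocks one_dim I \<longleftrightarrow> x \<in> coords I {5} \<union> (coords I {1, 4} \<union> coords I {2, 3})" for x
    using cases[of "fst x"] by (cases x) (auto simp: mem_blocks mem_coords)
  then show ?thesis by blast
qed

lemma coords_disjoint:
  "coords I {1, 4} \<inter> coords I {2, 3} = {}"
  "coords I {5} \<inter> (coords I {1, 4} \<union> coords I {2, 3}) = {}"
  by (auto simp: mem_coords)

text \<open>
  The image under the projection to \<open>I\<close> of the section of a plane with coordinate hyperplanes through the
  origin. The flags tell which of the two generators remain: the hyperplanes 1 and 4 cut the first one,
  2 and 3 the second one.
\<close>

definition plane_section :: "nat set \<Rightarrow> bool \<Rightarrow> bool \<Rightarrow> bool \<Rightarrow> (nat \<times> nat) rvec set" where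
  "plane_section I s t k = flat (proj one_dim I (base k))
     (if s then proj one_dim I (gen 1 4 k) else 0) (if t then proj one_dim I (gen 2 3 k) else 0)"

abbreviation proj_plane :: "nat set \<Rightarrow> bool \<Rightarrow> (nat \<times> nat) rvec set" where
  "proj_plane I \<equiv> plane_section I True True"

definition section_rank :: "nat set \<Rightarrow> bool \<Rightarrow> bool \<Rightarrow> nat" where
  "section_rank I s t = of_bool (s \<and> (1 \<in> I \<or> 4 \<in> I)) + of_bool (t \<and> (2 \<in> I \<or> 3 \<in> I))"

lemma proj_plane_image:
  "finite I \<Longrightarrow> proj one_dim I ` flat (base k) (gen 1 4 k) (gen 2 3 k) = proj_plane I k"
  by (simp add: plane_section_def linear_image_flat linear_proj)

lemma plane_section_props:
  assumes "I \<subseteq> {1..5}"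
  shows "plane_section I s t k \<noteq> {}" "affine (plane_section I s t k)"
    and "rational_polyhedron (blocks one_dim I) (plane_section I s t k)"
    and "cell_dim (plane_section I s t k) = section_rank I s t"
proof -
  have I: "finite I" using assms finite_subset by blast
  let ?u = "if s then proj one_dim I (gen 1 4 k) else 0" and ?w = "if t then proj one_dim I (gen 2 3 k) else 0"
  have g: "?u \<in> int_lattice (coords I {1, 4})" "?w \<in> int_lattice (coords I {2, 3})"
    by (simp_all add: proj_gen_lattice[OF I] int_lattice_0)
  show "plane_section I s t k \<noteq> {}" unfolding plane_section_def using base_in_flat by blast
  show "affine (plane_section I s t k)" unfolding plane_section_def by (rule affine_flat)
  show "rational_polyhedron (blocks one_dim I) (plane_section I s t k)"
    unfolding blocks_split[OF assms] plane_section_def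
    by (rule rational_polyhedron_flat[OF _ _ _ coords_disjoint g proj_base_euclid[OF I]])
       (simp_all add: finite_coords)
  have "dim (span {?u, ?w}) = section_rank I s t"
    using dim_span_disjoint_pair[OF coords_disjoint(1)[of I], of ?u ?w] g
      proj_gen_zero_iff[OF I, of 1 4 k] proj_gen_zero_iff[OF I, of 2 3 k]
    by (simp add: int_lattice_iff section_rank_def)
  then show "cell_dim (plane_section I s t k) = section_rank I s t"
    by (simp add: cell_dim_def plane_section_def)
qed

text \<open>The last coordinate separates the two planes.\<close>

lemma plane_sections_disjoint:
  assumes "finite I" "5 \<in> I" "k \<noteq> l"
  shows "plane_section I s t k \<inter> plane_section I s t l = {}"
proof -
  have last: "lookup z (5, 1) = of_bool k" if "z \<in> plane_section I s t k" for z k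
    using that assms(1,2)
    by (auto simp: plane_section_def flat_iff lookup_add lookup_proj lookup_gen base_def lookup_single)
  have False if z: "z \<in> plane_section I s t k" "z \<in> plane_section I s t l" for z
    using last[OF z(1)] last[OF z(2)] assms(3) by (auto simp: of_bool_def split: if_splits)
  then show ?thesis by blast
qed

lemma disjoint_plane_sections:
  assumes "finite I" "5 \<in> I"
  shows "disjoint (range (plane_section I s t))"
  unfolding disjoint_def
proof (intro ballI impI)
  fix A B assume "A \<in> range (plane_section I s t)" "B \<in> range (plane_section I s t)" "A \<noteq> B"
  then obtain k l where kl: "A = plane_section I s t k" "B = plane_section I s t l" by (elim imageE)
  have "k \<noteq> l" using \<open>A \<noteq> B\<close> unfolding kl by (rule contrapos_nn) simp
  then show "A \<inter> B = {}" unfolding kl by (rule plane_sections_disjoint[OF assms])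
qed

lemma proj_tropical_with_5:
  assumes I: "I \<subseteq> {1..5}" "5 \<in> I"
  shows "tropical_variety (blocks one_dim I) (unweighted (range (proj_plane I)))"
    and "tdim (unweighted (range (proj_plane I))) = section_rank I True True"
proof -
  have dis: "disjoint (range (proj_plane I))"
    by (rule disjoint_plane_sections[OF finite_subset[OF I(1)] I(2)]) simp
  have cell: "\<sigma> \<noteq> {} \<and> affine \<sigma> \<and> rational_polyhedron (blocks one_dim I) \<sigma> \<and> cell_dim \<sigma> = section_rank I True True"
    if "\<sigma> \<in> range (proj_plane I)" for \<sigma>
    using that by (elim imageE) (simp add: plane_section_props[OF I(1)])
  show "tropical_variety (blocks one_dim I) (unweighted (range (proj_plane I)))"
    by (rule disjoint_affine_tropical(1)[OF _ _ cell dis]) auto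
  show "tdim (unweighted (range (proj_plane I))) = section_rank I True True"
    by (rule disjoint_affine_tropical(2)[OF _ _ cell dis]) auto
qed

text \<open>
  If the projection keeps both coordinates, the lines remain different and the projected generators
  remain primitive, because one of their entries is \<open>1\<close>. If it keeps one coordinate, both lines become
  the same coordinate axis, and the unit vector has to replace the generators.
\<close>

lemma crossing_proj_gen:
  assumes "finite I" "a \<noteq> b"
  shows "\<exists>U. crossing (coords I {a, b}) U \<and> (\<forall>k. span {U k} = span {proj one_dim I (gen a b k)})"
proof (cases "a \<in> I \<and> b \<in> I")
  case True
  let ?U = "\<lambda>k. proj one_dim I (gen a b k)"
  have "unimodular (coords I {a, b}) {?U k}" for k
    unfolding unimodular_singleton
  proof (intro conjI allI impI proj_gen_lattice[OF assms])
    fix c assume "c *\<^sub>R ?U k \<in> int_lattice (coords I {a, b})"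
    then have "lookup (c *\<^sub>R ?U k) (i, 1) \<in> \<int>" for i by (simp only: int_lattice_iff)
    from this[of "if k then a else b"] show "c \<in> \<int>"
      using True assms by (simp add: lookup_proj lookup_gen split: if_splits)
  qed
  moreover have "x = 0 \<and> y = 0" if xy: "x *\<^sub>R ?U False = y *\<^sub>R ?U True" for x y
  proof -
    have "lookup (x *\<^sub>R ?U False) (i, 1) = lookup (y *\<^sub>R ?U True) (i, 1)" for i
      using xy by (rule arg_cong)
    from this[of a] this[of b] have "x * 2 = y" "x = y * 2"
      using True assms by (simp_all add: lookup_proj lookup_gen)
    then show ?thesis by simp
  qed
  ultimately have "crossing (coords I {a, b}) ?U" unfolding crossing_def by blast
  then show ?thesis by blast
next
  case False
  show ?thesis
  proof (cases "a \<in> I \<or> b \<in> I")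
    case False
    have "span {0 :: (nat \<times> nat) rvec} = span {proj one_dim I (gen a b k)}" for k
      using proj_gen_zero_iff[OF assms, of k] False by simp
    then show ?thesis by (intro exI[of _ "\<lambda>_. 0"]) (auto simp: crossing_def)
  next
    case True
    define i where "i = (if a \<in> I then a else b)"
    have i: "i \<in> I" "i = a \<or> i = b" "\<And>j. j \<in> I \<Longrightarrow> j = a \<or> j = b \<Longrightarrow> j = i"
      using True \<open>\<not> (a \<in> I \<and> b \<in> I)\<close> by (auto simp: i_def)
    let ?e = "single (i, 1::nat) (1::real)"
    have "unimodular (coords I {a, b}) {?e}"
      unfolding unimodular_singleton
    proof (intro conjI allI impI)
      show "?e \<in> int_lattice (coords I {a, b})"
        using i(1,2) by (intro int_lattice_single) (auto simp: mem_coords)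
      fix c assume "c *\<^sub>R ?e \<in> int_lattice (coords I {a, b})"
      then have "lookup (c *\<^sub>R ?e) (i, 1) \<in> \<int>" by (simp only: int_lattice_iff)
      then show "c \<in> \<int>" by simp
    qed
    then have "crossing (coords I {a, b}) (\<lambda>_. ?e)" by (simp add: crossing_def)
    moreover have "span {?e} = span {proj one_dim I (gen a b k)}" for k
    proof -
      define c where "c = lookup (gen a b k) (i, 1)"
      have c: "c \<noteq> 0" using i(2) assms(2) by (auto simp: c_def lookup_gen)
      have e: "proj one_dim I (gen a b k) = c *\<^sub>R ?e"
      proof (rule poly_mapping_eqI)
        fix p :: "nat \<times> nat"
        obtain j l where p: "p = (j, l)" by fastforce
        show "lookup (proj one_dim I (gen a b k)) p = lookup (c *\<^sub>R ?e) p"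
        proof (cases "j = i")
          case True
          then show ?thesis
            using i(1) assms by (simp add: p lookup_proj lookup_gen c_def lookup_single when_def)
        next
          case False
          then have "j \<in> I \<Longrightarrow> j \<noteq> a \<and> j \<noteq> b" using i(3)[of j] by blast
          then show ?thesis using assms False by (simp add: p lookup_proj lookup_gen lookup_single when_def)
        qed
      qed
      have "?e = (1 / c) *\<^sub>R (c *\<^sub>R ?e)" using c by simp
      then have "?e \<in> span {c *\<^sub>R ?e}" by (metis span_base span_scale singletonI)
      moreover have "c *\<^sub>R ?e \<in> span {?e}" by (intro span_scale span_base) simp
      ultimately show ?thesis unfolding e by (simp add: span_eq)
    qed
    ultimately show ?thesis by blast
  qed
qed

lemma span_pair_cong: "span {u} = span {u'} \<Longrightarrow> span {w} = span {w'} \<Longrightarrow> span {u, w} = span {u', w'}"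
  using span_Un[of "{u}" "{w}"] span_Un[of "{u'}" "{w'}"] by (simp add: insert_commute)

lemma support_two_planes: "proj one_dim I ` support two_planes = (\<Union>k. proj_plane I k)" if "finite I"
proof -
  have "proj one_dim I ` support two_planes = (\<Union>k. proj one_dim I ` flat (base k) (gen 1 4 k) (gen 2 3 k))"
    by (simp add: support_def two_planes_def image_UN)
  then show ?thesis by (simp only: proj_plane_image[OF that])
qed

text \<open>
  Projections that keep the fifth coordinate give two disjoint affine spaces; the other ones give two
  linear spaces of the same dimension, which are products of lines.
\<close>

lemma two_planes_projection_pure: "projection_pure 5 one_dim two_planes"
  unfolding projection_pure_def
proof (intro allI impI)
  fix I :: "nat set" assume I: "I \<subseteq> {1..5}"
  have fI: "finite I" using I finite_subset by blast
  show "\<exists>\<Delta>. tropical_variety (blocks one_dim I) \<Delta> \<and> support \<Delta> = proj one_dim I ` support two_planes"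
  proof (cases "5 \<in> I")
    case True
    then show ?thesis
      unfolding support_two_planes[OF fI]
      by (intro exI[of _ "unweighted (range (proj_plane I))"] conjI
          proj_tropical_with_5(1)[OF I]) (simp_all add: support_def)
  next
    case False
    obtain U where U: "crossing (coords I {1, 4}) U" "\<forall>k. span {U k} = span {proj one_dim I (gen 1 4 k)}"
      using crossing_proj_gen[OF fI, of 1 4] by auto
    obtain W where W: "crossing (coords I {2, 3}) W" "\<forall>k. span {W k} = span {proj one_dim I (gen 2 3 k)}"
      using crossing_proj_gen[OF fI, of 2 3] by auto
    have "coords I {5} = {}" using False by (auto simp: mem_coords)
    then have B: "coords I {1, 4} \<union> coords I {2, 3} = blocks one_dim I" using blocks_split[OF I] by simp
    have "proj one_dim I (base k) = 0" for k
    proof (rule poly_mapping_eqI)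
      fix p
      have "p \<notin> coords I {5}" using \<open>coords I {5} = {}\<close> by simp
      then show "lookup (proj one_dim I (base k)) p = lookup 0 p"
        using proj_base_euclid[OF fI, of k] by (cases p) (simp add: euclid_iff)
    qed
    then have "proj_plane I k = span {U k, W k}" for k
      using span_pair_cong[of "U k" "proj one_dim I (gen 1 4 k)" "W k" "proj one_dim I (gen 2 3 k)"] U(2) W(2)
      by (simp add: plane_section_def flat_def)
    then show ?thesis
      using crossing_planes_tropical[OF finite_coords finite_coords coords_disjoint(1) U(1) W(1)]
      unfolding B support_two_planes[OF fI] by simp
  qed
qed

lemma proj_full:
  assumes "x \<in> euclid (blocks one_dim {1..5})"
  shows "proj one_dim {1..5} x = x"
  using assms by (simp add: proj_coord_part coord_part_id finite_blocks)

lemma gen_full: "a \<in> {1..5} \<Longrightarrow> b \<in> {1..5} \<Longrightarrow> gen a b k \<in> int_lattice (blocks one_dim {1..5})"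
  unfolding gen_def by (intro int_lattice_add int_lattice_single) (auto simp: mem_blocks)

lemma base_full: "base k \<in> euclid (blocks one_dim {1..5})"
  unfolding base_def by (intro single_in_euclid) (auto simp: mem_blocks)

lemma plane_section_full:
  "plane_section {1..5} s t k = flat (base k) (if s then gen 1 4 k else 0) (if t then gen 2 3 k else 0)"
  unfolding plane_section_def using gen_full[of 1 4 k] gen_full[of 2 3 k]
  by (simp add: proj_full base_full int_lattice_iff)

lemma two_planes_eq: "two_planes = unweighted (range (proj_plane {1..5}))"
  by (simp add: two_planes_def plane_section_full)

lemma two_planes_tropical: "tropical_variety (blocks one_dim {1..5}) two_planes"
  unfolding two_planes_eq by (rule proj_tropical_with_5) auto

lemma two_planes_tdim: "tdim two_planes = 2"
proof -
  have "tdim two_planes = section_rank {1..5} True True" unfolding two_planes_eq by (rule proj_tropical_with_5) auto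
  then show ?thesis by (simp add: section_rank_def)
qed

text \<open>Both planes have projections of the same dimension, so either of them can be selected.\<close>

lemma two_planes_facet_selectable: "facet_selectable 5 one_dim two_planes"
  unfolding facet_selectable_def
proof (intro ballI impI)
  fix n assume le: "\<forall>I\<subseteq>{1..5}. (\<Sum>i\<in>I. lookup n i) \<le> proj_dim one_dim I two_planes"
  let ?\<sigma> = "flat (base True) (gen 1 4 True) (gen 2 3 True)"
  have dim: "cell_dim (proj one_dim I ` flat (base k) (gen 1 4 k) (gen 2 3 k)) = section_rank I True True"
    if "I \<subseteq> {1..5}" for I k
    using plane_section_props(4)[OF that, of True True k] proj_plane_image[of I k] finite_subset[OF that] by simp
  have "?\<sigma> \<in> facets two_planes"
  proof -
    have "cell_dim ?\<sigma> = 2"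
      using plane_section_props(4)[of "{1..5}" True True True] by (simp add: plane_section_full section_rank_def)
    moreover have "?\<sigma> \<in> cells two_planes" by (auto simp: two_planes_def)
    ultimately show ?thesis by (simp add: facets_def two_planes_tdim)
  qed
  moreover have "(\<Sum>i\<in>I. lookup n i) \<le> cell_dim (proj one_dim I ` ?\<sigma>)" if I: "I \<subseteq> {1..5}" for I
  proof -
    have "(\<lambda>\<sigma>. cell_dim (proj one_dim I ` \<sigma>)) ` cells two_planes = {section_rank I True True}"
      using dim[OF I] by (auto simp: two_planes_def image_iff)
    then have "proj_dim one_dim I two_planes = section_rank I True True" by (simp add: proj_dim_def)
    then show ?thesis using le I dim[OF I] by auto
  qed
  ultimately show "\<exists>\<sigma>\<in>facets two_planes. \<forall>I\<subseteq>{1..5}.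
      (\<Sum>i\<in>I. lookup n i) \<le> cell_dim (proj one_dim I ` \<sigma>)" by blast
qed

text \<open>
  Adding a line that is parallel to one plane and not to the other one gives a plane and a
  three-dimensional space, which are disjoint. A facet through the origin lies in the plane, so a
  pure complex with this support would have dimension at most two, and finitely many cells of
  dimension at most two do not cover a three-dimensional space.
\<close>

lemma two_planes_not_admissible: "\<not> translation_admissible (blocks one_dim {1..5}) two_planes"
proof
  let ?J = "blocks one_dim {1..5}"
  let ?u = "gen 1 4 False" and ?u' = "gen 1 4 True" and ?w = "gen 2 3 False" and ?w' = "gen 2 3 True"
  let ?V = "span {?u}"
  assume adm: "translation_admissible ?J two_planes"
  have u: "?u \<in> int_lattice ?J" by (rule gen_full) auto
  have VJ: "?V \<subseteq> euclid ?J"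
    using u by (intro span_minimal subspace_euclid) (simp add: int_lattice_iff)
  have "?V = span (?V \<inter> int_lattice ?J)"
  proof
    show "?V \<subseteq> span (?V \<inter> int_lattice ?J)" using u by (intro span_mono) (simp add: span_base)
    show "span (?V \<inter> int_lattice ?J) \<subseteq> ?V" by (intro span_minimal) auto
  qed
  then have "rational_subspace ?J ?V" using VJ by (simp add: rational_subspace_def)
  then obtain \<Delta> where \<Delta>: "tropical_variety ?J \<Delta>" "support \<Delta> = sum_set (support two_planes) ?V"
    using adm unfolding translation_admissible_def by blast
  have J: "finite ?J" by (simp add: finite_blocks)
  have pc: "polyhedral_complex ?J (cells \<Delta>)" using \<Delta>(1) by (simp add: tropical_variety_def)
  have fin: "finite (cells \<Delta>)" using pc by (simp add: polyhedral_complex_def)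
  have supp: "z \<in> support \<Delta> \<longleftrightarrow> (\<exists>k x y c. z = base k + (x *\<^sub>R gen 1 4 k + y *\<^sub>R gen 2 3 k) + c *\<^sub>R ?u)" for z
  proof -
    have "p \<in> support two_planes \<longleftrightarrow> (\<exists>k. p \<in> flat (base k) (gen 1 4 k) (gen 2 3 k))" for p
      by (auto simp: support_def two_planes_def)
    then have "z \<in> support \<Delta> \<longleftrightarrow> (\<exists>k. \<exists>p\<in>flat (base k) (gen 1 4 k) (gen 2 3 k). \<exists>q\<in>?V. z = p + q)"
      unfolding \<Delta>(2) sum_set_def by blast
    then show ?thesis unfolding Bex_def flat_iff span_singleton by blast
  qed
  have last: "lookup (base k + (x *\<^sub>R gen 1 4 k + y *\<^sub>R gen 2 3 k) + c *\<^sub>R ?u) (5, 1) = of_bool k"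
    for k x y c by (simp add: lookup_add lookup_gen base_def)
  have zero: "0 \<in> support \<Delta>"
    unfolding supp by (intro exI[of _ False] exI[of _ 0]) (simp add: base_def)
  then obtain \<sigma> where "\<sigma> \<in> cells \<Delta>" "0 \<in> \<sigma>" by (auto simp: support_def)
  then obtain \<rho> where \<rho>: "\<rho> \<in> facets \<Delta>" "0 \<in> \<rho>" using \<Delta>(1) unfolding tropical_variety_def by blast
  have \<rho>c: "\<rho> \<in> cells \<Delta>" using \<rho>(1) by (simp add: facets_def)
  have "\<rho> \<subseteq> span {?u, ?w}"
  proof
    fix z assume z: "z \<in> \<rho>"
    then have "z \<in> support \<Delta>" using \<rho>c by (auto simp: support_def)
    then obtain k x y c where zk: "z = base k + (x *\<^sub>R gen 1 4 k + y *\<^sub>R gen 2 3 k) + c *\<^sub>R ?u"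
      unfolding supp by blast
    (* otherwise the midpoint of 0 and z would have fifth coordinate 1/2 *)
    have "k = False"
    proof (rule ccontr)
      assume "k \<noteq> False"
      then have z5: "lookup z (5, 1) = 1" unfolding zk last by simp
      have "(1 / 2) *\<^sub>R 0 + (1 / 2) *\<^sub>R z \<in> \<rho>"
        using convex_rational_polyhedron[OF complex_cellD(2)[OF pc \<rho>c]] \<rho>(2) z by (intro convexD) auto
      then have "(1 / 2) *\<^sub>R z \<in> support \<Delta>" using \<rho>c by (auto simp: support_def)
      then obtain k' x' y' c' where "(1 / 2) *\<^sub>R z = base k' + (x' *\<^sub>R gen 1 4 k' + y' *\<^sub>R gen 2 3 k') + c' *\<^sub>R ?u"
        unfolding supp by blast
      then have "lookup ((1 / 2) *\<^sub>R z) (5, 1) = of_bool k'" by (simp only: last)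
      then show False using z5 by (auto simp: of_bool_def split: if_splits)
    qed
    then have "z = (x + c) *\<^sub>R ?u + y *\<^sub>R ?w" unfolding zk by (simp add: base_def scaleR_add_left)
    then show "z \<in> span {?u, ?w}" unfolding span2_iff by blast
  qed
  then have "cell_dim \<rho> \<le> cell_dim (span {?u, ?w})"
    using u gen_full[of 2 3 False]
    by (intro cell_dim_mono[OF J] span_minimal subspace_euclid) (auto simp: int_lattice_iff)
  also have "\<dots> \<le> card {?u, ?w}"
    unfolding cell_dim_def lin_space_subspace[OF subspace_span] by (rule dim_le_card) auto
  also have "\<dots> \<le> 2" by (rule order_trans[OF card_insert_le_m1]) auto
  finally have td: "tdim \<Delta> \<le> 2" using \<rho>(1) by (simp add: facets_def)
  have small: "cell_dim \<sigma> \<le> 2" if "\<sigma> \<in> cells \<Delta>" for \<sigma>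
  proof -
    have "cell_dim \<sigma> \<le> Max (cell_dim ` cells \<Delta>)" using fin that by (intro Max_ge) auto
    then show ?thesis using td by (simp add: tdim_def)
  qed
  (* the three-dimensional component is W, with direction L *)
  define L where "L = span {?u, ?u', ?w'}"
  define W where "W = (+) (base True) ` L"
  define aff where "aff \<sigma> = (+) (SOME p. p \<in> \<sigma>) ` lin_space \<sigma>" for \<sigma> :: "(nat \<times> nat) rvec set"
  have sub_aff: "\<sigma> \<subseteq> aff \<sigma>" for \<sigma>
  proof
    fix x assume x: "x \<in> \<sigma>"
    then have "(SOME p. p \<in> \<sigma>) \<in> \<sigma>" by (rule someI)
    then have "x - (SOME p. p \<in> \<sigma>) \<in> lin_space \<sigma>" using x by (rule diff_in_lin_space[rotated])
    then show "x \<in> aff \<sigma>" unfolding aff_def by (rule image_eqI[rotated]) simp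
  qed
  have "W \<subseteq> \<Union> (aff ` cells \<Delta>)"
  proof
    fix z assume "z \<in> W"
    then obtain q where q: "q \<in> L" "z = base True + q" by (auto simp: W_def)
    obtain c where "q - c *\<^sub>R ?u \<in> span {?u', ?w'}" using q(1) unfolding L_def span_breakdown_eq[of q ?u] by blast
    then obtain x y where "q - c *\<^sub>R ?u = x *\<^sub>R ?u' + y *\<^sub>R ?w'" unfolding span2_iff by blast
    then have "z = base True + (x *\<^sub>R ?u' + y *\<^sub>R ?w') + c *\<^sub>R ?u" using q(2) by (simp add: algebra_simps)
    then have "z \<in> support \<Delta>" unfolding supp by blast
    then show "z \<in> \<Union> (aff ` cells \<Delta>)" using sub_aff by (auto simp: support_def)
  qed
  moreover have "affine W" "W \<noteq> {}"
    unfolding W_def L_def using span_zero by (auto simp: affine_translation[symmetric] subspace_imp_affine)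
  moreover have "affine (aff \<sigma>)" for \<sigma>
    unfolding aff_def by (simp add: affine_translation[symmetric] subspace_imp_affine subspace_lin_space)
  ultimately obtain \<sigma> where \<sigma>: "\<sigma> \<in> cells \<Delta>" "W \<subseteq> aff \<sigma>"
    using affine_cover[of "aff ` cells \<Delta>" W] fin by auto
  have "L \<subseteq> lin_space \<sigma>"
    using lin_space_mono[OF \<sigma>(2)] unfolding W_def aff_def
    by (simp add: lin_space_translate L_def subspace_lin_space)
  moreover have "lin_space \<sigma> \<subseteq> euclid ?J" by (rule lin_space_euclid[OF complex_cellD(3)[OF pc \<sigma>(1)]])
  ultimately have "dim L \<le> 2"
    using dim_mono_euclid[OF J, of "lin_space \<sigma>" L] small[OF \<sigma>(1)] by (simp add: cell_dim_def)
  moreover have "dim L = 3"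
  proof -
    have w0: "?w' \<noteq> 0" and uw: "?u' \<notin> span {?w'}" and u3: "?u \<notin> span {?u', ?w'}"
    proof -
      have l: "lookup x k = lookup y k" if "x = y" for x y :: "(nat \<times> nat) rvec" and k
        using that by simp
      show "?w' \<noteq> 0"
      proof
        assume "?w' = 0"
        from l[OF this, of "(2, 1)"] show False by (simp add: lookup_gen)
      qed
      show "?u' \<notin> span {?w'}"
      proof
        assume "?u' \<in> span {?w'}"
        then obtain c where "?u' = c *\<^sub>R ?w'" by (auto simp: span_singleton)
        from l[OF this, of "(1, 1)"] show False by (simp add: lookup_gen)
      qed
      show "?u \<notin> span {?u', ?w'}"
      proof
        assume "?u \<in> span {?u', ?w'}"
        then obtain x y where "?u = x *\<^sub>R ?u' + y *\<^sub>R ?w'" unfolding span2_iff by blast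
        from l[OF this, of "(1, 1)"] l[OF this, of "(4, 1)"] show False by (simp add: lookup_gen lookup_add)
      qed
    qed
    have "?u' \<noteq> ?w'" using uw span_base[of ?w' "{?w'}"] by auto
    moreover have "?u \<noteq> ?u'" "?u \<noteq> ?w'" using u3 span_base[of ?u' "{?u', ?w'}"] span_base[of ?w' "{?u', ?w'}"] by auto
    moreover have "independent {?u, ?u', ?w'}"
      using w0 uw u3 calculation by (simp add: independent_insert)
    ultimately show ?thesis unfolding L_def using dim_span_eq_card_independent[of "{?u, ?u', ?w'}"] by simp
  qed
  ultimately show False by simp
qed

section \<open>The mixed degrees\<close>

definition points :: "nat \<Rightarrow> (nat \<times> nat) tropical" where
  "points = (\<lambda>_. unweighted {{0}})"

abbreviation section_cell :: "bool \<Rightarrow> bool \<Rightarrow> bool \<Rightarrow> (nat \<times> nat) rvec set" where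
  "section_cell \<equiv> plane_section {1..5}"

abbreviation ambient :: "(nat \<times> nat) set" where
  "ambient \<equiv> blocks one_dim {1..5}"

lemma finite_space: "finite ambient"
  by (simp add: finite_blocks)

lemma in_space: "i \<in> {1..5} \<Longrightarrow> (i, 1) \<in> ambient"
  by (simp add: mem_blocks)

lemmas section_cell_props = plane_section_props[OF order_refl]

text \<open>
  Two sections of the same kind are recorded by their flags and their weights. The empty complex, which
  arises once both planes are parallel to a hyperplane, is \<open>None\<close>.
\<close>

type_synonym state = "(bool \<times> bool \<times> (bool \<Rightarrow> nat)) option"

fun represents :: "state \<Rightarrow> (nat \<times> nat) tropical \<Rightarrow> bool" where
  "represents None \<Delta> \<longleftrightarrow> cells \<Delta> = {}"
| "represents (Some (s, t, c)) \<Delta> \<longleftrightarrow>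
     cells \<Delta> = range (section_cell s t) \<and> (\<forall>k. weight \<Delta> (section_cell s t k) = c k)"

text \<open>The entry in coordinate \<open>i \<le> 4\<close> of the one generator of plane \<open>k\<close> that does not vanish there.\<close>

definition coefficient :: "nat \<Rightarrow> bool \<Rightarrow> nat" where
  "coefficient i k = (if (i = 1 \<or> i = 2) = k then 1 else 2)"

fun cut :: "nat \<Rightarrow> state \<Rightarrow> state" where
  "cut i None = None"
| "cut i (Some (s, t, c)) =
     (if (i = 1 \<or> i = 4) \<and> s then Some (False, t, \<lambda>k. c k * coefficient i k)
      else if (i = 2 \<or> i = 3) \<and> t then Some (s, False, \<lambda>k. c k * coefficient i k)
      else None)"

lemma represents_flat_family:
  assumes "represents (Some (s, t, c)) \<Delta>"
  shows "flat_family ambient (section_rank {1..5} s t) \<Delta>"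
proof -
  have cl: "cells \<Delta> = range (section_cell s t)" using assms by simp
  have "disjoint (cells \<Delta>)" unfolding cl by (rule disjoint_plane_sections) auto
  moreover have "section_cell s t k \<noteq> {} \<and> affine (section_cell s t k) \<and> closed (section_cell s t k) \<and>
      section_cell s t k \<subseteq> euclid ambient \<and> cell_dim (section_cell s t k) = section_rank {1..5} s t" for k
    by (intro conjI section_cell_props closed_rational_polyhedron[OF section_cell_props(3)]
        rational_polyhedron_in_euclid[OF section_cell_props(3)])
  moreover have "finite (cells \<Delta>)" unfolding cl by simp
  ultimately show ?thesis unfolding flat_family_def cl by blast
qed

lemma flat_hyperplane_section:
  assumes "flat b u w \<subseteq> euclid J" "lookup b i = 0" "lookup w i = 0"
    and "lookup u i \<noteq> 0"
  shows "flat b u w \<inter> euclid (J - {i}) = flat b 0 w"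
proof (intro equalityI subsetI)
  fix z assume z: "z \<in> flat b u w \<inter> euclid (J - {i})"
  then obtain x y where xy: "z = b + (x *\<^sub>R u + y *\<^sub>R w)" by (auto simp: flat_iff)
  have "lookup z i = 0" using z by (simp add: euclid_iff)
  then have "x = 0" using assms(2-4) by (simp add: xy lookup_add)
  then show "z \<in> flat b 0 w" unfolding flat_iff xy by auto
next
  fix z assume "z \<in> flat b 0 w"
  then obtain y where y: "z = b + (0 *\<^sub>R u + y *\<^sub>R w)" by (auto simp: flat_iff)
  then have "z \<in> flat b u w" unfolding flat_iff by blast
  moreover have "lookup z i = 0" using assms(2,3) by (simp add: y lookup_add)
  ultimately show "z \<in> flat b u w \<inter> euclid (J - {i})" using assms(1) by (auto simp: euclid_iff)
qed

text \<open>
  As \<open>u\<close> has an entry \<open>1\<close> where \<open>w\<close> vanishes, a lattice point \<open>xu + yw\<close> of the span has integral \<open>x\<close>.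
  So the \<open>i\<close>-th entries of these lattice points are the multiples of that of \<open>u\<close>.
\<close>

lemma flat_hyperplane_index:
  assumes i: "i \<in> J" and u: "u \<in> int_lattice J" and g: "0 < g" "lookup u i = real g"
    and w: "lookup w i = 0" and j: "lookup u j = 1" "lookup w j = 0"
  shows "subgroup_index (int_lattice J) (sum_set (cell_lattice J (flat b u w)) (int_lattice (J - {i}))) = g"
proof (rule subgroup_index_hyperplane[OF i g(1)])
  show "cell_lattice J (flat b u w) \<subseteq> int_lattice J" by (simp add: cell_lattice_def)
  show "(\<lambda>x. lookup x i) ` cell_lattice J (flat b u w) = range (\<lambda>z::int. real g * of_int z)"
  proof (intro equalityI subsetI)
    fix q assume "q \<in> (\<lambda>x. lookup x i) ` cell_lattice J (flat b u w)"
    then obtain p where p: "p \<in> int_lattice J" "p \<in> span {u, w}" "q = lookup p i"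
      by (auto simp: cell_lattice_def)
    obtain x y where xy: "p = x *\<^sub>R u + y *\<^sub>R w" using p(2) unfolding span2_iff by blast
    have "lookup p j \<in> \<int>" using p(1) by (simp add: int_lattice_iff)
    then have "x \<in> \<int>" using j by (simp add: xy lookup_add)
    then obtain z where "x = of_int z" by (rule Ints_cases)
    then have "q = real g * of_int z" using p(3) g(2) w by (simp add: xy lookup_add)
    then show "q \<in> range (\<lambda>z::int. real g * of_int z)" by blast
  next
    fix q assume "q \<in> range (\<lambda>z::int. real g * of_int z)"
    then obtain z :: int where z: "q = real g * of_int z" by blast
    have "of_int z *\<^sub>R u \<in> cell_lattice J (flat b u w)"
      using int_lattice_scale[OF u, of "of_int z"] span_scale[OF span_base[of u "{u, w}"]]
      by (simp add: cell_lattice_def)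
    moreover have "q = lookup (of_int z *\<^sub>R u) i" using z g(2) by simp
    ultimately show "q \<in> (\<lambda>x. lookup x i) ` cell_lattice J (flat b u w)" by blast
  qed
qed

lemma transverse_flat:
  "transverse i (flat b u w) \<longleftrightarrow> lookup u i \<noteq> 0 \<or> lookup w i \<noteq> 0"
proof
  assume "transverse i (flat b u w)"
  then show "lookup u i \<noteq> 0 \<or> lookup w i \<noteq> 0"
    by (auto simp: transverse_def span2_iff lookup_add)
next
  assume "lookup u i \<noteq> 0 \<or> lookup w i \<noteq> 0"
  then show "transverse i (flat b u w)"
    using span_base[of u "{u, w}"] span_base[of w "{u, w}"] by (auto simp: transverse_def)
qed

lemma section_cell_transverse:
  assumes "i \<in> {1..5}"
  shows "transverse (i, 1) (section_cell s t k) \<longleftrightarrow> (i = 1 \<or> i = 4) \<and> s \<or> (i = 2 \<or> i = 3) \<and> t"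
  by (auto simp: plane_section_full transverse_flat lookup_gen)

lemma section_cell_cut_1_4:
  assumes "i = 1 \<or> i = 4"
  shows "section_cell True t k \<inter> euclid (ambient - {(i, 1)}) = section_cell False t k"
    and "subgroup_index (int_lattice ambient)
       (sum_set (cell_lattice ambient (section_cell True t k)) (int_lattice (ambient - {(i, 1)}))) = coefficient i k"
proof -
  have sub: "section_cell True t k \<subseteq> euclid ambient"
    by (rule rational_polyhedron_in_euclid[OF section_cell_props(3)])
  have "flat (base k) (gen 1 4 k) (if t then gen 2 3 k else 0) \<inter> euclid (ambient - {(i, 1)})
      = flat (base k) 0 (if t then gen 2 3 k else 0)"
    by (rule flat_hyperplane_section)
      (use sub assms in \<open>auto simp: plane_section_full lookup_gen base_def lookup_single\<close>)
  then show "section_cell True t k \<inter> euclid (ambient - {(i, 1)}) = section_cell False t k"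
    by (simp add: plane_section_full)
  have "subgroup_index (int_lattice ambient)
       (sum_set (cell_lattice ambient (flat (base k) (gen 1 4 k) (if t then gen 2 3 k else 0)))
         (int_lattice (ambient - {(i, 1)}))) = coefficient i k"
    by (rule flat_hyperplane_index[where j = "(if k then 1 else 4, 1)"])
      (use assms gen_full[of 1 4 k] in \<open>auto simp: lookup_gen coefficient_def in_space\<close>)
  then show "subgroup_index (int_lattice ambient)
       (sum_set (cell_lattice ambient (section_cell True t k)) (int_lattice (ambient - {(i, 1)}))) = coefficient i k"
    by (simp add: plane_section_full)
qed

lemma section_cell_cut_2_3:
  assumes "i = 2 \<or> i = 3"
  shows "section_cell s True k \<inter> euclid (ambient - {(i, 1)}) = section_cell s False k"
    and "subgroup_index (int_lattice ambient)
       (sum_set (cell_lattice ambient (section_cell s True k)) (int_lattice (ambient - {(i, 1)}))) = coefficient i k"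
proof -
  have sub: "section_cell s True k \<subseteq> euclid ambient"
    by (rule rational_polyhedron_in_euclid[OF section_cell_props(3)])
  have "flat (base k) (gen 2 3 k) (if s then gen 1 4 k else 0) \<inter> euclid (ambient - {(i, 1)})
      = flat (base k) 0 (if s then gen 1 4 k else 0)"
    by (rule flat_hyperplane_section)
      (use sub assms in \<open>auto simp: plane_section_full lookup_gen base_def lookup_single flat_swap[of _ "gen 2 3 k"]\<close>)
  then show "section_cell s True k \<inter> euclid (ambient - {(i, 1)}) = section_cell s False k"
    by (simp add: plane_section_full flat_swap[of _ "gen 2 3 k"] flat_swap[of _ 0])
  have "subgroup_index (int_lattice ambient)
       (sum_set (cell_lattice ambient (flat (base k) (gen 2 3 k) (if s then gen 1 4 k else 0)))
         (int_lattice (ambient - {(i, 1)}))) = coefficient i k"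
    by (rule flat_hyperplane_index[where j = "(if k then 2 else 3, 1)"])
      (use assms gen_full[of 2 3 k] in \<open>auto simp: lookup_gen coefficient_def in_space\<close>)
  then show "subgroup_index (int_lattice ambient)
       (sum_set (cell_lattice ambient (section_cell s True k)) (int_lattice (ambient - {(i, 1)}))) = coefficient i k"
    by (simp add: plane_section_full flat_swap[of _ "gen 2 3 k"])
qed

lemma represents_cut:
  assumes i: "i \<in> {1..5}" and E: "cells E = {euclid (ambient - {(i, 1)})}" "weight E (euclid (ambient - {(i, 1)})) = 1"
    and \<Delta>: "represents st \<Delta>"
  shows "represents (cut i st) (stable_intersection ambient \<Delta> E)"
proof (cases st)
  case None
  then show ?thesis using \<Delta> stable_intersection_empty[of \<Delta> E ambient] by simp
next
  case (Some x)
  obtain s t c where x: "x = (s, t, c)" using prod_cases3 by blast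
  have st: "represents (Some (s, t, c)) \<Delta>" using \<Delta> by (simp add: Some x)
  then have cl: "cells \<Delta> = range (section_cell s t)" and wt: "\<And>k. weight \<Delta> (section_cell s t k) = c k" by auto
  note SI = stable_intersection_hyperplane[OF finite_space in_space[OF i] represents_flat_family[OF st] E(1)]
  let ?H = "euclid (ambient - {(i, 1)})"
  show ?thesis
  proof (cases "(i = 1 \<or> i = 4) \<and> s \<or> (i = 2 \<or> i = 3) \<and> t")
    case False
    then have "cells (stable_intersection ambient \<Delta> E) = {}"
      unfolding SI(1) cl by (auto simp: section_cell_transverse[OF i])
    moreover have "cut i (Some (s, t, c)) = None" using False by auto
    ultimately show ?thesis unfolding Some x by simp
  next
    case True
    then have tr: "transverse (i, 1) (section_cell s t k)" for k by (simp add: section_cell_transverse[OF i])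
    then have cells': "cells (stable_intersection ambient \<Delta> E) = range (\<lambda>k. section_cell s t k \<inter> ?H)"
      unfolding SI(1) cl by auto
    have weight': "weight (stable_intersection ambient \<Delta> E) (section_cell s t k \<inter> ?H)
        = c k * subgroup_index (int_lattice ambient) (sum_set (cell_lattice ambient (section_cell s t k)) (int_lattice (ambient - {(i, 1)})))" for k
      using SI(2)[of "section_cell s t k"] tr[of k] by (simp add: cl wt E(2))
    show ?thesis
    proof (cases "i = 1 \<or> i = 4")
      case i14: True
      then have "s" using True by auto
      then show ?thesis
        using cells' weight' i14 section_cell_cut_1_4[OF i14] by (simp add: Some x)
    next
      case i14: False
      then have i23: "i = 2 \<or> i = 3" and "t" using True by auto
      then show ?thesis
        using cells' weight' i14 section_cell_cut_2_3[OF i23] by (simp add: Some x)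
    qed
  qed
qed

lemma represents_whole_space:
  assumes E: "E = whole_space ambient" and \<Delta>: "represents st \<Delta>"
  shows "represents st (stable_intersection ambient \<Delta> E)"
proof (cases st)
  case None
  then show ?thesis using \<Delta> stable_intersection_empty[of \<Delta> E ambient] by simp
next
  case (Some x)
  obtain s t c where x: "x = (s, t, c)" using prod_cases3 by blast
  have st: "represents (Some (s, t, c)) \<Delta>" using \<Delta> by (simp add: Some x)
  then show ?thesis
    using stable_intersection_whole_space[OF finite_space represents_flat_family[OF st]]
    by (simp add: Some x E)
qed

lemma pullback_points:
  assumes i: "i \<in> {1..5}"
  shows "cells (pullback 5 one_dim i (points i)) = {euclid (ambient - {(i, 1)})}"
    and "weight (pullback 5 one_dim i (points i)) \<sigma> = 1"
proof -
  have "proj one_dim {i} x = 0 \<longleftrightarrow> lookup x (i, 1) = 0" for x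
  proof
    assume z: "proj one_dim {i} x = 0"
    have "lookup (proj one_dim {i} x) (i, 1) = 0" by (simp add: z)
    then show "lookup x (i, 1) = 0" by (simp add: lookup_proj)
  next
    assume z: "lookup x (i, 1) = 0"
    show "proj one_dim {i} x = 0"
    proof (rule poly_mapping_eqI)
      fix p show "lookup (proj one_dim {i} x) p = lookup 0 p"
        using z by (cases p) (simp add: lookup_proj)
    qed
  qed
  note zero = this
  have "{x \<in> euclid ambient. proj one_dim {i} x \<in> {0}} = euclid (ambient - {(i, 1)})"
    unfolding singleton_iff zero by (auto simp: euclid_iff)
  then show "cells (pullback 5 one_dim i (points i)) = {euclid (ambient - {(i, 1)})}"
    by (simp add: pullback_def points_def)
  show "weight (pullback 5 one_dim i (points i)) \<sigma> = 1" by (simp add: pullback_def points_def)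
qed

lemma stable_power_points_1:
  assumes i: "i \<in> {1..5}"
  defines "E \<equiv> stable_power ambient (pullback 5 one_dim i (points i)) 1"
  shows "cells E = {euclid (ambient - {(i, 1)})}" "weight E (euclid (ambient - {(i, 1)})) = 1"
proof -
  let ?D = "pullback 5 one_dim i (points i)" and ?W = "whole_space ambient :: (nat \<times> nat) tropical"
  have E: "E = stable_intersection ambient ?W ?D" by (simp add: E_def One_nat_def)
  note SI = stable_intersection_hyperplane[OF finite_space in_space[OF i] flat_family_whole_space[OF finite_space]
      pullback_points(1)[OF i]]
  have tr: "transverse (i, 1) (euclid ambient)"
    unfolding transverse_def lin_space_subspace[OF subspace_euclid]
    using in_space[OF i] by (intro bexI[of _ "single (i, 1) 1"]) (simp_all add: single_in_euclid)
  have cW: "cells ?W = {euclid ambient}" by (simp add: whole_space_def)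
  have H: "euclid ambient \<inter> euclid (ambient - {(i, 1)}) = euclid (ambient - {(i, 1)})" by (auto simp: euclid_iff)
  show "cells E = {euclid (ambient - {(i, 1)})}" unfolding E SI(1) cW using tr H by auto
  have "cell_lattice ambient (euclid ambient) = int_lattice ambient"
    unfolding cell_lattice_def lin_space_subspace[OF subspace_euclid] int_lattice_def by blast
  moreover have "subgroup_index (int_lattice ambient) (sum_set (int_lattice ambient) (int_lattice (ambient - {(i, 1)}))) = 1"
  proof (rule subgroup_index_hyperplane[OF in_space[OF i]])
    show "(\<lambda>x. lookup x (i, 1)) ` int_lattice ambient = range (\<lambda>z::int. real 1 * of_int z)"
    proof (intro equalityI subsetI)
      fix q assume "q \<in> (\<lambda>x. lookup x (i, 1)) ` int_lattice ambient"
      then have "q \<in> \<int>" by (auto simp: int_lattice_iff)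
      then show "q \<in> range (\<lambda>z::int. real 1 * of_int z)" by (auto elim: Ints_cases)
    next
      fix q assume "q \<in> range (\<lambda>z::int. real 1 * of_int z)"
      then obtain z :: int where "q = of_int z" by auto
      then have "q = lookup (single (i, 1) q) (i, 1)" "q \<in> \<int>" by auto
      then show "q \<in> (\<lambda>x. lookup x (i, 1)) ` int_lattice ambient"
        using int_lattice_single[OF in_space[OF i], of q] by blast
    qed
  qed auto
  ultimately show "weight E (euclid (ambient - {(i, 1)})) = 1"
    using SI(2)[of "euclid ambient"] tr cW H pullback_points(2)[OF i]
    by (simp add: E whole_space_def)
qed

text \<open>A hyperplane is parallel to itself, so its stable self-intersection is empty.\<close>

lemma stable_power_points_ge_2:
  assumes i: "i \<in> {1..5}"
  shows "cells (stable_power ambient (pullback 5 one_dim i (points i)) (Suc (Suc r))) = {}"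
proof (induction r)
  case 0
  let ?D = "pullback 5 one_dim i (points i)"
  define E where "E = stable_power ambient ?D 1"
  have E: "cells E = {euclid (ambient - {(i, 1)})}" using stable_power_points_1(1)[OF i] by (simp add: E_def)
  have "closed (euclid (ambient - {(i, 1)}))"
    using flat_family_whole_space[of "ambient - {(i, 1)}"] finite_space by (simp add: flat_family_def whole_space_def)
  then have ff: "flat_family ambient (cell_dim (euclid (ambient - {(i, 1)}))) E"
    using subspace_0[OF subspace_euclid, of "ambient - {(i, 1)}"]
    by (auto simp: flat_family_def E disjoint_def subspace_imp_affine subspace_euclid intro: subsetD[OF euclid_mono, rotated])
  have "\<not> transverse (i, 1) (euclid (ambient - {(i, 1)}))"
    unfolding transverse_def lin_space_subspace[OF subspace_euclid] by (auto simp: euclid_iff)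
  then have "cells (stable_intersection ambient E ?D) = {}"
    unfolding stable_intersection_hyperplane(1)[OF finite_space in_space[OF i] ff pullback_points(1)[OF i]]
    using E by auto
  then show ?case by (simp add: E_def One_nat_def)
next
  case (Suc r)
  then show ?case
    unfolding stable_power.simps(2)[of _ _ "Suc (Suc r)"] by (intro stable_intersection_empty disjI1)
qed

definition cut_power :: "nat \<Rightarrow> nat \<Rightarrow> state \<Rightarrow> state" where
  "cut_power i r st = (if r = 0 then st else if r = 1 then cut i st else None)"

lemma represents_cut_power:
  assumes i: "i \<in> {1..5}" and \<Delta>: "represents st \<Delta>"
  shows "represents (cut_power i r st)
    (stable_intersection ambient \<Delta> (stable_power ambient (pullback 5 one_dim i (points i)) r))"
proof -
  consider "r = 0" | "r = 1" | q where "r = Suc (Suc q)"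
    by (metis One_nat_def not0_implies_Suc)
  then show ?thesis
  proof cases
    case 1
    then show ?thesis using represents_whole_space[OF _ \<Delta>] by (simp add: cut_power_def)
  next
    case 2
    then show ?thesis using represents_cut[OF i stable_power_points_1[OF i] \<Delta>] by (simp add: cut_power_def)
  next
    case 3
    have "represents None (stable_intersection ambient \<Delta> (stable_power ambient (pullback 5 one_dim i (points i)) r))"
      using stable_intersection_empty[of \<Delta>] stable_power_points_ge_2[OF i, of q] 3 by (simp del: stable_power.simps)
    then show ?thesis using 3 by (simp add: cut_power_def One_nat_def)
  qed
qed

fun state_degree :: "state \<Rightarrow> nat" where
  "state_degree None = 0"
| "state_degree (Some (s, t, c)) = c False + c True"

lemma degree_represents:
  assumes "represents st \<Delta>"
  shows "tropical_degree \<Delta> = state_degree st"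
proof (cases st)
  case None
  then show ?thesis using assms by (simp add: tropical_degree_def facets_def)
next
  case (Some x)
  obtain s t c where x: "x = (s, t, c)" using prod_cases3 by blast
  have st: "represents (Some (s, t, c)) \<Delta>" using assms by (simp add: Some x)
  have "facets \<Delta> = {section_cell s t False, section_cell s t True}"
    using facets_flat_family[OF represents_flat_family[OF st]] st by (auto simp: UNIV_bool)
  moreover have "section_cell s t False \<noteq> section_cell s t True" using plane_sections_disjoint[of "{1..5}" False True s t] section_cell_props(1) by auto
  ultimately show ?thesis using st by (simp add: tropical_degree_def Some x)
qed

lemma multidegree_two_planes:
  "multidegree 5 one_dim two_planes points n =
     state_degree (foldl (\<lambda>st i. cut_power i (lookup n i) st) (Some (True, True, \<lambda>_. 1)) [1..<Suc 5])"
proof -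
  have fold: "represents (foldl (\<lambda>st i. cut_power i (lookup n i) st) st is)
      (foldl (\<lambda>\<Delta> i. stable_intersection ambient \<Delta>
          (stable_power ambient (pullback 5 one_dim i (points i)) (lookup n i))) \<Delta> is)"
    if "represents st \<Delta>" "set is \<subseteq> {1..5}" for st \<Delta> "is"
    using that
  proof (induction "is" arbitrary: st \<Delta>)
    case (Cons i "is")
    then have "i \<in> {1..5}" "set is \<subseteq> {1..5}" by auto
    then show ?case
      unfolding foldl_Cons using Cons.prems(1) by (intro Cons.IH represents_cut_power)
  qed simp
  have "represents (Some (True, True, \<lambda>_. 1)) two_planes"
    by (auto simp: two_planes_def plane_section_full)
  then show ?thesis
    unfolding multidegree_def Let_def by (intro degree_represents fold) auto
qed

section \<open>The volume polynomial is not Lorentzian\<close>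

text \<open>Needed because a sum over an infinite set of exponents would be zero by convention.\<close>

lemma finite_exponents: "finite (exponents p d)"
proof -
  let ?f = "\<lambda>n :: nat \<Rightarrow>\<^sub>0 nat. restrict (lookup n) {1..p}"
  have "?f ` exponents p d \<subseteq> {1..p} \<rightarrow>\<^sub>E {..d}"
  proof
    fix f assume "f \<in> ?f ` exponents p d"
    then obtain n where n: "n \<in> exponents p d" "f = ?f n" by blast
    have "lookup n i \<le> d" if "i \<in> {1..p}" for i
      using member_le_sum[OF that, of "lookup n"] n(1) by (simp add: exponents_def)
    then show "f \<in> {1..p} \<rightarrow>\<^sub>E {..d}" unfolding n(2) by auto
  qed
  then have "finite (?f ` exponents p d)" by (rule finite_subset) (intro finite_PiE, auto)
  moreover have "inj_on ?f (exponents p d)"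
  proof (rule inj_onI)
    fix n n' assume nn: "n \<in> exponents p d" "n' \<in> exponents p d" "?f n = ?f n'"
    show "n = n'"
    proof (rule poly_mapping_eqI)
      fix i
      show "lookup n i = lookup n' i"
      proof (cases "i \<in> {1..p}")
        case True
        then show ?thesis using fun_cong[OF nn(3), of i] by simp
      next
        case False
        then have "i \<notin> Poly_Mapping.keys n" "i \<notin> Poly_Mapping.keys n'" using nn(1,2) by (auto simp: exponents_def)
        then show ?thesis by (simp add: in_keys_iff)
      qed
    qed
  qed
  ultimately show ?thesis by (rule finite_imageD)
qed

lemma lookup_tvol:
  "lookup (tvol p m \<Gamma> \<Lambda>) n =
     (if n \<in> exponents p (tdim \<Gamma>)
      then fact (tdim \<Gamma>) / (\<Prod>i=1..p. fact (lookup n i)) * real (multidegree p m \<Gamma> \<Lambda> n) else 0)"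
  unfolding tvol_def using finite_exponents
  by (simp add: lookup_sum lookup_single when_def)

text \<open>The matrix of \<open>10 (t\<^sub>1 t\<^sub>2 + t\<^sub>3 t\<^sub>4) + 8 (t\<^sub>1 t\<^sub>3 + t\<^sub>2 t\<^sub>4)\<close>, with indices starting at 0.\<close>

definition degree_matrix :: "nat \<Rightarrow> nat \<Rightarrow> real" where
  "degree_matrix i j =
     (if {i, j} = {0, 1} \<or> {i, j} = {2, 3} then 5
      else if {i, j} = {0, 2} \<or> {i, j} = {1, 3} then 4 else 0)"

lemma less_5_cases:
  assumes "(i::nat) < 5"
  obtains "i = 0" | "i = 1" | "i = 2" | "i = 3" | "i = 4"
  using assms by linarith

lemma interval_1_5: "{1..5} = {1, 2, 3, 4, 5 :: nat}"
  by auto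

lemma quadratic_form_two_planes:
  assumes "i < 5" "j < 5"
  shows "quadratic_form_mat 5 (tvol 5 one_dim two_planes points) $$ (i, j) = degree_matrix i j"
proof -
  define n where "n = single (Suc i) (1::nat) + single (Suc j) 1"
  have l: "lookup n a = of_bool (a = Suc i) + of_bool (a = Suc j)" for a
    by (simp add: n_def lookup_add lookup_single when_def)
  have "n \<in> exponents 5 2"
  proof -
    have "Poly_Mapping.keys n \<subseteq> {1..5}" using assms by (auto simp: in_keys_iff l split: if_splits)
    moreover have "(\<Sum>a=1..5. lookup n a) = 2"
      using assms by (simp add: l sum.distrib)
    ultimately show ?thesis by (simp add: exponents_def)
  qed
  then have q: "quadratic_form_mat 5 (tvol 5 one_dim two_planes points) $$ (i, j)
     = fact 2 / (\<Prod>a=1..5. fact (lookup n a)) * real (multidegree 5 one_dim two_planes points n)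
        / (if i = j then 1 else 2)"
    using assms by (simp add: quadratic_form_mat_def lookup_tvol two_planes_tdim n_def)
  have upt: "[1..<Suc 5] = [1, 2, 3, 4, 5 :: nat]" by (simp add: upt_rec)
  show ?thesis
    unfolding q multidegree_two_planes upt
    by (rule less_5_cases[OF assms(1)]; rule less_5_cases[OF assms(2)])
       (simp_all add: l cut_power_def coefficient_def degree_matrix_def interval_1_5 doubleton_eq_iff fact_numeral)
qed

lemma quadratic_form_carrier: "quadratic_form_mat 5 h \<in> carrier_mat 5 5"
  by (simp add: quadratic_form_mat_def)

text \<open>The eigenvectors are \<open>(1, 1, 1, 1, 0)\<close> for \<open>9 = 5 + 4\<close> and \<open>(1, 1, -1, -1, 0)\<close> for \<open>1 = 5 - 4\<close>.\<close>

lemma eigenvalues_two_planes: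
  fixes k s :: real
  assumes "k = 9 \<and> s = 1 \<or> k = 1 \<and> s = - 1"
  shows "eigenvalue (quadratic_form_mat 5 (tvol 5 one_dim two_planes points)) k"
proof -
  let ?A = "quadratic_form_mat 5 (tvol 5 one_dim two_planes points)"
  define v where "v = vec 5 (\<lambda>i. if i < 2 then 1 else if i < 4 then s else 0)"
  have "?A *\<^sub>v v = k \<cdot>\<^sub>v v"
  proof (rule eq_vecI)
    fix i assume "i < dim_vec (k \<cdot>\<^sub>v v)"
    then have i: "i < 5" by (simp add: v_def)
    have "(?A *\<^sub>v v) $ i = (\<Sum>j = 0..<5. degree_matrix i j * v $ j)"
      using i quadratic_form_carrier[of "tvol 5 one_dim two_planes points"] quadratic_form_two_planes[OF i]
      by (simp add: scalar_prod_def v_def)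
    also have "\<dots> = (\<Sum>j\<in>{0, 1, 2, 3, 4}. degree_matrix i j * v $ j)"
      by (rule sum.cong) auto
    also have "\<dots> = (k \<cdot>\<^sub>v v) $ i"
      by (rule less_5_cases[OF i]; insert assms; elim disjE conjE;
          simp add: degree_matrix_def v_def doubleton_eq_iff)
    finally show "(?A *\<^sub>v v) $ i = (k \<cdot>\<^sub>v v) $ i" .
  qed (simp add: v_def quadratic_form_mat_def)
  moreover have "v \<noteq> 0\<^sub>v 5"
  proof
    assume "v = 0\<^sub>v 5"
    then have "v $ 0 = 0\<^sub>v 5 $ 0" by simp
    then show False by (simp add: v_def)
  qed
  moreover have "v \<in> carrier_vec 5" by (simp add: v_def)
  ultimately show ?thesis
    unfolding eigenvalue_def eigenvector_def using quadratic_form_carrier by (metis carrier_matD(1))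
qed

lemma two_positive_eigenvalues:
  assumes A: "(A :: real mat) \<in> carrier_mat n n" and a: "eigenvalue A a" "0 < a"
    and b: "eigenvalue A b" "0 < b" and ne: "a \<noteq> b"
  shows "2 \<le> num_pos_eigenvalues A"
proof -
  have nz: "char_poly A \<noteq> 0" using degree_monic_char_poly[OF A] by auto
  let ?S = "{k. eigenvalue A k \<and> 0 < k}"
  have "?S \<subseteq> {k. poly (char_poly A) k = 0}" using eigenvalue_root_char_poly[OF A] by auto
  then have fin: "finite ?S" using poly_roots_finite[OF nz] finite_subset by blast
  have pos: "1 \<le> Polynomial.order k (char_poly A)" if "k \<in> ?S" for k
    using that eigenvalue_root_char_poly[OF A] order_gt_0_iff[OF nz, of k] by (simp add: Suc_le_eq One_nat_def)
  have "2 = card {a, b}" using ne by simp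
  also have "\<dots> \<le> card ?S" using fin a b by (intro card_mono) auto
  also have "\<dots> \<le> (\<Sum>k\<in>?S. Polynomial.order k (char_poly A))"
    using sum_mono[of ?S "\<lambda>_. 1" "\<lambda>k. Polynomial.order k (char_poly A)"] pos by simp
  finally show ?thesis unfolding num_pos_eigenvalues_def .
qed

lemma two_planes_not_lorentzian:
  "\<not> lorentzian 5 (tdim two_planes) (tvol 5 one_dim two_planes points)"
proof
  assume "lorentzian 5 (tdim two_planes) (tvol 5 one_dim two_planes points)"
  then have *: "\<forall>is. length is + 2 = tdim two_planes \<and> sorted is \<and> set is \<subseteq> {1..5} \<longrightarrow>
     num_pos_eigenvalues (quadratic_form_mat 5 (foldr partial_deriv is (tvol 5 one_dim two_planes points))) \<le> 1"
    unfolding lorentzian_def by blast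
  have "num_pos_eigenvalues (quadratic_form_mat 5 (tvol 5 one_dim two_planes points)) \<le> 1"
    using *[rule_format, of "[]"] by (simp add: two_planes_tdim)
  moreover have "2 \<le> num_pos_eigenvalues (quadratic_form_mat 5 (tvol 5 one_dim two_planes points))"
    by (rule two_positive_eigenvalues[OF quadratic_form_carrier eigenvalues_two_planes[of 9 1] _
        eigenvalues_two_planes[of 1 "- 1"]]) auto
  ultimately show False by simp
qed

lemma points_positive: "positive_divisor (blocks one_dim {i}) (points i)"
proof -
  have "blocks one_dim {i} = {(i, 1)}" by (auto simp: blocks_def one_dim_def)
  then show ?thesis unfolding points_def using positive_divisor_origin by simp
qed

theorem proposition4p2:
  shows "\<exists>(p :: nat) (m :: nat \<Rightarrow> nat) (\<Gamma> :: (nat \<times> nat) tropical)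
            (\<Lambda> :: nat \<Rightarrow> (nat \<times> nat) tropical).
           0 < p \<and> (\<forall>i\<in>{1..p}. 0 < m i) \<and>
           tropical_variety (blocks m {1..p}) \<Gamma> \<and>
           projection_pure p m \<Gamma> \<and>
           facet_selectable p m \<Gamma> \<and>
           \<not> translation_admissible (blocks m {1..p}) \<Gamma> \<and>
           (\<forall>i\<in>{1..p}. positive_divisor (blocks m {i}) (\<Lambda> i)) \<and>
           \<not> lorentzian p (tdim \<Gamma>) (tvol p m \<Gamma> \<Lambda>)"
  by (intro exI[of _ 5] exI[of _ one_dim] exI[of _ two_planes] exI[of _ points] conjI ballI
      two_planes_tropical two_planes_projection_pure two_planes_facet_selectable
      two_planes_not_admissible two_planes_not_lorentzian points_positive)
     (simp_all add: one_dim_def)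

end
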